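(* Let $1<p<\infty$ and let $N\ge 2$ be an integer. Then there is a unique $k=k(p,N)<0$ for which there exists a function $f:[0,\pi/2]\to\mathbb{R}$ such that (i) $f$ is positive on $[0,\pi/2)$ and decreasing on $[0,\pi/2]$; (ii) $f\in C^2[0,\pi/2]$; (iii) $f(0)=1$, $f'(0)=0$, $f(\pi/2)=0$ and $-\infty<f'(\pi/2)<0$; and the quasiradial function $r^kf(\theta)$ is $p$-harmonic in $\mathbb{R}^N_+$.
   Context: $\mathbb{R}^N_+=\{(x',x_N): x'\in\mathbb{R}^{N-1},\ x_N>0\}$. For $x\in\mathbb{R}^N_+$, $r=|x|$ and $\theta\in[0,\pi/2)$ is the angle between $x$ and the positive $x_N$-axis, so $\cos\theta=x_N/|x|$. A function is $p$-harmonic in a domain if it is a continuous weak solution in $W^{1,p}_{\mathrm{loc}}$ of $\mathrm{div}(|\nabla u|^{p-2}\nabla u)=0$. *)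

theory Defs
  imports "HOL-Analysis.Analysis"
begin

definition grad :: "('a::euclidean_space \<Rightarrow> real) \<Rightarrow> 'a \<Rightarrow> 'a" where
  "grad f x = (\<Sum>b\<in>Basis. frechet_derivative f (at x) b *\<^sub>R b)"

primrec Ck :: "nat \<Rightarrow> ('a::euclidean_space \<Rightarrow> real) \<Rightarrow> bool" where
  "Ck 0 f \<longleftrightarrow> continuous_on UNIV f"
| "Ck (Suc n) f \<longleftrightarrow> (\<forall>x. f differentiable (at x)) \<and> (\<forall>b\<in>Basis. Ck n (\<lambda>x. grad f x \<bullet> b))"

(* C_c^\<infinity>(\<Omega>), with functions extended by zero to the whole space. *)
definition test_fun :: "'a::euclidean_space set \<Rightarrow> ('a \<Rightarrow> real) set" where
  "test_fun \<Omega> = {\<phi>. (\<forall>n. Ck n \<phi>) \<and> compact (closure {x. \<phi> x \<noteq> 0}) \<and> closure {x. \<phi> x \<noteq> 0} \<subseteq> \<Omega>}"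

definition Lp_loc :: "real \<Rightarrow> 'a::euclidean_space set \<Rightarrow> ('a \<Rightarrow> 'b::euclidean_space) \<Rightarrow> bool" where
  "Lp_loc p \<Omega> g \<longleftrightarrow> g \<in> borel_measurable (lebesgue_on \<Omega>) \<and>
     (\<forall>K. compact K \<and> K \<subseteq> \<Omega> \<longrightarrow> integrable (lebesgue_on K) (\<lambda>x. norm (g x) powr p))"

(* The requirement of local integrability matters: the Bochner integral of a
   non-integrable function is 0 by convention. *)
definition weak_gradient :: "'a::euclidean_space set \<Rightarrow> ('a \<Rightarrow> real) \<Rightarrow> ('a \<Rightarrow> 'a) \<Rightarrow> bool" where
  "weak_gradient \<Omega> u G \<longleftrightarrow> Lp_loc 1 \<Omega> u \<and> Lp_loc 1 \<Omega> G \<and>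
     (\<forall>\<phi>\<in>test_fun \<Omega>. (LINT x|lebesgue_on \<Omega>. u x *\<^sub>R grad \<phi> x) = - (LINT x|lebesgue_on \<Omega>. \<phi> x *\<^sub>R G x))"

(* To be used for a domain (open connected set) \<Omega> and 1 < p. The values of u outside
   \<Omega> are irrelevant. G is the weak gradient of u, unique up to null sets, so that u, G
   locally in L^p says that u is in W^{1,p}_loc. Where G x = 0 the field
   |G|^{p-2} G is 0, also for p < 2. *)
definition p_harmonic :: "real \<Rightarrow> 'a::euclidean_space set \<Rightarrow> ('a \<Rightarrow> real) \<Rightarrow> bool" where
  "p_harmonic p \<Omega> u \<longleftrightarrow> continuous_on \<Omega> u \<and> Lp_loc p \<Omega> u \<and>
     (\<exists>G. weak_gradient \<Omega> u G \<and> Lp_loc p \<Omega> G \<and>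
        (\<forall>\<phi>\<in>test_fun \<Omega>.
           (LINT x|lebesgue_on \<Omega>. (norm (G x) powr (p - 2) *\<^sub>R G x) \<bullet> grad \<phi> x) = 0))"

(* The index i plays the role of the last coordinate N. *)
definition half_space :: "'n::finite \<Rightarrow> (real ^ 'n) set" where
  "half_space i = {x. x $ i > 0}"

definition polar_angle :: "'n::finite \<Rightarrow> real ^ 'n \<Rightarrow> real" where
  "polar_angle i x = arccos (x $ i / norm x)"

definition quasiradial :: "'n::finite \<Rightarrow> real \<Rightarrow> (real \<Rightarrow> real) \<Rightarrow> real ^ 'n \<Rightarrow> real" where
  "quasiradial i k f x = norm x powr k * f (polar_angle i x)"

(* C^2 on an interval S; derivatives at endpoints belonging to S are one-sided. *)
definition C2_on :: "real set \<Rightarrow> (real \<Rightarrow> real) \<Rightarrow> bool" where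
  "C2_on S f \<longleftrightarrow> (\<exists>f' f''.
     (\<forall>t\<in>S. (f has_real_derivative f' t) (at t within S)) \<and>
     (\<forall>t\<in>S. (f' has_real_derivative f'' t) (at t within S)) \<and>
     continuous_on S f'')"

end

(* Write u = r^k f(theta) and V = k^2 f^2 + f'^2. Off the axis grad u = r^(k-1) (k f e_r + f' e_theta)
   never vanishes and |grad u|^(p-2) grad u is a C^1 field r^a (P e_r + Q e_theta), so u is p-harmonic
   iff the divergence of this field vanishes, which is an ordinary differential equation for f.
   The axis is a null set that almost every line parallel to a coordinate direction meets at most
   once; this is all that integration by parts across it needs.

   Existence: with beta = -k, f = R cos psi and f' = -beta R sin psi the equation becomes first order for
   psi, singular at 0, and one shoots for psi(pi/2) = pi/2. The singular problem is solved by a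
   contraction, and all estimates, including the continuity in beta, come from sub- and supersolutions
   (0, C t, arctan (m t), t).

   Uniqueness: the slope y = -f'/(beta f) has y'(0) and, at a given value, y' increasing in beta, so two
   solutions with beta_1 < beta_2 satisfy y_1 < y_2; but y ~ 1/(beta (pi/2 - theta)) at pi/2. *)

theory Submission
  imports Defs "HOL-Computational_Algebra.Polynomial"
begin

text \<open>For p < 2 the factor |grad u|^(p-2) blows up where the gradient vanishes. This never
  happens: f > 0 before pi/2 and f'(pi/2) is nonzero, so V is positive on the closed interval and
  one argument serves all p > 1. Near the axis the obstacle is the division by sin theta in the
  polar part of a field; the estimate Q = O(sin theta) makes the field continuous there and its
  derivatives bounded nearby. As \<open>p_harmonic\<close> admits any weak gradient, the passage to
  the differential equation also needs that the weak gradient is unique almost everywhere.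

  The slope y = tan psi has a pole at pi/2, which shapes both halves. Existence works with psi,
  which stays in [0, pi/2]; uniqueness works with the difference of the two slopes multiplied by k l
  f g, which is differentiable up to pi/2. The shooting interval starts at the threshold under which
  psi would leave 0 downwards (or at 0, if that is larger) and ends where psi(t) \<ge> t can be
  forced. The term cot t times a nonlinear function of psi is Lipschitz only for psi = O(t), hence a
  truncation that is afterwards shown to be inactive.\<close>

section \<open>Gradients and the classes \<open>Ck\<close>\<close>

lemma grad_inner_Basis:
  assumes "b \<in> Basis"
  shows "grad f x \<bullet> b = frechet_derivative f (at x) b"
  using assms by (simp add: grad_def inner_sum_left inner_Basis if_distrib cong: if_cong)

lemma grad_inner:
  assumes "f differentiable (at x)"
  shows "grad f x \<bullet> v = frechet_derivative f (at x) v"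
proof -
  interpret linear "frechet_derivative f (at x)"
    using assms by (rule linear_frechet_derivative)
  have "frechet_derivative f (at x) v = frechet_derivative f (at x) (\<Sum>b\<in>Basis. (v \<bullet> b) *\<^sub>R b)"
    by (simp add: euclidean_representation)
  also have "\<dots> = (\<Sum>b\<in>Basis. (v \<bullet> b) *\<^sub>R frechet_derivative f (at x) b)"
    by (simp add: sum scale)
  finally show ?thesis
    by (simp add: grad_def inner_sum_left inner_sum_right inner_commute[of _ v] mult.commute)
qed

lemma grad_eqI:
  assumes "(f has_derivative (\<lambda>h. v \<bullet> h)) (at x)"
  shows "grad f x = v"
proof -
  have "grad f x \<bullet> b = v \<bullet> b" if "b \<in> Basis" for b
    using frechet_derivative_at[OF assms] that by (metis grad_inner_Basis)
  then show ?thesis by (simp add: euclidean_eq_iff[of "grad f x"])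
qed

lemma has_derivative_grad:
  assumes "f differentiable (at x)"
  shows "(f has_derivative (\<lambda>h. grad f x \<bullet> h)) (at x)"
  using assms frechet_derivative_works[of f "at x"]
  by (simp add: grad_inner)

lemma Ck_mono: "Ck (Suc n) f \<Longrightarrow> Ck n f"
proof (induction n arbitrary: f)
  case 0
  then have "f differentiable_on UNIV"
    by (simp add: differentiable_on_def)
  then show ?case
    by (simp add: differentiable_imp_continuous_on)
next
  case (Suc n)
  then show ?case by (metis Ck.simps(2))
qed

lemma Ck_const: "Ck n (\<lambda>x. c)"
proof (induction n arbitrary: c)
  case (Suc n)
  have "grad (\<lambda>x. c) x = 0" for x :: 'a
    by (rule grad_eqI) simp
  then show ?case using Suc by simp
qed simp

lemma Ck_add: "Ck n f \<Longrightarrow> Ck n g \<Longrightarrow> Ck n (\<lambda>x. f x + g x)"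
proof (induction n arbitrary: f g)
  case 0
  then show ?case by (simp add: continuous_on_add)
next
  case (Suc n)
  have "grad (\<lambda>x. f x + g x) x = grad f x + grad g x" for x
    by (rule grad_eqI)
      (use Suc.prems has_derivative_add[OF has_derivative_grad has_derivative_grad, of f x g]
        in \<open>simp add: inner_add_left\<close>)
  then show ?case using Suc by (simp add: inner_add_left)
qed

lemma Ck_mult: "Ck n f \<Longrightarrow> Ck n g \<Longrightarrow> Ck n (\<lambda>x. f x * g x)"
proof (induction n arbitrary: f g)
  case 0
  then show ?case by (simp add: continuous_on_mult)
next
  case (Suc n)
  have "grad (\<lambda>x. f x * g x) x = f x *\<^sub>R grad g x + g x *\<^sub>R grad f x" for x
    by (rule grad_eqI)
      (use Suc.prems has_derivative_mult[OF has_derivative_grad has_derivative_grad, of f x g]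
        in \<open>simp add: inner_add_left mult.commute\<close>)
  moreover have "Ck n (\<lambda>x. f x * (grad g x \<bullet> b) + g x * (grad f x \<bullet> b))" if "b \<in> Basis" for b
    using Suc.prems that Ck_mono[of n f] Ck_mono[of n g] by (intro Ck_add Suc.IH) auto
  ultimately show ?case using Suc.prems by (simp add: inner_add_left)
qed

lemma Ck_prod:
  assumes "finite A" "\<And>a. a \<in> A \<Longrightarrow> Ck n (f a)"
  shows "Ck n (\<lambda>x. \<Prod>a\<in>A. f a x)"
  using assms by (induction A) (auto intro: Ck_mult Ck_const)

text \<open>The induction on \<open>n\<close> replaces the outer function by its derivative, so a
  whole chain \<open>G 0\<close>, \<open>G 1\<close>, ... is assumed, each function being the
  derivative of its predecessor.\<close>

lemma Ck_compose_affine: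
  assumes "\<And>j t. (G j has_real_derivative G (Suc j) t) (at t)"
  shows "Ck n (\<lambda>x. G j (v \<bullet> x + c))"
proof (induction n arbitrary: j)
  case 0
  have "isCont (G j) t" for t using assms DERIV_isCont by blast
  then have "continuous_on UNIV (G j)" by (simp add: continuous_at_imp_continuous_on)
  then show ?case
    by (auto intro!: continuous_on_compose2[of UNIV "G j"] continuous_intros)
next
  case (Suc n)
  have d: "((\<lambda>x. G j (v \<bullet> x + c)) has_derivative (\<lambda>h. (G (Suc j) (v \<bullet> x + c) *\<^sub>R v) \<bullet> h)) (at x)" for x
    by (rule has_derivative_eq_rhs[OF DERIV_compose_FDERIV[OF assms]])
      (auto intro!: derivative_eq_intros simp: mult.commute)
  have "Ck n (\<lambda>x. G (Suc j) (v \<bullet> x + c) * (v \<bullet> b))" for b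
    by (intro Ck_mult Ck_const Suc)
  moreover have "grad (\<lambda>x. G j (v \<bullet> x + c)) x = G (Suc j) (v \<bullet> x + c) *\<^sub>R v" for x
    using d by (rule grad_eqI)
  moreover have "(\<lambda>x. G j (v \<bullet> x + c)) differentiable (at x)" for x
    using d by (auto simp: differentiable_def)
  ultimately show ?case
    by simp
qed

subsection \<open>Smooth bump functions\<close>

text \<open>Carrying a polynomial in 1/t makes the family closed under differentiation;
  \<open>P = 1\<close> is the classical smooth function that is flat at 0.\<close>

definition flat_exp :: "real poly \<Rightarrow> real \<Rightarrow> real" where
  "flat_exp P t = (if t > 0 then poly P (1/t) * exp (- (1/t)) else 0)"

lemma poly_times_exp_neg_tendsto_0:
  "((\<lambda>x::real. poly P x * exp (- x)) \<longlongrightarrow> 0) at_top"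
proof -
  have "((\<lambda>x. \<Sum>i\<le>degree P. coeff P i * (x ^ i / exp x)) \<longlongrightarrow> (\<Sum>i\<le>degree P. coeff P i * 0)) at_top"
    by (intro tendsto_intros tendsto_power_div_exp_0)
  then show ?thesis
    by (simp add: poly_altdef sum_distrib_right exp_minus divide_inverse mult.assoc)
qed

lemma flat_exp_tendsto_0: "((\<lambda>t. flat_exp P t) \<longlongrightarrow> 0) (at_right 0)"
proof -
  have "((\<lambda>t. poly P (1/t) * exp (- (1/t))) \<longlongrightarrow> 0) (at_right 0)"
    using filterlim_compose[OF poly_times_exp_neg_tendsto_0 filterlim_inverse_at_top_right]
    by (simp add: divide_inverse)
  moreover have "eventually (\<lambda>t. poly P (1/t) * exp (- (1/t)) = flat_exp P t) (at_right 0)"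
    using eventually_at_right_less[of 0] by eventually_elim (simp add: flat_exp_def)
  ultimately show ?thesis by (rule Lim_transform_eventually)
qed

text \<open>With X = 1/t one has dX/dt = -X^2, so P(X) exp(-X) has derivative X^2 (P - P')(X)
  exp(-X); \<open>[:0,0,1:]\<close> is X^2.\<close>

lemma flat_exp_deriv:
  "(flat_exp P has_real_derivative flat_exp ([:0,0,1:] * (P - pderiv P)) t) (at t)"
proof -
  consider "t > 0" | "t < 0" | "t = 0" by linarith
  then show ?thesis
  proof cases
    case 1
    have "((\<lambda>t. poly P (1/t) * exp (- (1/t))) has_real_derivative
       flat_exp ([:0,0,1:] * (P - pderiv P)) t) (at t)"
      using 1 by (auto intro!: derivative_eq_intros DERIV_chain2[OF poly_DERIV]
          simp: flat_exp_def field_simps power2_eq_square)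
    then show ?thesis
      by (rule has_field_derivative_transform_within[where d = t]) (use 1 in \<open>auto simp: flat_exp_def dist_real_def\<close>)
  next
    case 2
    have "((\<lambda>t. 0) has_real_derivative flat_exp ([:0,0,1:] * (P - pderiv P)) t) (at t)"
      using 2 by (simp add: flat_exp_def)
    then show ?thesis
      by (rule has_field_derivative_transform_within[where d = "-t"]) (use 2 in \<open>auto simp: flat_exp_def dist_real_def\<close>)
  next
    case 3
    \<comment> \<open>Division by t turns \<open>P\<close> into \<open>pCons 0 P\<close>, so the
      difference quotient at 0 is again a member of the family.\<close>
    have "((\<lambda>t. flat_exp P t / t) \<longlongrightarrow> 0) (at_right 0)"
      by (rule Lim_transform_eventually[OF flat_exp_tendsto_0[of "pCons 0 P"]])
        (use eventually_at_right_less[of 0] in eventually_elim, simp add: flat_exp_def)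
    moreover have "((\<lambda>t. flat_exp P t / t) \<longlongrightarrow> 0) (at_left 0)"
      by (rule Lim_transform_eventually[OF tendsto_const])
        (use eventually_at_left_real[of "-1" 0] in \<open>auto elim!: eventually_mono simp: flat_exp_def\<close>)
    ultimately have "((\<lambda>t. flat_exp P t / t) \<longlongrightarrow> 0) (at 0)"
      using filterlim_split_at by blast
    then show ?thesis
      using 3 by (simp add: has_field_derivative_iff flat_exp_def)
  qed
qed

text \<open>The parameter \<open>m\<close> steepens the walls: for growing \<open>m\<close> the
  functions stay between 0 and 1, vanish off the open box and tend to its indicator.\<close>

definition box_bump :: "'a::euclidean_space \<Rightarrow> 'a \<Rightarrow> real \<Rightarrow> 'a \<Rightarrow> real" where
  "box_bump c d m x = (\<Prod>b\<in>Basis. flat_exp 1 (m * (x \<bullet> b - c \<bullet> b)) * flat_exp 1 (m * (d \<bullet> b - x \<bullet> b)))"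

lemma flat_exp_1_bounds: "0 \<le> flat_exp 1 t" "flat_exp 1 t \<le> 1"
  by (auto simp: flat_exp_def)

lemma box_bump_bounds: "0 \<le> box_bump c d m x" "box_bump c d m x \<le> 1"
  unfolding box_bump_def
  by (auto intro!: prod_nonneg prod_le_1 mult_nonneg_nonneg mult_le_one simp: flat_exp_1_bounds)

lemma Ck_box_bump: "Ck n (box_bump c d m)"
proof -
  define Q where "Q = (\<lambda>j. ((\<lambda>P. [:0,0,1:] * (P - pderiv P)) ^^ j) (1::real poly))"
  have der: "(flat_exp (Q j) has_real_derivative flat_exp (Q (Suc j)) t) (at t)" for j t
    unfolding Q_def using flat_exp_deriv by simp
  have aff: "Ck n (\<lambda>x. flat_exp 1 (v \<bullet> x + e))" for v e
    using Ck_compose_affine[of "\<lambda>j. flat_exp (Q j)" n 0 v e] der by (simp add: Q_def)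
  have "Ck n (\<lambda>x. flat_exp 1 (m * (x \<bullet> b - c \<bullet> b)) * flat_exp 1 (m * (d \<bullet> b - x \<bullet> b)))" for b
  proof -
    have "Ck n (\<lambda>x. flat_exp 1 ((m *\<^sub>R b) \<bullet> x + - m * (c \<bullet> b)) * flat_exp 1 ((- m *\<^sub>R b) \<bullet> x + m * (d \<bullet> b)))"
      by (intro Ck_mult aff)
    then show ?thesis
      by (simp add: algebra_simps inner_commute)
  qed
  then show ?thesis
    unfolding box_bump_def by (intro Ck_prod) auto
qed

lemma box_bump_eq_0:
  assumes "m > 0" "x \<notin> box c d"
  shows "box_bump c d m x = 0"
proof -
  obtain b where b: "b \<in> Basis" "x \<bullet> b \<le> c \<bullet> b \<or> d \<bullet> b \<le> x \<bullet> b"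
    using assms(2) by (auto simp: mem_box not_less)
  have "m * (x \<bullet> b - c \<bullet> b) \<le> 0 \<or> m * (d \<bullet> b - x \<bullet> b) \<le> 0"
    using b(2) assms(1) by (auto simp: mult_le_0_iff)
  then have "flat_exp 1 (m * (x \<bullet> b - c \<bullet> b)) * flat_exp 1 (m * (d \<bullet> b - x \<bullet> b)) = 0"
    by (auto simp: flat_exp_def)
  then show ?thesis
    unfolding box_bump_def using b(1) by (simp add: prod_zero_iff) blast
qed

lemma box_bump_test_fun:
  assumes "m > 0" "cbox c d \<subseteq> \<Omega>"
  shows "box_bump c d m \<in> test_fun \<Omega>"
proof -
  have sub: "{x. box_bump c d m x \<noteq> 0} \<subseteq> cbox c d"
    using box_bump_eq_0[OF assms(1)] box_subset_cbox by blast
  then have "closure {x. box_bump c d m x \<noteq> 0} \<subseteq> cbox c d"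
    by (rule closure_minimal) (rule closed_cbox)
  moreover have "compact (closure {x. box_bump c d m x \<noteq> 0})"
    using bounded_subset[OF bounded_cbox sub] by (rule compact_closure[THEN iffD2])
  ultimately show ?thesis
    using assms(2) Ck_box_bump by (auto simp: test_fun_def)
qed

lemma box_bump_tendsto: "(\<lambda>m. box_bump c d (real (Suc m)) x) \<longlonglongrightarrow> indicator (box c d) x"
proof (cases "x \<in> box c d")
  case False
  then show ?thesis using box_bump_eq_0[of "real (Suc _)" x c d] by simp
next
  case True
  have lim: "(\<lambda>m. flat_exp 1 (real (Suc m) * s)) \<longlonglongrightarrow> 1" if "s > 0" for s
  proof -
    have "(\<lambda>m. exp (- (1 / s * inverse (real (Suc m))))) \<longlonglongrightarrow> exp (- (1 / s * 0))"
      by (intro tendsto_intros LIMSEQ_inverse_real_of_nat)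
    moreover have "exp (- (1 / s * inverse (real (Suc m)))) = flat_exp 1 (real (Suc m) * s)" for m
      using that by (simp add: flat_exp_def field_simps del: of_nat_Suc)
    ultimately show ?thesis by simp
  qed
  have "(\<lambda>m. box_bump c d (real (Suc m)) x) \<longlonglongrightarrow> (\<Prod>b\<in>(Basis::'a set). 1 * 1)"
    unfolding box_bump_def using True
    by (intro tendsto_prod tendsto_mult lim) (auto simp: mem_box)
  then show ?thesis using True by simp
qed

subsection \<open>Integration by parts against test functions\<close>

text \<open>The mean value theorem applies on either side of \<open>c\<close>; an interval that
  contains \<open>c\<close> is cut there and the two estimates are added.\<close>

lemma lipschitz_of_bounded_derivative_except_point:
  fixes \<phi> :: "real \<Rightarrow> real"
  assumes cont: "continuous_on UNIV \<phi>"
    and der: "\<And>t. t \<noteq> c \<Longrightarrow> (\<phi> has_real_derivative \<phi>' t) (at t)"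
    and bd: "\<And>t. t \<noteq> c \<Longrightarrow> \<bar>\<phi>' t\<bar> \<le> M"
  shows "\<bar>\<phi> v - \<phi> u\<bar> \<le> M * \<bar>v - u\<bar>"
proof -
  have step: "\<bar>\<phi> v - \<phi> u\<bar> \<le> M * (v - u)" if "u \<le> v" "c \<le> u \<or> v \<le> c" for u v
  proof (cases "u = v")
    case False
    with that have uv: "u < v" by simp
    have "continuous_on {u..v} \<phi>" using cont continuous_on_subset by blast
    moreover have "(\<phi> has_derivative (\<lambda>h. \<phi>' x * h)) (at x)" if "u < x" "x < v" for x
      using der[of x] that \<open>c \<le> u \<or> v \<le> c\<close> by (auto simp: has_field_derivative_def)
    ultimately obtain x where x: "u < x" "x < v" "\<phi> v - \<phi> u = \<phi>' x * (v - u)"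
      using mvt[OF uv, of \<phi> "\<lambda>x h. \<phi>' x * h"] by (metis)
    have "\<bar>\<phi>' x\<bar> \<le> M" using bd x that by auto
    then show ?thesis using x uv by (simp add: abs_mult mult_right_mono)
  qed simp
  have mono: "\<bar>\<phi> v - \<phi> u\<bar> \<le> M * (v - u)" if "u \<le> v" for u v
  proof (cases "c \<le> u \<or> v \<le> c")
    case False
    then have "\<bar>\<phi> c - \<phi> u\<bar> \<le> M * (c - u)" "\<bar>\<phi> v - \<phi> c\<bar> \<le> M * (v - c)"
      by (auto intro!: step)
    then show ?thesis by (simp add: algebra_simps)
  qed (use step that in blast)
  show ?thesis
    using mono[of u v] mono[of v u] by (cases "u \<le> v") (auto simp: abs_minus_commute)
qed

lemma integral_lborel_translate:
  fixes X :: "'a::euclidean_space \<Rightarrow> real"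
  assumes "X \<in> borel_measurable borel"
  shows "integral\<^sup>L lborel (\<lambda>x. X (x + c)) = integral\<^sup>L lborel X"
    and "integrable lborel (\<lambda>x. X (x + c)) \<longleftrightarrow> integrable lborel X"
  using integral_distr[of "(+) c" lborel borel X] integrable_distr_eq[of "(+) c" lborel borel X] assms
  by (simp_all add: lborel_distr_plus add.commute)

lemma integrable_lborel_compact_support:
  fixes X :: "'a::euclidean_space \<Rightarrow> real"
  assumes "continuous_on UNIV X" "compact K" "\<And>x. x \<notin> K \<Longrightarrow> X x = 0"
  shows "integrable lborel X"
proof -
  have "integrable lborel (\<lambda>x. indicator K x *\<^sub>R X x)"
    using assms(2) continuous_on_subset[OF assms(1)] by (intro borel_integrable_compact) auto
  moreover have "(\<lambda>x. indicator K x *\<^sub>R X x) = X"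
    using assms(3) by (auto simp: fun_eq_iff indicator_def)
  ultimately show ?thesis by simp
qed

text \<open>The exceptional set \<open>L\<close> is null and met by each line parallel to \<open>b\<close> through a point
  outside \<open>L\<close> at most once; the mean value theorem then still bounds the difference quotients,
  so no differentiability on \<open>L\<close> is required.\<close>

lemma integral_directional_derivative_eq_0:
  fixes X g :: "'a::euclidean_space \<Rightarrow> real"
  assumes cont: "continuous_on UNIV X" and K: "compact K" "\<And>x. x \<notin> K \<Longrightarrow> X x = 0"
    and L: "negligible L" "\<And>x. x \<notin> L \<Longrightarrow> \<exists>c. \<forall>t. t \<noteq> c \<longrightarrow> x + t *\<^sub>R b \<notin> L"
    and der: "\<And>x. x \<notin> L \<Longrightarrow> ((\<lambda>t. X (x + t *\<^sub>R b)) has_real_derivative g x) (at 0)"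
    and bd: "\<And>x. x \<notin> L \<Longrightarrow> \<bar>g x\<bar> \<le> M"
  shows "integrable lebesgue g" "integral\<^sup>L lebesgue g = 0"
proof -
  define h where "h n = inverse (real (Suc n))" for n
  have h: "h n > 0" "h n \<le> 1" for n by (auto simp: h_def divide_simps)
  \<comment> \<open>Difference quotients along \<open>b\<close>: their integrals vanish by
    translation invariance, and off \<open>L\<close> they are uniformly dominated and tend to
    \<open>g\<close>.\<close>
  define D where "D n x = (X (x + h n *\<^sub>R b) - X x) / h n" for n x
  have Xmeas: "X \<in> borel_measurable borel" using cont by (rule borel_measurable_continuous_onI)
  have Xint: "integrable lborel X"
    using integrable_lborel_compact_support[OF cont K] .
  have Dint: "integrable lborel (D n)" "integral\<^sup>L lborel (D n) = 0" for n
  proof -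
    have i: "integrable lborel (\<lambda>x. X (x + h n *\<^sub>R b))"
      using integral_lborel_translate(2)[OF Xmeas] Xint by blast
    then show "integrable lborel (D n)"
      unfolding D_def using Xint by auto
    show "integral\<^sup>L lborel (D n) = 0"
      unfolding D_def using Xint i integral_lborel_translate(1)[OF Xmeas] by simp
  qed
  have lip: "\<bar>X (x + s *\<^sub>R b) - X x\<bar> \<le> M * \<bar>s\<bar>" if xL: "x \<notin> L" for x s
  proof -
    obtain c where c: "\<And>t. t \<noteq> c \<Longrightarrow> x + t *\<^sub>R b \<notin> L" using L(2)[OF xL] by blast
    have "((\<lambda>t. X (x + t *\<^sub>R b)) has_real_derivative g (x + t *\<^sub>R b)) (at t)" if "t \<noteq> c" for t
    proof -
      have "((\<lambda>u. X (x + (u + t) *\<^sub>R b)) has_real_derivative g (x + t *\<^sub>R b)) (at 0)"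
        using der[OF c[OF that]] by (simp add: algebra_simps)
      then show ?thesis
        using DERIV_shift[of "\<lambda>t. X (x + t *\<^sub>R b)" "g (x + t *\<^sub>R b)" 0 t] by simp
    qed
    moreover have "continuous_on UNIV (\<lambda>t. X (x + t *\<^sub>R b))"
      by (rule continuous_on_compose2[OF cont]) (auto intro!: continuous_intros)
    ultimately have "\<bar>X (x + s *\<^sub>R b) - X (x + 0 *\<^sub>R b)\<bar> \<le> M * \<bar>s - 0\<bar>"
      using bd[OF c] by (intro lipschitz_of_bounded_derivative_except_point
          [where c = c and \<phi> = "\<lambda>t. X (x + t *\<^sub>R b)" and \<phi>' = "\<lambda>t. g (x + t *\<^sub>R b)"])
    then show ?thesis by simp
  qed
  obtain R where R: "\<And>x. x \<in> K \<Longrightarrow> norm x \<le> R"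
    using compact_imp_bounded[OF K(1)] by (auto simp: bounded_iff)
  \<comment> \<open>Outside this ball neither \<open>x\<close> nor
    \<open>x + h n *\<^sub>R b\<close> lies in \<open>K\<close>, because \<open>h n \<le> 1\<close>,
    so the quotients vanish there.\<close>
  define B where "B = cball (0::'a) (R + norm b)"
  have bound: "\<bar>D n x\<bar> \<le> M * indicator B x" if "x \<notin> L" for n x
  proof (cases "x \<in> B")
    case True
    then show ?thesis
      using lip[OF that, of "h n"] h(1)[of n] by (simp add: D_def divide_simps mult.commute)
  next
    case False
    then have nx: "norm x > R + norm b" by (simp add: B_def)
    have "norm x - norm (h n *\<^sub>R b) \<le> norm (x + h n *\<^sub>R b)"
      by (rule norm_diff_ineq)
    moreover have "norm (h n *\<^sub>R b) \<le> norm b" using h[of n] by (simp add: mult_left_le_one_le)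
    ultimately have "x + h n *\<^sub>R b \<notin> K" "x \<notin> K"
      using nx R[of "x + h n *\<^sub>R b"] R[of x] norm_ge_zero[of b] by auto
    then show ?thesis by (simp add: D_def K False)
  qed
  have lim: "(\<lambda>n. D n x) \<longlonglongrightarrow> g x" if "x \<notin> L" for x
  proof -
    have "((\<lambda>t. (X (x + t *\<^sub>R b) - X x) / t) \<longlongrightarrow> g x) (at 0)"
      using der[OF that] by (simp add: has_field_derivative_iff)
    moreover have "filterlim h (at 0) sequentially"
      unfolding filterlim_at h_def
      using LIMSEQ_inverse_real_of_nat by (auto simp del: of_nat_Suc)
    ultimately show ?thesis
      unfolding D_def by (rule filterlim_compose)
  qed
  have Ls: "L \<in> null_sets lebesgue" using L(1) by (simp add: negligible_iff_null_sets)
  then have Lm [measurable]: "L \<in> sets lebesgue" by auto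
  define gg where "gg x = (if x \<in> L then 0 else g x)" for x
  define DD where "DD n x = (if x \<in> L then 0 else D n x)" for n x
  have Dm [measurable]: "D n \<in> borel_measurable lebesgue" for n
    using Dint(1)[of n] by (auto intro: measurable_completion)
  have DDm: "DD n \<in> borel_measurable lebesgue" for n
    unfolding DD_def by measurable
  have DD0: "integral\<^sup>L lebesgue (DD n) = 0" for n
  proof -
    have "integral\<^sup>L lebesgue (DD n) = integral\<^sup>L lebesgue (D n)"
      using AE_not_in[OF Ls] by (intro integral_cong_AE DDm Dm) (auto simp: DD_def)
    also have "\<dots> = integral\<^sup>L lborel (D n)"
      using Dint(1)[of n] by (intro integral_completion) auto
    finally show ?thesis using Dint by simp
  qed
  have limg: "(\<lambda>n. DD n x) \<longlonglongrightarrow> gg x" for x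
    using lim by (auto simp: DD_def gg_def)
  have ggm: "gg \<in> borel_measurable lebesgue"
    by (rule borel_measurable_LIMSEQ_real[OF limg DDm])
  \<comment> \<open>If \<open>L\<close> were everything, \<open>bd\<close> would be vacuous and
    \<open>M\<close> could be negative; the dominating function below distinguishes this
    case.\<close>
  have M0: "M \<ge> 0 \<or> UNIV = L"
    using bd abs_ge_zero order_trans by blast
  have w: "integrable lebesgue (\<lambda>x. M * indicator B x)"
    using emeasure_lborel_cball_finite[of "0::'a" "R + norm b"]
    by (intro integrable_mult_right) (auto simp: B_def integrable_indicator_iff)
  have bDD: "norm (DD n x) \<le> (if UNIV = L then 0 else M * indicator B x)" for n x
    using bound[of x n] M0 by (auto simp: DD_def)
  have w': "integrable lebesgue (\<lambda>x. if UNIV = L then 0 else M * indicator B x)"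
    using w by (cases "UNIV = L") auto
  have "integrable lebesgue gg"
    by (rule integrable_dominated_convergence[where s = DD, OF ggm DDm w']) (use limg bDD in auto)
  have "(\<lambda>n. integral\<^sup>L lebesgue (DD n)) \<longlonglongrightarrow> integral\<^sup>L lebesgue gg"
    by (rule integral_dominated_convergence[where s = DD, OF ggm DDm w']) (use limg bDD in auto)
  then have "integral\<^sup>L lebesgue gg = 0"
    by (simp add: DD0 LIMSEQ_const_iff)
  have AE: "AE x in lebesgue. gg x = g x"
    using AE_not_in[OF Ls] by eventually_elim (simp add: gg_def)
  have "gg absolutely_integrable_on UNIV"
    using \<open>integrable lebesgue gg\<close> by (simp add: set_integrable_def)
  then have "g absolutely_integrable_on UNIV"
    by (rule absolutely_integrable_spike[OF _ L(1)]) (simp add: gg_def)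
  then show gi: "integrable lebesgue g" by (simp add: set_integrable_def)
  have "integral\<^sup>L lebesgue gg = integral\<^sup>L lebesgue g"
    using ggm gi AE by (intro integral_cong_AE) auto
  then show "integral\<^sup>L lebesgue g = 0" using \<open>integral\<^sup>L lebesgue gg = 0\<close> by simp
qed

lemma test_funD:
  assumes "\<phi> \<in> test_fun \<Omega>"
  obtains K where "compact K" "K \<subseteq> \<Omega>" "\<And>x. x \<notin> K \<Longrightarrow> \<phi> x = 0" "\<And>x. x \<notin> K \<Longrightarrow> grad \<phi> x = 0"
    "\<And>x. \<phi> differentiable (at x)" "continuous_on UNIV \<phi>" "\<And>b. b \<in> Basis \<Longrightarrow> continuous_on UNIV (\<lambda>x. grad \<phi> x \<bullet> b)"
    "continuous_on UNIV (grad \<phi>)"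
proof -
  define S where "S = closure {x. \<phi> x \<noteq> 0}"
  have C: "Ck n \<phi>" for n using assms by (simp add: test_fun_def)
  have S: "compact S" "S \<subseteq> \<Omega>" using assms by (auto simp: test_fun_def S_def)
  have zero: "\<phi> x = 0" if "x \<notin> S" for x
    using that closure_subset[of "{x. \<phi> x \<noteq> 0}"] unfolding S_def by blast
  have d: "\<phi> differentiable (at x)" for x using C[of "Suc 0"] by simp
  have c0: "continuous_on UNIV \<phi>" using C[of 0] by simp
  have c: "continuous_on UNIV (\<lambda>x. grad \<phi> x \<bullet> b)" if "b \<in> Basis" for b
    using C[of "Suc 0"] that by simp
  have c1: "continuous_on UNIV (grad \<phi>)"
    using c by (intro continuous_on_componentwise[THEN iffD2]) auto
  have g: "grad \<phi> x = 0" if x: "x \<notin> S" for x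
  proof (rule grad_eqI)
    have "((\<lambda>x. 0) has_derivative (\<lambda>h. 0 \<bullet> h)) (at x)" by simp
    moreover have "open (- S)" using S by (simp add: compact_imp_closed open_Compl)
    moreover have "x \<in> - S" using x by simp
    ultimately show "(\<phi> has_derivative (\<lambda>h. 0 \<bullet> h)) (at x)"
      by (rule has_derivative_transform_within_open) (metis ComplD zero)
  qed
  show ?thesis using that[OF S zero g d c0 c c1] by blast
qed

lemma continuous_on_UNIV_extend_by_0:
  fixes X :: "'a::t2_space \<Rightarrow> 'b::real_normed_vector"
  assumes "open \<Omega>" "compact K" "K \<subseteq> \<Omega>" "continuous_on \<Omega> X" "\<And>x. x \<notin> K \<Longrightarrow> X x = 0"
  shows "continuous_on UNIV X"
proof -
  have op: "open (- K)" using assms by (simp add: compact_imp_closed open_Compl)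
  have "continuous_on (- K) X"
    by (rule continuous_on_cong[THEN iffD1, OF refl _ continuous_on_const[of _ 0]]) (use assms in auto)
  then have "continuous_on (\<Omega> \<union> - K) X"
    using assms op by (intro continuous_on_open_Un) auto
  moreover have "\<Omega> \<union> - K = UNIV" using assms by auto
  ultimately show ?thesis by simp
qed

lemma integral_lebesgue_on_eq:
  fixes f :: "'a::euclidean_space \<Rightarrow> 'b::euclidean_space"
  assumes "open \<Omega>" "\<And>x. x \<notin> \<Omega> \<Longrightarrow> f x = 0"
  shows "integral\<^sup>L (lebesgue_on \<Omega>) f = integral\<^sup>L lebesgue f"
    "integrable (lebesgue_on \<Omega>) f \<longleftrightarrow> integrable lebesgue f"
proof -
  have "\<Omega> \<in> sets lebesgue" using assms(1) by auto
  moreover have "(\<lambda>x. if x \<in> \<Omega> then f x else 0) = f" using assms(2) by auto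
  ultimately show "integral\<^sup>L (lebesgue_on \<Omega>) f = integral\<^sup>L lebesgue f"
    "integrable (lebesgue_on \<Omega>) f \<longleftrightarrow> integrable lebesgue f"
    using Lebesgue_Measure.integral_restrict_UNIV[of \<Omega> f] Lebesgue_Measure.integrable_restrict_UNIV[of \<Omega> f] by auto
qed

text \<open>The derivative of \<open>\<phi>\<close> times \<open>F\<close> along \<open>b\<close>
  has integral 0. Of its two terms, the one with the gradient of \<open>\<phi>\<close> is continuous
  with compact support and hence integrable; the other is then integrable as a difference, which
  also settles its measurability.\<close>

lemma integration_by_parts_test_fun:
  fixes F g :: "'a::euclidean_space \<Rightarrow> real"
  assumes \<Omega>: "open \<Omega>" and \<phi>: "\<phi> \<in> test_fun \<Omega>" and b: "b \<in> Basis"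
    and cont: "continuous_on \<Omega> F"
    and L: "negligible L" "\<And>x. x \<notin> L \<Longrightarrow> \<exists>c. \<forall>t. t \<noteq> c \<longrightarrow> x + t *\<^sub>R b \<notin> L"
    and der: "\<And>x. x \<in> \<Omega> - L \<Longrightarrow> ((\<lambda>t. F (x + t *\<^sub>R b)) has_real_derivative g x) (at 0)"
    and bd: "\<And>K. compact K \<Longrightarrow> K \<subseteq> \<Omega> \<Longrightarrow> \<exists>M. \<forall>x\<in>K - L. \<bar>g x\<bar> \<le> M"
  shows "integrable (lebesgue_on \<Omega>) (\<lambda>x. F x * (grad \<phi> x \<bullet> b))"
    and "integrable (lebesgue_on \<Omega>) (\<lambda>x. \<phi> x * g x)"
    and "(LINT x|lebesgue_on \<Omega>. F x * (grad \<phi> x \<bullet> b)) = - (LINT x|lebesgue_on \<Omega>. \<phi> x * g x)"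
proof -
  obtain K where K: "compact K" "K \<subseteq> \<Omega>" "\<And>x. x \<notin> K \<Longrightarrow> \<phi> x = 0" "\<And>x. x \<notin> K \<Longrightarrow> grad \<phi> x = 0"
    "\<And>x. \<phi> differentiable (at x)" "continuous_on UNIV \<phi>" "\<And>b. b \<in> Basis \<Longrightarrow> continuous_on UNIV (\<lambda>x. grad \<phi> x \<bullet> b)"
    "continuous_on UNIV (grad \<phi>)"
    using test_funD[OF \<phi>] by metis
  let ?A = "\<lambda>x. F x * (grad \<phi> x \<bullet> b)" and ?B = "\<lambda>x. \<phi> x * g x"
  obtain M1 where M1: "\<And>x. x \<in> K - L \<Longrightarrow> \<bar>g x\<bar> \<le> M1" using bd[OF K(1,2)] by blast
  have contK: "continuous_on K F" using cont K(2) continuous_on_subset by blast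
  have cA: "continuous_on UNIV ?A"
    by (rule continuous_on_UNIV_extend_by_0[OF \<Omega> K(1,2)])
      (use K cont b continuous_on_subset[OF K(8)] in \<open>auto intro!: continuous_intros\<close>)
  have cX: "continuous_on UNIV (\<lambda>x. \<phi> x * F x)"
    by (rule continuous_on_UNIV_extend_by_0[OF \<Omega> K(1,2)])
      (use K cont b continuous_on_subset[OF K(6)] in \<open>auto intro!: continuous_intros\<close>)
  have bdA: "\<exists>M. \<forall>x. \<bar>?A x\<bar> \<le> M"
  proof -
    have "compact (?A ` K)" using cA K(1) compact_continuous_image continuous_on_subset by blast
    then obtain M where "\<And>x. x \<in> K \<Longrightarrow> \<bar>?A x\<bar> \<le> M"
      using compact_imp_bounded[of "?A ` K"] by (auto simp: bounded_iff)
    then have "\<bar>?A x\<bar> \<le> max M 0" for x using K(4)[of x] by (cases "x \<in> K") (auto simp: le_max_iff_disj)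
    then show ?thesis by blast
  qed
  then obtain M2 where M2: "\<And>x. \<bar>?A x\<bar> \<le> M2" by blast
  have "\<exists>M. \<forall>x. \<bar>\<phi> x\<bar> \<le> M"
  proof -
    have "compact (\<phi> ` K)" using K(6) K(1) compact_continuous_image continuous_on_subset by blast
    then obtain M where "\<And>x. x \<in> K \<Longrightarrow> \<bar>\<phi> x\<bar> \<le> M"
      using compact_imp_bounded[of "\<phi> ` K"] by (auto simp: bounded_iff)
    then have "\<bar>\<phi> x\<bar> \<le> max M 0" for x using K(3)[of x] by (cases "x \<in> K") (auto simp: le_max_iff_disj)
    then show ?thesis by blast
  qed
  then obtain M3 where M3: "\<And>x. \<bar>\<phi> x\<bar> \<le> M3" by blast
  \<comment> \<open>Outside \<open>\<Omega>\<close> nothing is known about \<open>F\<close>, but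
    there the product vanishes near \<open>x\<close>.\<close>
  have derX: "((\<lambda>t. \<phi> (x + t *\<^sub>R b) * F (x + t *\<^sub>R b)) has_real_derivative ?A x + ?B x) (at 0)"
    if "x \<notin> L" for x
  proof (cases "x \<in> \<Omega>")
    case True
    have "((\<lambda>t. \<phi> (x + t *\<^sub>R b)) has_real_derivative (grad \<phi> x \<bullet> b)) (at 0)"
    proof -
      have "((\<lambda>t. x + t *\<^sub>R b) has_derivative (\<lambda>t. t *\<^sub>R b)) (at 0)"
        by (auto intro!: derivative_eq_intros)
      then have "(\<phi> \<circ> (\<lambda>t. x + t *\<^sub>R b) has_derivative (\<lambda>h. grad \<phi> x \<bullet> h) \<circ> (\<lambda>t. t *\<^sub>R b)) (at 0)"
        by (rule diff_chain_at) (simp add: has_derivative_grad K(5))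
      then show ?thesis by (simp add: has_field_derivative_def o_def mult.commute[of _ "grad \<phi> x \<bullet> b"] mult_commute_abs)
    qed
    from DERIV_mult[OF this der] True that show ?thesis
      by (simp add: mult.commute add.commute)
  next
    case False
    then have x: "x \<notin> K" using K by blast
    have "open (- K)" using K by (simp add: compact_imp_closed open_Compl)
    then have "open ((\<lambda>t. x + t *\<^sub>R b) -` (- K))"
      by (rule open_vimage) (auto intro!: continuous_intros)
    moreover have "((\<lambda>t. 0) has_real_derivative ?A x + ?B x) (at 0)"
      using K x by simp
    moreover have "0 \<in> (\<lambda>t. x + t *\<^sub>R b) -` (- K)" using x by simp
    ultimately show ?thesis
      using has_field_derivative_transform_within_open[of "\<lambda>t. 0" "?A x + ?B x" 0 "(\<lambda>t. x + t *\<^sub>R b) -` (- K)"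
          "\<lambda>t. \<phi> (x + t *\<^sub>R b) * F (x + t *\<^sub>R b)"] K(3) by auto
  qed
  have bnd: "\<bar>?A x + ?B x\<bar> \<le> M2 + M3 * max M1 0" if "x \<notin> L" for x
  proof -
    have "\<bar>?B x\<bar> \<le> M3 * max M1 0"
    proof (cases "x \<in> K")
      case True
      then have "\<bar>g x\<bar> \<le> max M1 0" using M1 that by (simp add: le_max_iff_disj)
      then show ?thesis using M3[of x] by (simp add: abs_mult mult_mono')
    next
      case False
      have "M3 \<ge> 0" using M3[of x] by linarith
      then show ?thesis using K False by simp
    qed
    then show ?thesis using M2[of x] by linarith
  qed
  have sum: "integrable lebesgue (\<lambda>x. ?A x + ?B x)" "integral\<^sup>L lebesgue (\<lambda>x. ?A x + ?B x) = 0"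
    using integral_directional_derivative_eq_0[OF cX K(1) _ L derX bnd] K(3) by auto
  have A: "integrable lebesgue ?A"
    using integrable_lborel_compact_support[OF cA K(1)] K(4)
    by (subst integrable_completion) (auto intro: borel_measurable_integrable)
  have B: "integrable lebesgue ?B"
    using Bochner_Integration.integrable_diff[OF sum(1) A] by simp
  have eq: "integral\<^sup>L lebesgue ?A = - integral\<^sup>L lebesgue ?B"
    using Bochner_Integration.integral_add[OF A B] sum(2) by simp
  have "?A x = 0" "?B x = 0" if "x \<notin> \<Omega>" for x
    using K(3)[of x] K(4)[of x] subsetD[OF K(2), of x] that by (metis inner_zero_left mult_zero_right, auto)
  note r = integral_lebesgue_on_eq[OF \<Omega> this(1)] integral_lebesgue_on_eq[OF \<Omega> this(2)]
  show "integrable (lebesgue_on \<Omega>) ?A" "integrable (lebesgue_on \<Omega>) ?B"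
    "(LINT x|lebesgue_on \<Omega>. ?A x) = - (LINT x|lebesgue_on \<Omega>. ?B x)"
    using A B eq r by auto
qed

subsection \<open>The fundamental lemma of the calculus of variations\<close>

text \<open>The positive and the negative part of \<open>g\<close> are densities of two measures
  that are finite and equal on boxes. Boxes form an intersection-stable generator, so the measures
  coincide, and so do the densities almost everywhere.\<close>

lemma AE_eq_0_of_integral_boxes_eq_0:
  fixes g :: "'a::euclidean_space \<Rightarrow> real"
  assumes g: "integrable lborel g" and 0: "\<And>c d. (LINT x|lborel. indicator (box c d) x * g x) = 0"
  shows "AE x in lborel. g x = 0"
proof -
  have [measurable]: "g \<in> borel_measurable lborel" using g by auto
  define D where "D s = density lborel (\<lambda>x. ennreal (s * g x))" for s
  have em: "emeasure (D s) B = ennreal (LINT x|lborel. indicator B x * max 0 (s * g x))"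
    if [measurable]: "B \<in> sets borel" for s B
  proof -
    have "integrable lborel (\<lambda>x. indicator B x * max 0 (s * g x))"
      using g by (intro integrable_real_mult_indicator[of B lborel "\<lambda>x. max 0 (s * g x)", simplified mult.commute]) auto
    then have "ennreal (LINT x|lborel. indicator B x * max 0 (s * g x)) = (\<integral>\<^sup>+x. ennreal (indicator B x * max 0 (s * g x)) \<partial>lborel)"
      by (intro nn_integral_eq_integral[symmetric]) auto
    also have "\<dots> = (\<integral>\<^sup>+x. ennreal (s * g x) * indicator B x \<partial>lborel)"
      by (intro nn_integral_cong) (auto simp: indicator_def max_def ennreal_neg)
    finally show ?thesis
      unfolding D_def by (simp add: emeasure_density)
  qed
  have eq: "emeasure (D 1) (box c d) = emeasure (D (-1)) (box c d)" for c d
  proof -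
    have i: "integrable lborel (\<lambda>x. indicator (box c d) x * max 0 (s * g x))" for s
      using g by (intro integrable_real_mult_indicator[of "box c d" lborel "\<lambda>x. max 0 (s * g x)", simplified mult.commute]) auto
    have "(LINT x|lborel. indicator (box c d) x * max 0 (1 * g x)) - (LINT x|lborel. indicator (box c d) x * max 0 (-1 * g x))
      = (LINT x|lborel. indicator (box c d) x * max 0 (1 * g x) - indicator (box c d) x * max 0 (-1 * g x))"
      using i by (intro Bochner_Integration.integral_diff[symmetric])
    also have "\<dots> = (LINT x|lborel. indicator (box c d) x * g x)"
      by (intro Bochner_Integration.integral_cong) (auto simp: indicator_def max_def)
    finally show ?thesis using 0[of c d] by (simp add: em)
  qed
  have "D 1 = D (-1)"
  proof (rule measure_eqI_generator_eq[where E = "range (\<lambda>(a, b). box a b :: 'a set)" and \<Omega> = UNIV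
        and A = "\<lambda>n. box (- (real n *\<^sub>R One)) (real n *\<^sub>R One)"])
    show "Int_stable (range (\<lambda>(a, b). box a b :: 'a set))"
      by (auto simp: Int_stable_def Int_interval box_Int_box)
    have gen: "sets (D s) = sigma_sets UNIV (range (\<lambda>(a, b). box a b :: 'a set))" for s
    proof -
      have "sets (borel :: 'a measure) = sigma_sets UNIV (range (\<lambda>(a, b). box a b :: 'a set))"
        by (subst borel_eq_box) (simp add: sets_measure_of)
      then show ?thesis by (simp add: D_def)
    qed
    show "sets (D 1) = sigma_sets UNIV (range (\<lambda>(a, b). box a b :: 'a set))"
      "sets (D (-1)) = sigma_sets UNIV (range (\<lambda>(a, b). box a b :: 'a set))"
      by (rule gen)+
    show "(\<Union>n. box (- (real n *\<^sub>R One)) (real n *\<^sub>R One)) = (UNIV :: 'a set)"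
      by (rule UN_box_eq_UNIV)
  qed (auto simp: eq em)
  \<comment> \<open>\<open>ennreal\<close> sends negative numbers to 0, so one of the two sides is
    always 0 and equality forces \<open>g x = 0\<close>.\<close>
  then have "AE x in lborel. ennreal (1 * g x) = ennreal (-1 * g x)"
    unfolding D_def by (intro sigma_finite_measure.density_unique[OF sigma_finite_lborel]) auto
  then show ?thesis
  proof eventually_elim
    case (elim x)
    then show ?case
      by (cases "g x \<ge> 0") (auto simp: ennreal_neg ennreal_eq_0_iff dest: sym)
  qed
qed

text \<open>Bumps with steep walls give integral 0 over each open box with closure in
  \<open>\<Omega>\<close>. On such a box a Borel representative of \<open>h\<close> is fed into the
  criterion for \<open>lborel\<close>; countably many closed boxes, whose boundaries are null,
  exhaust \<open>\<Omega>\<close>.\<close>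

lemma fundamental_lemma_calculus_of_variations:
  fixes h :: "'a::euclidean_space \<Rightarrow> real"
  assumes \<Omega>: "open \<Omega>" and int: "\<And>K. compact K \<Longrightarrow> K \<subseteq> \<Omega> \<Longrightarrow> integrable (lebesgue_on K) h"
    and 0: "\<And>\<phi>. \<phi> \<in> test_fun \<Omega> \<Longrightarrow> (LINT x|lebesgue_on \<Omega>. \<phi> x * h x) = 0"
  shows "AE x in lebesgue. x \<in> \<Omega> \<longrightarrow> h x = 0"
proof -
  have hi: "integrable lebesgue (\<lambda>x. indicator (cbox c d) x * h x)" if "cbox c d \<subseteq> \<Omega>" for c d
  proof -
    have "integrable lebesgue (\<lambda>x. if x \<in> cbox c d then h x else 0)"
      using int[OF compact_cbox that] by (subst Lebesgue_Measure.integrable_restrict_UNIV) auto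
    moreover have "(\<lambda>x. if x \<in> cbox c d then h x else 0) = (\<lambda>x. indicator (cbox c d) x * h x)"
      by (auto simp: indicator_def)
    ultimately show ?thesis by simp
  qed
  have box0: "(LINT x|lebesgue. indicator (box c d) x * h x) = 0" if cd: "cbox c d \<subseteq> \<Omega>" for c d
  proof -
    \<comment> \<open>\<open>h\<close> is integrable on compact subsets only; the indicator of
      \<open>cbox c d\<close> is carried along to provide an integrable majorant.\<close>
    let ?s = "\<lambda>m x. box_bump c d (real (Suc m)) x * (indicator (cbox c d) x * h x)"
    have eq: "box_bump c d (real (Suc m)) x * h x = ?s m x" for m x
      using box_bump_eq_0[of "real (Suc m)" x c d] box_subset_cbox[of c d]
      by (cases "x \<in> cbox c d") (auto simp del: of_nat_Suc)
    have i0: "integral\<^sup>L lebesgue (?s m) = 0" for m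
    proof -
      have "integral\<^sup>L (lebesgue_on \<Omega>) (?s m) = 0"
        using 0[OF box_bump_test_fun[of "real (Suc m)" c d \<Omega>]] cd by (simp add: eq del: of_nat_Suc)
      moreover have "?s m x = 0" if "x \<notin> \<Omega>" for x using that cd by (auto simp: indicator_def)
      ultimately show ?thesis
        using integral_lebesgue_on_eq(1)[OF \<Omega>, of "?s m"] by simp
    qed
    have m1: "(\<lambda>x. indicator (cbox c d) x * h x) \<in> borel_measurable lebesgue"
      using hi[OF cd] by auto
    have m2: "box_bump c d (real (Suc m)) \<in> borel_measurable lebesgue" for m
    proof -
      have "continuous_on UNIV (box_bump c d (real (Suc m)))"
        using Ck_box_bump[of 0] by simp
      then show ?thesis
        by (intro measurable_completion) (simp add: borel_measurable_continuous_onI)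
    qed
    have ind: "indicator (box c d) x * h x = indicator (box c d) x * (indicator (cbox c d) x * h x)" for x
      using box_subset_cbox[of c d] by (auto simp: indicator_def)
    have "(\<lambda>m. integral\<^sup>L lebesgue (?s m)) \<longlonglongrightarrow> (LINT x|lebesgue. indicator (box c d) x * h x)"
    proof (rule integral_dominated_convergence)
      show "(\<lambda>x. indicator (box c d) x * h x) \<in> borel_measurable lebesgue"
        unfolding ind by (rule borel_measurable_times[OF borel_measurable_indicator m1]) auto
      show "?s m \<in> borel_measurable lebesgue" for m
        using m1 m2 by (rule borel_measurable_times[rotated])
      show "integrable lebesgue (\<lambda>x. \<bar>indicator (cbox c d) x * h x\<bar>)"
        using hi[OF cd] by (rule integrable_abs)
      show "AE x in lebesgue. (\<lambda>m. ?s m x) \<longlonglongrightarrow> indicator (box c d) x * h x"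
        unfolding ind by (intro always_eventually allI tendsto_mult box_bump_tendsto tendsto_const)
      show "AE x in lebesgue. norm (?s m x) \<le> \<bar>indicator (cbox c d) x * h x\<bar>" for m
        using box_bump_bounds[of c d "real (Suc m)"]
        by (intro always_eventually allI) (simp add: abs_mult mult_left_le_one_le)
    qed
    then show ?thesis by (simp add: i0 LIMSEQ_const_iff del: of_nat_Suc)
  qed
  have ae: "AE x in lebesgue. x \<in> box c d \<longrightarrow> h x = 0" if cd: "cbox c d \<subseteq> \<Omega>" for c d
  proof -
    let ?h = "\<lambda>x. indicator (box c d) x * h x"
    have "integrable lebesgue (\<lambda>x. indicator (box c d) x * (indicator (cbox c d) x * h x))"
      using integrable_real_mult_indicator[OF _ hi[OF cd], of "box c d"] by (simp add: mult.commute)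
    moreover have "(\<lambda>x. indicator (box c d) x * (indicator (cbox c d) x * h x)) = ?h"
      using box_subset_cbox[of c d] by (auto simp: indicator_def fun_eq_iff)
    ultimately have hint: "integrable lebesgue ?h" by simp
    have "\<exists>g\<in>borel_measurable lborel. AE x in lborel. ?h x = g x"
      by (rule completion_ex_borel_measurable_real) (rule borel_measurable_integrable[OF hint])
    then obtain g where g [measurable]: "g \<in> borel_measurable lborel" and hg: "AE x in lborel. ?h x = g x"
      by (rule bexE)
    have gm: "g \<in> borel_measurable lebesgue" using g by (rule measurable_completion)
    have hg': "AE x in lebesgue. ?h x = g x" using hg by (rule AE_completion)
    have "integrable lebesgue g"
      using integrable_cong_AE[OF _ gm hg'] hint by auto
    then have gint: "integrable lborel g" using integrable_completion[OF g] by simp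
    have "(LINT x|lborel. indicator (box e f) x * g x) = 0" for e f
    proof -
      have "(LINT x|lborel. indicator (box e f) x * g x) = (LINT x|lebesgue. indicator (box e f) x * g x)"
        by (intro integral_completion[symmetric]) measurable
      also have "\<dots> = (LINT x|lebesgue. indicator (box e f) x * ?h x)"
      proof (intro integral_cong_AE)
        show "(\<lambda>x. indicator (box e f) x * ?h x) \<in> borel_measurable lebesgue"
          by (rule borel_measurable_times[OF borel_measurable_indicator borel_measurable_integrable[OF hint]]) auto
        show "(\<lambda>x. indicator (box e f) x * g x) \<in> borel_measurable lebesgue"
          by (rule borel_measurable_times[OF borel_measurable_indicator gm]) auto
        show "AE x in lebesgue. indicator (box e f) x * g x = indicator (box e f) x * ?h x"
          using hg' by eventually_elim simp
      qed
      also have "\<dots> = (LINT x|lebesgue. indicator (box e f \<inter> box c d) x * h x)"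
        by (intro Bochner_Integration.integral_cong) (auto simp: indicator_def)
      also have "\<dots> = 0"
      proof (cases "box e f \<inter> box c d = {}")
        case False
        \<comment> \<open>The intersection is again a box with closure inside
          \<open>cbox c d\<close>, so \<open>box0\<close> applies to it.\<close>
        obtain a b where ab: "box e f \<inter> box c d = box a b" using box_Int_box[of e f c d] by blast
        with False have "cbox a b = closure (box a b)" by (simp add: closure_box)
        also have "\<dots> \<subseteq> cbox c d"
          using ab box_subset_cbox[of c d] by (intro closure_minimal) auto
        finally show ?thesis using ab box0[of a b] cd by auto
      qed simp
      finally show ?thesis .
    qed
    then have "AE x in lborel. g x = 0"
      using gint by (rule AE_eq_0_of_integral_boxes_eq_0[rotated])
    then have "AE x in lebesgue. g x = 0" by (rule AE_completion)
    then show ?thesis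
      using hg' by eventually_elim (metis indicator_simps(1) mult_1)
  qed
  obtain \<D> where \<D>: "countable \<D>" "\<D> \<subseteq> Pow \<Omega>" "\<And>X. X \<in> \<D> \<Longrightarrow> \<exists>a b. X = cbox a b" "\<Union>\<D> = \<Omega>"
    using open_countable_Union_open_cbox[OF \<Omega>] by metis
  have "AE x in lebesgue. \<forall>X\<in>\<D>. x \<in> X \<longrightarrow> h x = 0"
  proof (subst AE_ball_countable[OF \<D>(1)], intro ballI)
    fix X assume X: "X \<in> \<D>"
    then obtain a b where ab: "X = cbox a b" using \<D>(3) by blast
    have "cbox a b - box a b \<in> null_sets lebesgue"
      using negligible_frontier_interval negligible_iff_null_sets by blast
    then have "AE x in lebesgue. x \<notin> cbox a b - box a b" by (rule AE_not_in)
    moreover have "AE x in lebesgue. x \<in> box a b \<longrightarrow> h x = 0"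
      using ae[of a b] X \<D>(2) ab by blast
    ultimately show "AE x in lebesgue. x \<in> X \<longrightarrow> h x = 0"
      by eventually_elim (use ab in blast)
  qed
  then show ?thesis using \<D>(4) by (auto elim!: eventually_mono)
qed

subsection \<open>Vector fields in the coordinates $(r, \theta)$\<close>

text \<open>\<open>polar_angle i\<close> is the case \<open>e = axis i 1\<close>; an abstract
  Euclidean space makes \<open>Basis\<close> sums and \<open>DIM('a)\<close> available
  directly.\<close>

definition angle_to :: "'a::euclidean_space \<Rightarrow> 'a \<Rightarrow> real" where
  "angle_to e x = arccos (x \<bullet> e / norm x)"

definition axis_line :: "'a::euclidean_space \<Rightarrow> 'a set" where
  "axis_line e = {x. x = (x \<bullet> e) *\<^sub>R e}"

text \<open>Off the axis, the gradient of the angle is \<open>- perp_part e x / (norm x * sin \<theta>)\<close>.\<close>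

definition perp_part :: "'a::euclidean_space \<Rightarrow> 'a \<Rightarrow> 'a" where
  "perp_part e x = e - ((x \<bullet> e) / (norm x)\<^sup>2) *\<^sub>R x"

text \<open>The field with radial part \<open>r powr a * P \<theta>\<close> and polar part \<open>r powr a * Q \<theta>\<close>. On the axis
  the quotient \<open>Q \<theta> / sin \<theta>\<close> is \<open>0\<close>, which is the right value when \<open>Q 0 = 0\<close>.\<close>

definition polar_field :: "'a::euclidean_space \<Rightarrow> real \<Rightarrow> (real \<Rightarrow> real) \<Rightarrow> (real \<Rightarrow> real) \<Rightarrow> 'a \<Rightarrow> 'a" where
  "polar_field e a P Q x = norm x powr a *\<^sub>R
     ((P (angle_to e x) / norm x) *\<^sub>R x - (Q (angle_to e x) / sin (angle_to e x)) *\<^sub>R perp_part e x)"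

lemma closed_axis_line: "closed (axis_line e)"
  unfolding axis_line_def by (intro closed_Collect_eq continuous_intros)

lemma negligible_axis_line:
  fixes e :: "'a::euclidean_space"
  assumes "e \<in> Basis" "2 \<le> DIM('a)"
  shows "negligible (axis_line e)"
proof -
  have "card (Basis - {e}) \<noteq> 0" using assms by simp
  then have "Basis - {e} \<noteq> {}" by (metis card.empty)
  then obtain b where b: "b \<in> Basis" "b \<noteq> e" by auto
  have "axis_line e \<subseteq> {x. x \<bullet> b = 0}"
  proof
    fix x assume "x \<in> axis_line e"
    then have "x \<bullet> b = ((x \<bullet> e) *\<^sub>R e) \<bullet> b" by (simp add: axis_line_def)
    then show "x \<in> {x. x \<bullet> b = 0}" using b assms by (simp add: inner_not_same_Basis)
  qed
  then show ?thesis using negligible_standard_hyperplane[OF b(1), of 0] negligible_subset by blast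
qed

text \<open>A line parallel to the axis avoids it altogether. On any other coordinate line a point
  of the axis has coordinate 0 along \<open>b\<close>, which leaves the single parameter
  \<open>- (x \<bullet> b)\<close>.\<close>

lemma axis_line_meets_parallel_once:
  assumes "e \<in> Basis" "b \<in> Basis" "x \<notin> axis_line e"
  shows "\<exists>c. \<forall>t. t \<noteq> c \<longrightarrow> x + t *\<^sub>R b \<notin> axis_line e"
proof (cases "b = e")
  case True
  then have "x + t *\<^sub>R b \<notin> axis_line e" for t
    using assms by (simp add: axis_line_def inner_add_left inner_Basis algebra_simps)
  then show ?thesis by blast
next
  case False
  have "x + t *\<^sub>R b \<notin> axis_line e" if "t \<noteq> - (x \<bullet> b)" for t
  proof
    assume "x + t *\<^sub>R b \<in> axis_line e"
    then have "(x + t *\<^sub>R b) \<bullet> b = (((x + t *\<^sub>R b) \<bullet> e) *\<^sub>R e) \<bullet> b" by (simp add: axis_line_def)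
    then have "x \<bullet> b + t = 0" using assms False by (simp add: inner_add_left inner_Basis)
    then show False using that by simp
  qed
  then show ?thesis by blast
qed

context
  fixes e x :: "'a::euclidean_space"
  assumes e: "e \<in> Basis" and x: "0 < x \<bullet> e"
begin

lemma half_space_norm_pos: "0 < norm x"
  using x by auto

lemma cos_sector_bounds: "0 < x \<bullet> e / norm x" "x \<bullet> e / norm x \<le> 1"
  using x half_space_norm_pos Cauchy_Schwarz_ineq2[of x e] e
  by (auto simp: divide_simps)

lemma cos_angle_to: "cos (angle_to e x) = x \<bullet> e / norm x"
  unfolding angle_to_def using cos_sector_bounds by (intro cos_arccos) auto

lemma sin_angle_to: "sin (angle_to e x) = sqrt (1 - (x \<bullet> e / norm x)\<^sup>2)"
  unfolding angle_to_def using cos_sector_bounds by (intro sin_arccos) auto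

lemma angle_to_bounds: "0 \<le> angle_to e x" "angle_to e x < pi / 2"
proof -
  show "0 \<le> angle_to e x" unfolding angle_to_def using cos_sector_bounds by (intro arccos_lbound) auto
  show "angle_to e x < pi / 2"
    using arccos_less_arccos[of 0 "x \<bullet> e / norm x"] cos_sector_bounds unfolding angle_to_def by simp
qed

lemma sin_angle_to_nonneg: "0 \<le> sin (angle_to e x)"
  using angle_to_bounds by (intro sin_ge_zero) auto

lemma perp_part_inner [simp]: "perp_part e x \<bullet> x = 0"
  using half_space_norm_pos by (simp add: perp_part_def inner_diff_left inner_diff_right power2_norm_eq_inner inner_commute)

lemma perp_part_inner_self: "perp_part e x \<bullet> perp_part e x = (sin (angle_to e x))\<^sup>2"
proof -
  \<comment> \<open>Only the second factor is unfolded; its multiple of \<open>x\<close> drops out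
    by orthogonality.\<close>
  have "perp_part e x \<bullet> perp_part e x = perp_part e x \<bullet> e"
    unfolding perp_part_def[of e x, THEN arg_cong, of "\<lambda>y. perp_part e x \<bullet> y"]
    by (simp add: inner_diff_right)
  also have "\<dots> = 1 - (x \<bullet> e / norm x)\<^sup>2"
    using e by (simp add: perp_part_def inner_diff_left power2_eq_square inner_Basis)
  finally show ?thesis
    using cos_angle_to sin_squared_eq[of "angle_to e x"] by simp
qed

lemma norm_perp_part: "norm (perp_part e x) = sin (angle_to e x)"
  using perp_part_inner_self sin_angle_to_nonneg by (simp add: norm_eq_sqrt_inner)

text \<open>The vectors \<open>x\<close> and \<open>perp_part e x\<close> are orthogonal, of lengths
  r and sin theta. On the axis division by \<open>sin\<close> returns 0, which agrees with
  \<open>Q 0 = 0\<close>.\<close>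

lemma norm_polar_field:
  assumes "Q 0 = 0"
  shows "norm (polar_field e a P Q x) = norm x powr a * sqrt ((P (angle_to e x))\<^sup>2 + (Q (angle_to e x))\<^sup>2)"
proof -
  let ?t = "angle_to e x"
  define c where "c = Q ?t / sin ?t"
  have c: "c * sin ?t = Q ?t"
  proof (cases "sin ?t = 0")
    case True
    then have "?t = 0" using angle_to_bounds sin_gt_zero[of ?t] by fastforce
    then show ?thesis using assms by (simp add: c_def)
  qed (simp add: c_def)
  let ?w = "(P ?t / norm x) *\<^sub>R x - c *\<^sub>R perp_part e x"
  have "?w \<bullet> ?w = (P ?t / norm x)\<^sup>2 * (x \<bullet> x) + c\<^sup>2 * (perp_part e x \<bullet> perp_part e x)"
    by (simp add: inner_diff_left inner_diff_right inner_commute[of x "perp_part e x"] power2_eq_square)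
  also have "\<dots> = (P ?t)\<^sup>2 + (c * sin ?t)\<^sup>2"
    using half_space_norm_pos
    by (simp add: norm_perp_part power_mult_distrib power_divide power2_norm_eq_inner[symmetric])
  finally have "norm ?w = sqrt ((P ?t)\<^sup>2 + (Q ?t)\<^sup>2)"
    by (simp add: norm_eq_sqrt_inner c)
  then show ?thesis by (simp add: polar_field_def c_def)
qed

context
  assumes xL: "x \<notin> axis_line e"
begin

lemma cos_sector_less_1: "x \<bullet> e / norm x < 1"
proof -
  have "0 < (norm (x - (x \<bullet> e) *\<^sub>R e))\<^sup>2" using xL by (simp add: axis_line_def)
  also have "\<dots> = (norm x)\<^sup>2 - (x \<bullet> e)\<^sup>2"
    unfolding power2_norm_eq_inner
    using e by (simp add: inner_diff_left inner_diff_right inner_Basis inner_commute power2_eq_square)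
  finally have "(x \<bullet> e)\<^sup>2 < (norm x)\<^sup>2" by simp
  then have "x \<bullet> e < norm x" by (rule power_less_imp_less_base) simp
  then show ?thesis using half_space_norm_pos by simp
qed

lemma angle_to_pos: "0 < angle_to e x"
  using arccos_less_arccos[of "x \<bullet> e / norm x" 1] cos_sector_bounds cos_sector_less_1
  unfolding angle_to_def by simp

lemma sin_angle_to_pos: "0 < sin (angle_to e x)"
  using angle_to_pos angle_to_bounds by (intro sin_gt_zero) auto

lemma has_derivative_angle_to:
  "(angle_to e has_derivative (\<lambda>v. - (perp_part e x \<bullet> v) / (norm x * sin (angle_to e x)))) (at x)"
proof -
  have x0: "x \<noteq> 0" using half_space_norm_pos by auto
  have n: "(norm has_derivative (\<lambda>v. (x \<bullet> v) / norm x)) (at x)"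
    using has_derivative_norm[OF x0] by (simp add: sgn_div_norm inner_commute divide_inverse mult.commute)
  have s: "((\<lambda>y. y \<bullet> e / norm y) has_derivative (\<lambda>v. (perp_part e x \<bullet> v) / norm x)) (at x)"
    by (rule has_derivative_eq_rhs[OF has_derivative_divide'[OF has_derivative_inner_left[OF has_derivative_ident] n]])
      (use x0 in \<open>auto simp: perp_part_def inner_diff_left inner_diff_right field_simps power2_eq_square inner_commute\<close>)
  have "DERIV arccos (x \<bullet> e / norm x) :> inverse (- sqrt (1 - (x \<bullet> e / norm x)\<^sup>2))"
    using cos_sector_bounds cos_sector_less_1 by (intro DERIV_arccos) auto
  then have "((\<lambda>y. arccos (y \<bullet> e / norm y)) has_derivative
      (\<lambda>v. - (perp_part e x \<bullet> v) / (norm x * sin (angle_to e x)))) (at x)"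
    by (rule has_derivative_eq_rhs[OF DERIV_compose_FDERIV[OF _ s]])
      (simp add: fun_eq_iff sin_angle_to divide_inverse mult_ac)
  moreover have "angle_to e = (\<lambda>y. arccos (y \<bullet> e / norm y))"
    by (simp add: fun_eq_iff angle_to_def)
  ultimately show ?thesis by simp
qed

lemma has_derivative_norm_powr:
  "((\<lambda>y. norm y powr a) has_derivative (\<lambda>v. a * norm x powr (a - 2) * (x \<bullet> v))) (at x)"
proof -
  have x0: "x \<noteq> 0" using half_space_norm_pos by auto
  have n: "(norm has_derivative (\<lambda>v. (x \<bullet> v) / norm x)) (at x)"
    using has_derivative_norm[OF x0] by (simp add: sgn_div_norm inner_commute divide_inverse mult.commute)
  have "DERIV (\<lambda>r. r powr a) (norm x) :> a * norm x powr (a - 1)"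
    using half_space_norm_pos by (rule has_real_derivative_powr)
  from DERIV_compose_FDERIV[OF this n]
  show ?thesis
    using half_space_norm_pos by (simp add: powr_diff field_simps power2_eq_square)
qed

lemma has_derivative_perp_part:
  "(perp_part e has_derivative (\<lambda>v. - ((e \<bullet> v) / (norm x)\<^sup>2 - 2 * (x \<bullet> e) * (x \<bullet> v) / (norm x)^4) *\<^sub>R x
     - ((x \<bullet> e) / (norm x)\<^sup>2) *\<^sub>R v)) (at x)"
proof -
  have x0: "x \<bullet> x \<noteq> 0" using half_space_norm_pos by auto
  have "perp_part e = (\<lambda>y. e - ((y \<bullet> e) / (y \<bullet> y)) *\<^sub>R y)"
    by (simp add: perp_part_def fun_eq_iff power2_norm_eq_inner)
  moreover have "((\<lambda>y. e - ((y \<bullet> e) / (y \<bullet> y)) *\<^sub>R y) has_derivative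
     (\<lambda>v. - ((e \<bullet> v) / (norm x)\<^sup>2 - 2 * (x \<bullet> e) * (x \<bullet> v) / (norm x)^4) *\<^sub>R x
     - ((x \<bullet> e) / (norm x)\<^sup>2) *\<^sub>R v)) (at x)"
    by (rule has_derivative_eq_rhs, (rule derivative_eq_intros refl x0)+)
      (use x0 in \<open>simp add: fun_eq_iff power2_norm_eq_inner power4_eq_xxxx power2_eq_square[of "norm x"]
        inner_commute field_simps flip: power2_norm_eq_inner\<close>)
  ultimately show ?thesis by simp
qed

text \<open>The derivative, in direction \<open>b\<close>, of the \<open>b\<close>-component of
  \<open>polar_field\<close>. Here \<open>u\<close> and \<open>w\<close> are the components of the
  unit vectors e_r and -e_theta along \<open>b\<close>; arranged like this, sin theta divides only
  \<open>Q\<close> and \<open>perp_part\<close>, and both quotients stay bounded near the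
  axis.\<close>

definition polar_field_diff :: "real \<Rightarrow> (real \<Rightarrow> real) \<Rightarrow> (real \<Rightarrow> real) \<Rightarrow> (real \<Rightarrow> real) \<Rightarrow> (real \<Rightarrow> real) \<Rightarrow> 'a \<Rightarrow> real" where
  "polar_field_diff a P Q P' Q' b =
    (let t = angle_to e x; u = (x \<bullet> b) / norm x; w = (perp_part e x \<bullet> b) / sin t; B = Q t / sin t
     in norm x powr (a - 1) * (a * u * (P t * u - Q t * w) - P' t * w * u - P t * u\<^sup>2 + P t
        + (Q' t - B * cos t) * w\<^sup>2 + B * (e \<bullet> b - 2 * cos t * u) * u + B * cos t))"

lemma has_derivative_along:
  assumes "(f has_derivative f') (at x)"
  shows "((\<lambda>t. f (x + t *\<^sub>R b)) has_real_derivative (f' b :: real)) (at 0)"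
proof -
  have "((\<lambda>t. x + t *\<^sub>R b) has_derivative (\<lambda>t. t *\<^sub>R b)) (at 0)"
    by (auto intro!: derivative_eq_intros)
  then have "(f \<circ> (\<lambda>t. x + t *\<^sub>R b) has_derivative f' \<circ> (\<lambda>t. t *\<^sub>R b)) (at 0)"
    by (rule diff_chain_at) (simp add: assms)
  moreover have "f' (t *\<^sub>R b) = f' b * t" for t
    using has_derivative_linear[OF assms] by (simp add: linear_scale)
  ultimately show ?thesis by (simp add: has_field_derivative_def o_def)
qed

lemma polar_field_has_derivative_along:
  assumes b: "b \<in> Basis"
    and P: "(P has_real_derivative P' (angle_to e x)) (at (angle_to e x))"
    and Q: "(Q has_real_derivative Q' (angle_to e x)) (at (angle_to e x))"
  shows "((\<lambda>t. polar_field e a P Q (x + t *\<^sub>R b) \<bullet> b) has_real_derivative polar_field_diff a P Q P' Q' b) (at 0)"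
proof -
  let ?t = "angle_to e x"
  define r s c where "r = norm x" and "s = sin ?t" and "c = cos ?t"
  define u w where "u = (x \<bullet> b) / norm x" and "w = (perp_part e x \<bullet> b) / sin ?t"
  have r: "r > 0" using half_space_norm_pos by (simp add: r_def)
  have s: "s > 0" using sin_angle_to_pos by (simp add: s_def)
  have X: "x \<bullet> b = u * r" "perp_part e x \<bullet> b = w * s" "x \<bullet> e = c * r"
    using r s by (simp_all add: u_def w_def r_def s_def c_def cos_angle_to)
  have bb: "b \<bullet> b = 1" using b by simp
  have d1: "((\<lambda>t. norm (x + t *\<^sub>R b) powr m) has_real_derivative m * r powr (m - 2) * (u * r)) (at 0)" for m
    using has_derivative_along[OF has_derivative_norm_powr[of m], of b] by (simp add: X r_def)
  have d2: "((\<lambda>t. angle_to e (x + t *\<^sub>R b)) has_real_derivative - w / r) (at 0)"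
    using has_derivative_along[OF has_derivative_angle_to, of b] s by (simp add: X r_def[symmetric] s_def[symmetric])
  have d3: "((\<lambda>t. (x + t *\<^sub>R b) \<bullet> b) has_real_derivative 1) (at 0)"
    by (auto intro!: derivative_eq_intros simp: inner_add_left bb)
  have d4: "((\<lambda>t. perp_part e (x + t *\<^sub>R b) \<bullet> b) has_real_derivative
      - ((e \<bullet> b) / r\<^sup>2 - 2 * (c * r) * (u * r) / r^4) * (u * r) - c * r / r\<^sup>2) (at 0)"
    using has_derivative_along[OF has_derivative_inner_left[OF has_derivative_perp_part], of b b]
    by (simp add: X r_def[symmetric] bb inner_diff_left inner_add_left)
  have P0: "((\<lambda>t. P (angle_to e (x + t *\<^sub>R b))) has_real_derivative P' ?t * (- w / r)) (at 0)"
    using P by (intro DERIV_chain2[OF _ d2]) simp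
  have Q0: "((\<lambda>t. Q (angle_to e (x + t *\<^sub>R b))) has_real_derivative Q' ?t * (- w / r)) (at 0)"
    using Q by (intro DERIV_chain2[OF _ d2]) simp
  have S0: "((\<lambda>t. sin (angle_to e (x + t *\<^sub>R b))) has_real_derivative c * (- w / r)) (at 0)"
    unfolding c_def by (intro DERIV_chain2[OF _ d2]) (simp add: DERIV_sin)
  have B0: "((\<lambda>t. Q (angle_to e (x + t *\<^sub>R b)) / sin (angle_to e (x + t *\<^sub>R b))) has_real_derivative
      (Q' ?t * (- w / r) * s - Q ?t * (c * (- w / r))) / (s * s)) (at 0)"
    using DERIV_divide[OF Q0 S0] s by (simp add: s_def)
  note D = DERIV_diff[OF DERIV_mult[OF DERIV_mult[OF d1[of "a - 1"] P0] d3] DERIV_mult[OF DERIV_mult[OF d1[of a] B0] d4]]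
  have eq: "polar_field e a P Q y \<bullet> b = norm y powr (a - 1) * P (angle_to e y) * (y \<bullet> b)
     - norm y powr a * (Q (angle_to e y) / sin (angle_to e y)) * (perp_part e y \<bullet> b)" if "y \<noteq> 0" for y
    using that by (simp add: polar_field_def inner_diff_left powr_diff algebra_simps)
  have "\<forall>\<^sub>F t in nhds 0. x + t *\<^sub>R b \<noteq> 0"
  proof -
    have "continuous_on UNIV (\<lambda>t. x + t *\<^sub>R b)" by (intro continuous_intros)
    then have "open ((\<lambda>t. x + t *\<^sub>R b) -` (- {0}))" by (intro open_vimage) auto
    moreover have "x \<noteq> 0" using x by auto
    ultimately show ?thesis
      by (auto simp: eventually_nhds intro!: exI[of _ "(\<lambda>t. x + t *\<^sub>R b) -` (- {0})"])
  qed
  then have ev: "\<forall>\<^sub>F t in nhds 0. polar_field e a P Q (x + t *\<^sub>R b) \<bullet> b =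
     norm (x + t *\<^sub>R b) powr (a - 1) * P (angle_to e (x + t *\<^sub>R b)) * ((x + t *\<^sub>R b) \<bullet> b)
     - norm (x + t *\<^sub>R b) powr a * (Q (angle_to e (x + t *\<^sub>R b)) / sin (angle_to e (x + t *\<^sub>R b))) * (perp_part e (x + t *\<^sub>R b) \<bullet> b)"
    by eventually_elim (rule eq)
  have p1: "r powr a = r powr (a - 1) * r" and p2: "r powr (a - 2) = r powr (a - 1) / r"
    and p3: "r powr (a - 3) = r powr (a - 1) / r\<^sup>2"
    using r by (simp_all add: powr_diff power2_eq_square power3_eq_cube)
  show ?thesis
    by (rule DERIV_cong_ev[THEN iffD2, OF refl ev _ D[THEN DERIV_cong]]; (rule refl)?)
      (use r s in \<open>simp add: polar_field_diff_def Let_def X bb r_def[symmetric] s_def[symmetric] c_def[symmetric]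
        p1 p2 p3 field_simps power2_eq_square power3_eq_cube power4_eq_xxxx\<close>)
qed

text \<open>All direction cosines are at most 1 and \<open>P\<close>, \<open>P'\<close>,
  \<open>Q'\<close>, \<open>Q / sin\<close> are at most \<open>C\<close>. The seven terms contribute
  2|a|, 1, 1, 1, 2, 3 and 1 times \<open>C\<close>.\<close>

lemma polar_field_diff_bound:
  assumes b: "b \<in> Basis" and C: "\<bar>P (angle_to e x)\<bar> \<le> C" "\<bar>P' (angle_to e x)\<bar> \<le> C"
    "\<bar>Q' (angle_to e x)\<bar> \<le> C" "\<bar>Q (angle_to e x)\<bar> \<le> C * sin (angle_to e x)"
  shows "\<bar>polar_field_diff a P Q P' Q' b\<bar> \<le> norm x powr (a - 1) * ((2 * \<bar>a\<bar> + 9) * C)"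
proof -
  let ?t = "angle_to e x"
  define u w B c where "u = (x \<bullet> b) / norm x" and "w = (perp_part e x \<bullet> b) / sin ?t"
    and "B = Q ?t / sin ?t" and "c = cos ?t"
  have s: "sin ?t > 0" by (rule sin_angle_to_pos)
  have C0: "C \<ge> 0" using C(1) by linarith
  have u: "\<bar>u\<bar> \<le> 1" using Basis_le_norm[OF b, of x] half_space_norm_pos by (simp add: u_def)
  have w: "\<bar>w\<bar> \<le> 1" using Basis_le_norm[OF b, of "perp_part e x"] s by (simp add: w_def norm_perp_part)
  have B: "\<bar>B\<bar> \<le> C" using C(4) s by (simp add: B_def divide_le_eq)
  have c: "\<bar>c\<bar> \<le> 1" by (simp add: c_def abs_cos_le_one)
  have E: "\<bar>e \<bullet> b\<bar> \<le> 1" using Basis_le_norm[OF b, of e] e by simp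
  have Q: "\<bar>Q ?t\<bar> \<le> C" using C(4) mult_left_le[OF sin_le_one[of ?t] C0] by linarith
  have m1: "\<bar>p * q\<bar> \<le> D" if "\<bar>p\<bar> \<le> D" "\<bar>q\<bar> \<le> 1" for p q D :: real
    using that mult_mono[of "\<bar>p\<bar>" D "\<bar>q\<bar>" 1] by (simp add: abs_mult)
  have t1: "\<bar>a * u * (P ?t * u - Q ?t * w)\<bar> \<le> \<bar>a\<bar> * (2 * C)"
  proof -
    have "\<bar>P ?t * u - Q ?t * w\<bar> \<le> 2 * C" using m1[OF C(1) u] m1[OF Q w] by linarith
    moreover have "\<bar>a * u\<bar> \<le> \<bar>a\<bar>" using m1[OF order_refl u] .
    ultimately show ?thesis unfolding abs_mult[of "a * u"] by (intro mult_mono) auto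
  qed
  have t2: "\<bar>P' ?t * w * u\<bar> \<le> C" using m1[OF m1[OF C(2) w] u] .
  have t3: "\<bar>P ?t * u\<^sup>2\<bar> \<le> C" using m1[OF m1[OF C(1) u] u] by (simp add: power2_eq_square mult.assoc)
  have t4: "\<bar>(Q' ?t - B * c) * w\<^sup>2\<bar> \<le> 2 * C"
  proof -
    have "\<bar>Q' ?t - B * c\<bar> \<le> 2 * C" using C(3) m1[OF B c] by linarith
    from m1[OF m1[OF this w] w] show ?thesis by (simp add: power2_eq_square mult.assoc)
  qed
  have t5: "\<bar>B * (e \<bullet> b - 2 * c * u) * u\<bar> \<le> 3 * C"
  proof -
    have "\<bar>e \<bullet> b - 2 * c * u\<bar> \<le> 3" using E m1[OF c u] by (simp add: mult.assoc)
    then have "\<bar>B * (e \<bullet> b - 2 * c * u)\<bar> \<le> C * 3" unfolding abs_mult using B by (intro mult_mono) auto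
    from m1[OF this u] show ?thesis by simp
  qed
  have t6: "\<bar>B * c\<bar> \<le> C" using m1[OF B c] .
  have "\<bar>a * u * (P ?t * u - Q ?t * w) - P' ?t * w * u - P ?t * u\<^sup>2 + P ?t
        + (Q' ?t - B * c) * w\<^sup>2 + B * (e \<bullet> b - 2 * c * u) * u + B * c\<bar> \<le> (2 * \<bar>a\<bar> + 9) * C"
    using t1 t2 t3 t4 t5 t6 C(1) by (simp add: algebra_simps) linarith
  then show ?thesis
    unfolding polar_field_diff_def Let_def u_def[symmetric] w_def[symmetric] B_def[symmetric] c_def[symmetric]
    by (simp add: abs_mult mult_left_mono)
qed

text \<open>Orthonormality of e_r and e_theta evaluates the sums of products of direction cosines;
  the summand independent of \<open>b\<close> is counted \<open>DIM('a)\<close> times. The outcome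
  is the divergence in polar coordinates, with the cotangent coming from the other angular
  directions.\<close>

lemma sum_polar_field_diff:
  "(\<Sum>b\<in>Basis. polar_field_diff a P Q P' Q' b) = norm x powr (a - 1) *
     ((a + real DIM('a) - 1) * P (angle_to e x) + Q' (angle_to e x)
       + (real DIM('a) - 2) * cot (angle_to e x) * Q (angle_to e x))"
proof -
  let ?t = "angle_to e x"
  define u w where "u b = (x \<bullet> b) / norm x" and "w b = (perp_part e x \<bullet> b) / sin ?t" for b
  define B c where "B = Q ?t / sin ?t" and "c = cos ?t"
  have s: "sin ?t > 0" by (rule sin_angle_to_pos)
  have n: "norm x > 0" by (rule half_space_norm_pos)
  have uu: "(\<Sum>b\<in>Basis. u b * u b) = 1"
    using n by (simp add: u_def power2_norm_eq_inner[symmetric] power2_eq_square euclidean_inner[of x x, symmetric] flip: sum_divide_distrib)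
  have ww: "(\<Sum>b\<in>Basis. w b * w b) = 1"
    using s perp_part_inner_self
    by (simp add: w_def power2_eq_square euclidean_inner[of "perp_part e x" "perp_part e x", symmetric] flip: sum_divide_distrib)
  have uw: "(\<Sum>b\<in>Basis. u b * w b) = 0"
    using euclidean_inner[of "x" "perp_part e x"] perp_part_inner
    by (simp add: u_def w_def inner_commute[of x "perp_part e x"] flip: sum_divide_distrib)
  have eu: "(\<Sum>b\<in>Basis. (e \<bullet> b) * u b) = c"
    using euclidean_inner[of e x]
    by (simp add: u_def c_def cos_angle_to inner_commute[of e x] flip: sum_divide_distrib)
  have "polar_field_diff a P Q P' Q' b = norm x powr (a - 1) * ((a * P ?t - P ?t - 2 * B * c) * (u b * u b)
     - (a * Q ?t + P' ?t) * (u b * w b) + (Q' ?t - B * c) * (w b * w b) + B * ((e \<bullet> b) * u b) + (P ?t + B * c))" for b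
    unfolding polar_field_diff_def Let_def u_def[symmetric] w_def[symmetric] B_def[symmetric] c_def[symmetric]
    by (simp add: algebra_simps power2_eq_square)
  then have "(\<Sum>b\<in>Basis. polar_field_diff a P Q P' Q' b) = norm x powr (a - 1) *
    ((a * P ?t - P ?t - 2 * B * c) * (\<Sum>b\<in>Basis. u b * u b) - (a * Q ?t + P' ?t) * (\<Sum>b\<in>Basis. u b * w b)
     + (Q' ?t - B * c) * (\<Sum>b\<in>Basis. w b * w b) + B * (\<Sum>b\<in>Basis. (e \<bullet> b) * u b) + real DIM('a) * (P ?t + B * c))"
    by (simp add: sum.distrib sum_subtractf flip: sum_distrib_left)
  also have "\<dots> = norm x powr (a - 1) * ((a + real DIM('a) - 1) * P ?t + Q' ?t + (real DIM('a) - 2) * cot ?t * Q ?t)"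
    unfolding uu ww uw eu using s by (simp add: B_def c_def cot_def field_simps)
  finally show ?thesis .
qed

lemma has_derivative_radial_times_angular:
  assumes "(f has_real_derivative f' (angle_to e x)) (at (angle_to e x))"
  shows "((\<lambda>y. norm y powr k * f (angle_to e y)) has_derivative
     (\<lambda>v. polar_field e (k - 1) (\<lambda>t. k * f t) f' x \<bullet> v)) (at x)"
proof -
  have n: "norm x > 0" by (rule half_space_norm_pos)
  have p: "norm x powr (k - 1) = norm x powr k / norm x" "norm x powr (k - 2) = norm x powr k / (norm x)\<^sup>2"
    using n by (simp_all add: powr_diff power2_eq_square)
  have "((\<lambda>y. f (angle_to e y)) has_derivative (\<lambda>v. - (perp_part e x \<bullet> v) / (norm x * sin (angle_to e x)) * f' (angle_to e x))) (at x)"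
    by (rule has_derivative_eq_rhs[OF DERIV_compose_FDERIV[OF assms has_derivative_angle_to]]) (simp add: fun_eq_iff)
  from has_derivative_mult[OF has_derivative_norm_powr[of k] this]
  show ?thesis
    by (rule has_derivative_eq_rhs)
      (use n in \<open>simp add: fun_eq_iff polar_field_def p inner_diff_left field_simps power2_eq_square\<close>)
qed

end

end

section \<open>Local integrability, and continuity of polar fields across the axis\<close>

lemma integrable_lebesgue_on_compact:
  fixes f :: "'a::euclidean_space \<Rightarrow> 'b::euclidean_space"
  assumes "compact K" "continuous_on K f"
  shows "integrable (lebesgue_on K) f"
proof -
  have "integrable lborel (\<lambda>x. indicator K x *\<^sub>R f x)"
    using assms by (rule borel_integrable_compact)
  then have "integrable lebesgue (\<lambda>x. indicator K x *\<^sub>R f x)"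
    by (subst integrable_completion) auto
  then have "integrable lebesgue (\<lambda>x. if x \<in> K then f x else 0)"
    by (simp add: indicator_scaleR_eq_if)
  then show ?thesis
    using Lebesgue_Measure.integrable_restrict_UNIV[of K f] assms(1) lmeasurable_compact by blast
qed

lemma Lp_loc_continuous:
  assumes "open \<Omega>" "continuous_on \<Omega> g" "0 < p"
  shows "Lp_loc p \<Omega> g"
  unfolding Lp_loc_def
proof (intro conjI allI impI)
  show "g \<in> borel_measurable (lebesgue_on \<Omega>)"
    using assms by (intro continuous_imp_measurable_on_sets_lebesgue) auto
  fix K assume K: "compact K \<and> K \<subseteq> \<Omega>"
  then have "continuous_on K g" using assms(2) continuous_on_subset by blast
  then have "continuous_on K (\<lambda>x. norm (g x) powr p)"
    using assms(3) by (intro continuous_on_powr' continuous_intros) auto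
  then show "integrable (lebesgue_on K) (\<lambda>x. norm (g x) powr p)"
    using K by (intro integrable_lebesgue_on_compact) auto
qed

lemma Lp_loc_1_integrable:
  fixes g :: "'a::euclidean_space \<Rightarrow> 'b::euclidean_space"
  assumes "Lp_loc 1 \<Omega> g" "compact K" "K \<subseteq> \<Omega>"
  shows "integrable (lebesgue_on K) g"
proof -
  have "g \<in> borel_measurable (lebesgue_on \<Omega>)" and *: "integrable (lebesgue_on K) (\<lambda>x. norm (g x) powr 1)"
    using assms by (auto simp: Lp_loc_def)
  then have "g \<in> borel_measurable (lebesgue_on K)"
    using measurable_restrict_mono[OF _ assms(3)] by blast
  moreover have "integrable (lebesgue_on K) (\<lambda>x. norm (g x))" using * by simp
  ultimately show ?thesis by (rule integrable_norm_cancel[rotated])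
qed

lemma compact_bounded_continuous:
  fixes f :: "'a::euclidean_space \<Rightarrow> 'b::euclidean_space"
  assumes "compact K" "continuous_on K f"
  shows "\<exists>M. \<forall>x\<in>K. norm (f x) \<le> M"
  using compact_imp_bounded[OF compact_continuous_image[OF assms(2,1)]] by (auto simp: bounded_iff)

lemma integrable_test_fun_scaleR:
  fixes g :: "'a::euclidean_space \<Rightarrow> 'b::euclidean_space"
  assumes \<Omega>: "open \<Omega>" and \<phi>: "\<phi> \<in> test_fun \<Omega>" and g: "Lp_loc 1 \<Omega> g"
  shows "integrable (lebesgue_on \<Omega>) (\<lambda>x. \<phi> x *\<^sub>R g x)"
proof -
  obtain K where K: "compact K" "K \<subseteq> \<Omega>" "\<And>x. x \<notin> K \<Longrightarrow> \<phi> x = 0" "continuous_on UNIV \<phi>"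
    using test_funD[OF \<phi>] by metis
  obtain M where M: "\<And>x. x \<in> K \<Longrightarrow> norm (\<phi> x) \<le> M"
    using compact_bounded_continuous[OF K(1) continuous_on_subset[OF K(4)]] by auto
  have Ks: "K \<in> sets lebesgue" using K(1) by (auto simp: compact_imp_closed)
  have gi: "integrable lebesgue (\<lambda>x. if x \<in> K then g x else 0)"
    using Lp_loc_1_integrable[OF g K(1,2)] Lebesgue_Measure.integrable_restrict_UNIV[OF Ks] by blast
  have "integrable lebesgue (\<lambda>x. \<phi> x *\<^sub>R (if x \<in> K then g x else 0))"
  proof (rule Bochner_Integration.integrable_bound)
    show "integrable lebesgue (\<lambda>x. M *\<^sub>R (if x \<in> K then g x else 0))"
      using gi by (rule integrable_scaleR_right)
    have "\<phi> \<in> borel_measurable lebesgue"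
      using K(4) by (intro measurable_completion) (simp add: borel_measurable_continuous_onI)
    then show "(\<lambda>x. \<phi> x *\<^sub>R (if x \<in> K then g x else 0)) \<in> borel_measurable lebesgue"
      using borel_measurable_integrable[OF gi] by (rule borel_measurable_scaleR)
    show "AE x in lebesgue. norm (\<phi> x *\<^sub>R (if x \<in> K then g x else 0)) \<le> norm (M *\<^sub>R (if x \<in> K then g x else 0))"
      using M by (intro always_eventually allI) (auto intro!: mult_right_mono intro: order_trans[OF _ abs_ge_self])
  qed
  moreover have "(\<lambda>x. \<phi> x *\<^sub>R (if x \<in> K then g x else 0)) = (\<lambda>x. \<phi> x *\<^sub>R g x)"
    using K(3) by auto
  ultimately show ?thesis
    using integral_lebesgue_on_eq(2)[OF \<Omega>, of "\<lambda>x. \<phi> x *\<^sub>R g x"] K by force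
qed

lemma open_inner_half_space: "open {x::'a::euclidean_space. 0 < x \<bullet> e}"
  by (intro open_Collect_less continuous_intros)

lemma continuous_on_angle_to:
  assumes e: "e \<in> Basis"
  shows "continuous_on {x. 0 < x \<bullet> e} (angle_to e)"
  unfolding angle_to_def
proof (rule continuous_on_arccos)
  show "continuous_on {x. 0 < x \<bullet> e} (\<lambda>x. x \<bullet> e / norm x)"
    by (intro continuous_intros) auto
  show "\<forall>x\<in>{x. 0 < x \<bullet> e}. - 1 \<le> x \<bullet> e / norm x \<and> x \<bullet> e / norm x \<le> 1"
    using cos_sector_bounds[OF e] by fastforce
qed

lemma continuous_on_perp_part: "continuous_on {x. 0 < x \<bullet> e} (perp_part e)"
  unfolding perp_part_def[abs_def] by (intro continuous_intros) auto

text \<open>Only the polar part is in doubt, and only on the axis. There \<open>Q / sin\<close> is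
  bounded by \<open>C\<close> while \<open>perp_part e x\<close> tends to 0, so the product has
  limit 0, its value on the axis.\<close>

lemma continuous_on_polar_field:
  assumes e: "e \<in> Basis" and P: "continuous_on {0..<pi/2} P" and Q: "continuous_on {0..<pi/2} Q"
    and C: "\<And>t. 0 \<le> t \<Longrightarrow> t < pi/2 \<Longrightarrow> \<bar>Q t\<bar> \<le> C * sin t"
  shows "continuous_on {x. 0 < x \<bullet> e} (polar_field e a P Q)"
proof -
  let ?H = "{x. 0 < x \<bullet> e}"
  have ang: "continuous_on ?H (angle_to e)" by (rule continuous_on_angle_to[OF e])
  have im: "angle_to e ` ?H \<subseteq> {0..<pi/2}" using angle_to_bounds[OF e] by auto
  have PA: "continuous_on ?H (\<lambda>x. P (angle_to e x))" "continuous_on ?H (\<lambda>x. Q (angle_to e x))"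
    using continuous_on_compose2[OF P ang im] continuous_on_compose2[OF Q ang im] by auto
  have n0: "norm x \<noteq> 0" if "x \<in> ?H" for x using that by auto
  let ?z = "\<lambda>x. (Q (angle_to e x) / sin (angle_to e x)) *\<^sub>R perp_part e x"
  have zb: "norm (?z x) \<le> C * norm (perp_part e x)" if "x \<in> ?H" for x
  proof -
    have x: "0 < x \<bullet> e" using that by simp
    have q: "\<bar>Q (angle_to e x)\<bar> \<le> C * sin (angle_to e x)"
      using C angle_to_bounds[OF e x] by blast
    have "\<bar>Q (angle_to e x) / sin (angle_to e x)\<bar> * sin (angle_to e x) \<le> C * sin (angle_to e x)"
      using q sin_angle_to_nonneg[OF e x] by (cases "sin (angle_to e x) = 0") auto
    then show ?thesis by (simp add: norm_perp_part[OF e x])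
  qed
  have "continuous_on ?H ?z"
  proof (rule continuous_at_imp_continuous_on, rule ballI)
    fix x assume x: "x \<in> ?H"
    show "isCont ?z x"
    proof (cases "x \<in> axis_line e")
      case False
      have op: "open (?H - axis_line e)"
        using open_inner_half_space closed_axis_line by (rule open_Diff)
      have "continuous_on (?H - axis_line e) ?z"
        using sin_angle_to_pos[OF e]
        by (intro continuous_intros continuous_on_subset[OF PA(2)] continuous_on_subset[OF ang]
            continuous_on_subset[OF continuous_on_perp_part]) fastforce+
      then show ?thesis using continuous_on_eq_continuous_at[OF op] x False by blast
    next
      case True
      define c where "c = x \<bullet> e"
      have c: "x = c *\<^sub>R e" "c > 0" using True x by (auto simp: axis_line_def c_def)
      have "perp_part e x = 0"
        using e c(2) unfolding c(1) by (simp add: perp_part_def power2_eq_square)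
      moreover have "isCont (perp_part e) x"
        using continuous_on_perp_part x continuous_on_eq_continuous_at[OF open_inner_half_space] by blast
      ultimately have "((\<lambda>y. C * norm (perp_part e y)) \<longlongrightarrow> C * norm (0::'a)) (at x)"
        by (intro tendsto_intros) (simp add: isCont_def)
      then have "((\<lambda>y. C * norm (perp_part e y)) \<longlongrightarrow> 0) (at x)" by simp
      moreover have "\<forall>\<^sub>F y in at x. norm (?z y) \<le> C * norm (perp_part e y)"
        using eventually_at_in_open'[OF open_inner_half_space x] by eventually_elim (rule zb)
      ultimately have "(?z \<longlongrightarrow> 0) (at x)"
        by (rule Lim_null_comparison[rotated])
      then show ?thesis using \<open>perp_part e x = 0\<close> by (simp add: isCont_def)
    qed
  qed
  moreover have "continuous_on ?H (\<lambda>x. (P (angle_to e x) / norm x) *\<^sub>R x)" (is "continuous_on _ ?y")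
    using n0 by (intro continuous_intros PA(1)) auto
  moreover have "continuous_on ?H (\<lambda>x. norm x powr a)"
    using n0 by (intro continuous_intros) auto
  ultimately show ?thesis
    unfolding polar_field_def[abs_def]
    using continuous_on_scaleR[of ?H "\<lambda>x. norm x powr a" "\<lambda>x. ?y x - ?z x"] continuous_on_diff[of ?H ?y ?z] by blast
qed

section \<open>Polar fields that are weakly divergence free\<close>

text \<open>Instantiated by the gradient (k f, f') and by the flux, which is the gradient times
  |grad u|^(p-2). The bound \<open>bdQ\<close> by a multiple of \<open>sin\<close> is what controls
  the field near the axis.\<close>

locale polar_pair =
  fixes e :: "'a::euclidean_space" and P Q P' Q' :: "real \<Rightarrow> real" and C :: real
  assumes e: "e \<in> Basis" and dim: "2 \<le> DIM('a)"
    and contP: "continuous_on {0..<pi/2} P" and contQ: "continuous_on {0..<pi/2} Q"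
    and derP: "\<And>t. 0 < t \<Longrightarrow> t < pi/2 \<Longrightarrow> (P has_real_derivative P' t) (at t)"
    and derQ: "\<And>t. 0 < t \<Longrightarrow> t < pi/2 \<Longrightarrow> (Q has_real_derivative Q' t) (at t)"
    and bdP: "\<And>t. 0 < t \<Longrightarrow> t < pi/2 \<Longrightarrow> \<bar>P t\<bar> \<le> C"
    and bdP': "\<And>t. 0 < t \<Longrightarrow> t < pi/2 \<Longrightarrow> \<bar>P' t\<bar> \<le> C"
    and bdQ': "\<And>t. 0 < t \<Longrightarrow> t < pi/2 \<Longrightarrow> \<bar>Q' t\<bar> \<le> C"
    and bdQ: "\<And>t. 0 \<le> t \<Longrightarrow> t < pi/2 \<Longrightarrow> \<bar>Q t\<bar> \<le> C * sin t"
begin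

lemma continuous_field: "continuous_on {x. 0 < x \<bullet> e} (polar_field e a P Q)"
  using continuous_on_polar_field[OF e contP contQ bdQ] .

definition field_div :: "real \<Rightarrow> 'a \<Rightarrow> real" where
  "field_div a x = (\<Sum>b\<in>Basis. polar_field_diff e x a P Q P' Q' b)"

lemma field_div_eq:
  assumes "0 < x \<bullet> e" "x \<notin> axis_line e"
  shows "field_div a x = norm x powr (a - 1) *
     ((a + real DIM('a) - 1) * P (angle_to e x) + Q' (angle_to e x)
       + (real DIM('a) - 2) * cot (angle_to e x) * Q (angle_to e x))"
  unfolding field_div_def using sum_polar_field_diff[OF e assms] .

lemma divergence_theorem_test_fun:
  assumes \<phi>: "\<phi> \<in> test_fun {x. 0 < x \<bullet> e}"
  shows "(LINT x|lebesgue_on {x. 0 < x \<bullet> e}. polar_field e a P Q x \<bullet> grad \<phi> x)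
    = - (LINT x|lebesgue_on {x. 0 < x \<bullet> e}. \<phi> x * field_div a x)"
proof -
  let ?H = "{x. 0 < x \<bullet> e}"
  note ang = angle_to_pos[OF e] angle_to_bounds[OF e]
  have der: "((\<lambda>t. polar_field e a P Q (x + t *\<^sub>R b) \<bullet> b) has_real_derivative polar_field_diff e x a P Q P' Q' b) (at 0)"
    if "b \<in> Basis" "x \<in> ?H - axis_line e" for b x
    using that ang[of x] by (intro polar_field_has_derivative_along[OF e] derP derQ) auto
  have bd: "\<exists>M. \<forall>x\<in>K - axis_line e. \<bar>polar_field_diff e x a P Q P' Q' b\<bar> \<le> M"
    if b: "b \<in> Basis" and K: "compact K" "K \<subseteq> ?H" for b K
  proof -
    have "continuous_on K (\<lambda>x. norm x powr (a - 1) * ((2 * \<bar>a\<bar> + 9) * C))"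
      using K(2) by (intro continuous_intros) auto
    then obtain M where M: "\<And>x. x \<in> K \<Longrightarrow> norm (norm x powr (a - 1) * ((2 * \<bar>a\<bar> + 9) * C)) \<le> M"
      using compact_bounded_continuous[OF K(1)] by blast
    have "\<bar>polar_field_diff e x a P Q P' Q' b\<bar> \<le> M" if x: "x \<in> K - axis_line e" for x
    proof -
      have x': "0 < x \<bullet> e" "x \<notin> axis_line e" using x K(2) by auto
      have t: "0 < angle_to e x" "0 \<le> angle_to e x" "angle_to e x < pi/2" using ang[of x] x' by auto
      have "\<bar>polar_field_diff e x a P Q P' Q' b\<bar> \<le> norm x powr (a - 1) * ((2 * \<bar>a\<bar> + 9) * C)"
        using t by (intro polar_field_diff_bound[OF e x' b] bdP bdP' bdQ bdQ')
      then show ?thesis using M[of x] x by auto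
    qed
    then show ?thesis by blast
  qed
  have cont: "continuous_on ?H (\<lambda>x. polar_field e a P Q x \<bullet> b)" for b
    by (intro continuous_intros continuous_field)
  note I = integration_by_parts_test_fun[OF open_inner_half_space \<phi> _ cont
      negligible_axis_line[OF e dim] axis_line_meets_parallel_once[OF e] der bd]
  have "(LINT x|lebesgue_on ?H. polar_field e a P Q x \<bullet> grad \<phi> x)
     = (LINT x|lebesgue_on ?H. (\<Sum>b\<in>Basis. (polar_field e a P Q x \<bullet> b) * (grad \<phi> x \<bullet> b)))"
    by (subst euclidean_inner) simp
  also have "\<dots> = (\<Sum>b\<in>Basis. LINT x|lebesgue_on ?H. (polar_field e a P Q x \<bullet> b) * (grad \<phi> x \<bullet> b))"
    by (intro Bochner_Integration.integral_sum I(1))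
  also have "\<dots> = (\<Sum>b\<in>Basis. - (LINT x|lebesgue_on ?H. \<phi> x * polar_field_diff e x a P Q P' Q' b))"
    by (intro sum.cong refl I(3))
  also have "\<dots> = - (LINT x|lebesgue_on ?H. (\<Sum>b\<in>Basis. \<phi> x * polar_field_diff e x a P Q P' Q' b))"
    unfolding sum_negf by (subst Bochner_Integration.integral_sum) (auto intro: I(2))
  also have "\<dots> = - (LINT x|lebesgue_on ?H. \<phi> x * field_div a x)"
    by (simp add: field_div_def sum_distrib_left)
  finally show ?thesis .
qed

lemma exists_point_at_angle:
  assumes "0 < t" "t < pi/2"
  obtains x where "0 < x \<bullet> e" "x \<notin> axis_line e" "angle_to e x = t"
proof -
  have "card (Basis - {e}) \<noteq> 0" using e dim by simp
  then have "Basis - {e} \<noteq> {}" by (metis card.empty)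
  then obtain b where b: "b \<in> Basis" "b \<noteq> e" by auto
  define x where "x = cos t *\<^sub>R e + sin t *\<^sub>R b"
  have s: "sin t > 0" "cos t > 0" using assms by (auto intro: sin_gt_zero cos_gt_zero)
  have xe: "x \<bullet> e = cos t" using e b by (simp add: x_def inner_add_left inner_Basis)
  have "x \<bullet> x = cos t * cos t + sin t * sin t"
    using e b by (simp add: x_def inner_add_left inner_add_right inner_Basis)
  then have "norm x = 1" by (simp add: norm_eq_sqrt_inner flip: power2_eq_square)
  then have "angle_to e x = t" using assms by (simp add: angle_to_def xe arccos_cos)
  moreover have "x \<notin> axis_line e"
  proof
    assume "x \<in> axis_line e"
    then have "x \<bullet> b = ((x \<bullet> e) *\<^sub>R e) \<bullet> b" by (simp add: axis_line_def)
    then show False using e b s by (simp add: x_def inner_add_left inner_Basis)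
  qed
  moreover have "0 < x \<bullet> e" using xe s by simp
  ultimately show ?thesis using that by blast
qed

text \<open>Forwards, tests are taken with support off the axis, where the divergence is continuous:
  it vanishes almost everywhere, hence everywhere there, and every angle in (0, pi/2) is attained by
  some point. Backwards, the divergence vanishes off the axis, a null set.\<close>

lemma weakly_div_free_iff:
  assumes contQ': "continuous_on {0<..<pi/2} Q'"
  shows "(\<forall>\<phi>\<in>test_fun {x. 0 < x \<bullet> e}.
      (LINT x|lebesgue_on {x. 0 < x \<bullet> e}. polar_field e a P Q x \<bullet> grad \<phi> x) = 0) \<longleftrightarrow>
    (\<forall>t. 0 < t \<and> t < pi/2 \<longrightarrow> (a + real DIM('a) - 1) * P t + Q' t + (real DIM('a) - 2) * cot t * Q t = 0)"
    (is "?L \<longleftrightarrow> (\<forall>t. _ \<longrightarrow> ?E t = 0)")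
proof
  let ?H = "{x. 0 < x \<bullet> e}"
  let ?D = "?H - axis_line e"
  have opD: "open ?D" using open_inner_half_space closed_axis_line by (rule open_Diff)
  assume L: ?L
  define h where "h x = norm x powr (a - 1) * ?E (angle_to e x)" for x
  have cont: "continuous_on ?D h"
  proof -
    have ang: "continuous_on ?D (angle_to e)"
      by (rule continuous_on_subset[OF continuous_on_angle_to[OF e]]) auto
    have im: "angle_to e ` ?D \<subseteq> {0<..<pi/2}"
      using angle_to_bounds[OF e] angle_to_pos[OF e] by auto
    have cP: "continuous_on {0<..<pi/2} P" "continuous_on {0<..<pi/2} Q"
      by (rule continuous_on_subset[OF contP] continuous_on_subset[OF contQ], force)+
    have "continuous_on {0<..<pi/2} ?E"
      unfolding cot_def using sin_gt_zero
      by (intro continuous_intros cP contQ') fastforce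
    then have "continuous_on ?D (\<lambda>x. ?E (angle_to e x))"
      by (rule continuous_on_compose2[OF _ ang im])
    moreover have "continuous_on ?D (\<lambda>x. norm x powr (a - 1))"
      by (intro continuous_intros) auto
    ultimately show ?thesis unfolding h_def by (rule continuous_on_mult[rotated])
  qed
  have "AE x in lebesgue. x \<in> ?D \<longrightarrow> h x = 0"
  proof (rule fundamental_lemma_calculus_of_variations[OF opD])
    show "integrable (lebesgue_on K) h" if "compact K" "K \<subseteq> ?D" for K
      using that continuous_on_subset[OF cont] by (intro integrable_lebesgue_on_compact) auto
    fix \<phi> assume \<phi>: "\<phi> \<in> test_fun ?D"
    then have \<phi>': "\<phi> \<in> test_fun ?H" by (auto simp: test_fun_def)
    obtain K where K: "K \<subseteq> ?D" "\<And>x. x \<notin> K \<Longrightarrow> \<phi> x = 0" using test_funD[OF \<phi>] by metis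
    have eq: "\<phi> x * h x = \<phi> x * field_div a x" for x
      using K field_div_eq[of x a] by (cases "x \<in> K") (auto simp: h_def)
    have z: "x \<notin> ?D \<Longrightarrow> \<phi> x * field_div a x = 0" for x using K by (metis mult_zero_left subsetD)
    have "(LINT x|lebesgue_on ?D. \<phi> x * h x) = (LINT x|lebesgue_on ?H. \<phi> x * field_div a x)"
      unfolding eq using integral_lebesgue_on_eq(1)[OF opD z] integral_lebesgue_on_eq(1)[OF open_inner_half_space[of e], of "\<lambda>x. \<phi> x * field_div a x"] z
      by simp
    then show "(LINT x|lebesgue_on ?D. \<phi> x * h x) = 0"
      using L \<phi>' divergence_theorem_test_fun[OF \<phi>', of a] by simp
  qed
  then have "AE x in lebesgue. x \<notin> {x \<in> ?D. h x \<noteq> 0}" by (auto elim: eventually_mono)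
  moreover have op: "open {x \<in> ?D. h x \<noteq> 0}"
  proof -
    have "open (?D \<inter> h -` (- {0}))" by (rule continuous_open_preimage[OF cont opD]) auto
    moreover have "?D \<inter> h -` (- {0}) = {x \<in> ?D. h x \<noteq> 0}" by auto
    ultimately show ?thesis by simp
  qed
  ultimately have "{x \<in> ?D. h x \<noteq> 0} \<in> null_sets lebesgue"
    by (subst AE_iff_null_sets) auto
  \<comment> \<open>An open null set is empty; this passes from almost everywhere to
    everywhere.\<close>
  then have "{x \<in> ?D. h x \<noteq> 0} = {}"
    using op open_not_negligible negligible_iff_null_sets by blast
  then have z: "h x = 0" if "x \<in> ?D" for x using that by blast
  show "\<forall>t. 0 < t \<and> t < pi/2 \<longrightarrow> ?E t = 0"
  proof (intro allI impI)
    fix t assume "0 < t \<and> t < pi/2"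
    then obtain x where x: "0 < x \<bullet> e" "x \<notin> axis_line e" "angle_to e x = t"
      using exists_point_at_angle by blast
    then have "norm x > 0" by auto
    then show "?E t = 0" using z[of x] x by (simp add: h_def)
  qed
next
  let ?H = "{x. 0 < x \<bullet> e}"
  assume E: "\<forall>t. 0 < t \<and> t < pi/2 \<longrightarrow> ?E t = 0"
  show ?L
  proof
    fix \<phi> assume \<phi>: "\<phi> \<in> test_fun ?H"
    have d0: "field_div a x = 0" if "x \<in> ?H" "x \<notin> axis_line e" for x
      using that field_div_eq[of x a] E angle_to_bounds[OF e, of x] angle_to_pos[OF e, of x] by simp
    have "AE x in lebesgue. x \<notin> axis_line e"
      using negligible_axis_line[OF e dim] AE_not_in negligible_iff_null_sets by blast
    then have "AE x in lebesgue_on ?H. \<phi> x * field_div a x = 0"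
      using d0 open_inner_half_space[of e] by (subst AE_restrict_space_iff) (auto elim!: eventually_mono)
    then show "(LINT x|lebesgue_on ?H. polar_field e a P Q x \<bullet> grad \<phi> x) = 0"
      using divergence_theorem_test_fun[OF \<phi>, of a] by (simp add: integral_eq_zero_AE)
  qed
qed

end

subsection \<open>The ordinary differential equation of the angular factor\<close>

text \<open>The divergence of the flux with the positive factor \<open>W / V\<close> removed: what
  remains is polynomial, and homogeneous of degree three, in y, y', y''. The coefficient k(p-1) + N
  - p is a + N - 1 for the degree a = (k-1)(p-1) of the flux.\<close>

definition angular_ode :: "real \<Rightarrow> real \<Rightarrow> real \<Rightarrow> real \<Rightarrow> real \<Rightarrow> real \<Rightarrow> real \<Rightarrow> real" where
  "angular_ode p N k t y y' y'' =
     ((p - 1) * y'\<^sup>2 + k\<^sup>2 * y\<^sup>2) * y'' + (p - 2) * k\<^sup>2 * y * y'\<^sup>2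
     + (N - 2) * cot t * y' * (k\<^sup>2 * y\<^sup>2 + y'\<^sup>2) + (k * (p - 1) + N - p) * k * y * (k\<^sup>2 * y\<^sup>2 + y'\<^sup>2)"

text \<open>\<open>pos\<close> and \<open>f'1\<close> together keep the gradient from vanishing on
  the closed interval, so powers of \<open>V\<close> are differentiable for every exponent.\<close>

locale angular_profile =
  fixes e :: "'a::euclidean_space" and p k :: real and f f' f'' :: "real \<Rightarrow> real"
  assumes e: "e \<in> Basis" and dim: "2 \<le> DIM('a)" and p: "1 < p" and k: "k < 0"
    and f: "\<And>t. t \<in> {0..pi/2} \<Longrightarrow> (f has_real_derivative f' t) (at t within {0..pi/2})"
    and f': "\<And>t. t \<in> {0..pi/2} \<Longrightarrow> (f' has_real_derivative f'' t) (at t within {0..pi/2})"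
    and f'': "continuous_on {0..pi/2} f''"
    and pos: "\<And>t. 0 \<le> t \<Longrightarrow> t < pi/2 \<Longrightarrow> 0 < f t"
    and f'0: "f' 0 = 0" and f'1: "f' (pi/2) \<noteq> 0"
begin

definition V :: "real \<Rightarrow> real" where "V t = k\<^sup>2 * (f t)\<^sup>2 + (f' t)\<^sup>2"

text \<open>The angular factor of |grad u|^(p-2).\<close>

definition W :: "real \<Rightarrow> real" where "W t = V t powr ((p - 2) / 2)"

definition W' :: "real \<Rightarrow> real" where
  "W' t = (p - 2) * W t / V t * (k\<^sup>2 * f t * f' t + f' t * f'' t)"

lemma cont_f: "continuous_on {0..pi/2} f" "continuous_on {0..pi/2} f'"
  by (rule DERIV_continuous_on[OF f] DERIV_continuous_on[OF f'], assumption)+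

lemma V_pos: "t \<in> {0..pi/2} \<Longrightarrow> 0 < V t"
proof (cases "t = pi/2")
  case True
  have "0 < (f' t)\<^sup>2" unfolding True using f'1 by simp
  then show ?thesis by (simp add: V_def add_nonneg_pos)
next
  case False
  moreover assume "t \<in> {0..pi/2}"
  ultimately have "0 < f t" using pos[of t] by auto
  then show ?thesis using k by (simp add: V_def add_pos_nonneg)
qed

lemma W_pos: "t \<in> {0..pi/2} \<Longrightarrow> 0 < W t"
  unfolding W_def using V_pos[of t] by simp

lemma cont_V: "continuous_on {0..pi/2} V"
  unfolding V_def[abs_def] by (intro continuous_intros cont_f)

lemma cont_W: "continuous_on {0..pi/2} W"
  unfolding W_def[abs_def] using V_pos by (intro continuous_intros cont_V) fastforce

lemma cont_W': "continuous_on {0..pi/2} W'"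
  unfolding W'_def[abs_def] using V_pos
  by (intro continuous_intros cont_V cont_W cont_f f'') fastforce

lemma interior_derivs:
  assumes "0 < t" "t < pi/2"
  shows "(f has_real_derivative f' t) (at t)" "(f' has_real_derivative f'' t) (at t)"
  using f[of t] f'[of t] assms at_within_Icc_at[of 0 t "pi/2"] by auto

lemma W_deriv:
  assumes t: "0 < t" "t < pi/2"
  shows "(W has_real_derivative W' t) (at t)"
proof -
  have V: "0 < V t" using V_pos t by auto
  have dV: "(V has_real_derivative 2 * (k\<^sup>2 * f t * f' t + f' t * f'' t)) (at t)"
    unfolding V_def[abs_def]
    by (rule DERIV_cong, (rule derivative_eq_intros interior_derivs[OF t] refl)+) (simp add: algebra_simps)
  have "((\<lambda>y. y powr ((p - 2) / 2)) has_real_derivative (p - 2) / 2 * V t powr ((p - 2) / 2 - 1)) (at (V t))"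
    using V by (rule has_real_derivative_powr)
  note d = DERIV_chain2[OF this dV]
  have pw: "V t powr ((p - 2) / 2 - 1) = V t powr ((p - 2) / 2) / V t"
    using V by (simp add: powr_diff)
  have alg: "(p - 2) / 2 * (w / v) * (2 * c) = (p - 2) * w / v * c" for w v c :: real
    by simp
  from d show ?thesis
    unfolding W_def[abs_def] W'_def
    by (rule DERIV_cong) (simp only: pw alg)
qed

definition P :: "real \<Rightarrow> real" where "P t = W t * (k * f t)"
definition Q :: "real \<Rightarrow> real" where "Q t = W t * f' t"
definition P' :: "real \<Rightarrow> real" where "P' t = W' t * (k * f t) + W t * (k * f' t)"
definition Q' :: "real \<Rightarrow> real" where "Q' t = W' t * f' t + W t * f'' t"

lemma PQ_derivs:
  assumes t: "0 < t" "t < pi/2"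
  shows "(P has_real_derivative P' t) (at t)" "(Q has_real_derivative Q' t) (at t)"
  unfolding P_def[abs_def] Q_def[abs_def] P'_def Q'_def
  by (rule DERIV_cong, (rule derivative_eq_intros W_deriv[OF t] interior_derivs[OF t] refl)+, simp)+

lemma cont_PQ: "continuous_on {0..pi/2} P" "continuous_on {0..pi/2} P'"
    "continuous_on {0..pi/2} Q" "continuous_on {0..pi/2} Q'"
  unfolding P_def[abs_def] Q_def[abs_def] P'_def[abs_def] Q'_def[abs_def]
  by (intro continuous_intros cont_W cont_W' cont_f f'')+

text \<open>The mean value theorem gives M t, and t \<le> 4 sin t: up to pi/3 because sin t \<ge>
  t/2, beyond it because sin t \<ge> 1/2 and t < 2.\<close>

lemma bounded_by_sin:
  fixes g g' :: "real \<Rightarrow> real"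
  assumes "continuous_on {0..<pi/2} g" "g 0 = 0" "0 \<le> M"
    and "\<And>t. 0 < t \<Longrightarrow> t < pi/2 \<Longrightarrow> (g has_real_derivative g' t) (at t)"
    and "\<And>t. 0 < t \<Longrightarrow> t < pi/2 \<Longrightarrow> \<bar>g' t\<bar> \<le> M"
    and t: "0 \<le> t" "t < pi/2"
  shows "\<bar>g t\<bar> \<le> 4 * M * sin t"
proof (cases "t = 0")
  case False
  with t have t0: "0 < t" by simp
  have "continuous_on {0..t} g" by (rule continuous_on_subset[OF assms(1)]) (use t in auto)
  moreover have "(g has_derivative (\<lambda>h. g' s * h)) (at s)" if "0 < s" "s < t" for s
    using assms(4)[of s] that t by (auto simp: has_field_derivative_def)
  ultimately obtain s where s: "0 < s" "s < t" "g t - g 0 = g' s * (t - 0)"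
    using mvt[OF t0, of g "\<lambda>s h. g' s * h"] by metis
  have "\<bar>g t\<bar> = \<bar>g' s\<bar> * t" using s assms(2) t0 by (simp add: abs_mult)
  also have "\<dots> \<le> M * t" using assms(5)[of s] s t by (intro mult_right_mono) auto
  also have "\<dots> \<le> M * (4 * sin t)"
  proof (intro mult_left_mono)
    show "t \<le> 4 * sin t"
    proof (cases "t \<le> pi/3")
      case True
      have "\<exists>z. 0 < z \<and> z < t \<and> sin t - sin 0 = (t - 0) * cos z"
        using t0 by (intro MVT2) (auto simp: DERIV_sin)
      then obtain z where z: "0 < z" "z < t" "sin t = t * cos z" by auto
      have "cos (pi/3) \<le> cos z" using z True by (intro cos_monotone_0_pi_le) auto
      then have "1/2 \<le> cos z" by (simp add: cos_60)
      then have "t * (1/2) \<le> sin t" unfolding z(3) using t0 by (intro mult_left_mono) auto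
      then show ?thesis using t0 by linarith
    next
      case False
      have "sin (pi/6) \<le> sin t" using False t by (intro sin_monotone_2pi_le) auto
      then have "1/2 \<le> sin t" by (simp add: sin_30)
      then show ?thesis using t pi_less_4 by linarith
    qed
  qed (use assms in auto)
  finally show ?thesis by (simp add: algebra_simps)
qed (use assms in simp)

lemma exists_common_bound:
  fixes gs :: "(real \<Rightarrow> real) set"
  assumes "finite gs" "\<And>g. g \<in> gs \<Longrightarrow> continuous_on {0..pi/2} g"
  shows "\<exists>M\<ge>0. \<forall>g\<in>gs. \<forall>t\<in>{0..pi/2}. \<bar>g t\<bar> \<le> M"
  using assms
proof (induction gs)
  case empty
  then show ?case by auto
next
  case (insert g gs)
  obtain M where M: "M \<ge> 0" "\<forall>g\<in>gs. \<forall>t\<in>{0..pi/2}. \<bar>g t\<bar> \<le> M"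
    using insert.IH insert.prems by auto
  obtain M' where M': "\<forall>t\<in>{0..pi/2}. norm (g t) \<le> M'"
    using compact_bounded_continuous[of "{0..pi/2}" g] insert.prems by auto
  show ?case
    using M M' by (intro exI[of _ "max M M'"]) (auto simp: le_max_iff_disj)
qed

lemma exists_polar_pair: "\<exists>C. polar_pair e P Q P' Q' C \<and> polar_pair e (\<lambda>t. k * f t) f' (\<lambda>t. k * f' t) f'' C"
proof -
  have "\<exists>M\<ge>0. \<forall>g\<in>{P, P', Q', (\<lambda>t. k * f t), (\<lambda>t. k * f' t), f''}. \<forall>t\<in>{0..pi/2}. \<bar>g t\<bar> \<le> M"
    by (rule exists_common_bound) (auto intro!: cont_PQ cont_f f'' continuous_intros)
  then obtain M where M0: "0 \<le> M" and M: "\<And>t. t \<in> {0..pi/2} \<Longrightarrow> \<bar>P t\<bar> \<le> M \<and> \<bar>P' t\<bar> \<le> M \<and> \<bar>Q' t\<bar> \<le> M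
      \<and> \<bar>k * f t\<bar> \<le> M \<and> \<bar>k * f' t\<bar> \<le> M \<and> \<bar>f'' t\<bar> \<le> M"
    by auto
  have sub: "{0..<pi/2} \<subseteq> {0..pi/2}" by auto
  have Q0: "Q 0 = 0" using f'0 by (simp add: Q_def)
  have M4: "M \<le> 4 * M" using M0 by simp
  have "polar_pair e P Q P' Q' (4 * M)"
  proof
    show "continuous_on {0..<pi/2} P" "continuous_on {0..<pi/2} Q"
      using cont_PQ continuous_on_subset sub by blast+
    show "\<bar>Q t\<bar> \<le> 4 * M * sin t" if "0 \<le> t" "t < pi/2" for t
      by (rule bounded_by_sin[where g' = Q'])
        (use M0 M Q0 that continuous_on_subset[OF cont_PQ(3) sub] PQ_derivs in auto)
  qed (use e dim M PQ_derivs M4 in \<open>auto intro: order_trans[OF _ M4]\<close>)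
  moreover have "polar_pair e (\<lambda>t. k * f t) f' (\<lambda>t. k * f' t) f'' (4 * M)"
  proof
    show "continuous_on {0..<pi/2} (\<lambda>t. k * f t)" "continuous_on {0..<pi/2} f'"
      using cont_f continuous_on_subset[OF _ sub] by (auto intro!: continuous_intros)
    show "\<bar>f' t\<bar> \<le> 4 * M * sin t" if "0 \<le> t" "t < pi/2" for t
      by (rule bounded_by_sin[where g' = f''])
        (use M0 M f'0 that continuous_on_subset[OF cont_f(2) sub] interior_derivs in auto)
    show "((\<lambda>t. k * f t) has_real_derivative k * f' t) (at t)" if "0 < t" "t < pi/2" for t
      using DERIV_cmult[OF interior_derivs(1)[OF that]] .
  qed (use e dim M interior_derivs M4 in \<open>auto intro: order_trans[OF _ M4]\<close>)
  ultimately show ?thesis by blast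
qed

section \<open>The quasiradial function, its weak gradient and its flux\<close>

abbreviation H :: "'a set" where "H \<equiv> {x. 0 < x \<bullet> e}"

abbreviation u :: "'a \<Rightarrow> real" where "u x \<equiv> norm x powr k * f (angle_to e x)"

abbreviation G :: "'a \<Rightarrow> 'a" where "G \<equiv> polar_field e (k - 1) (\<lambda>t. k * f t) f'"

lemma continuous_u: "continuous_on H u"
proof -
  have "angle_to e ` H \<subseteq> {0..pi/2}" using angle_to_bounds[OF e] by fastforce
  then have "continuous_on H (\<lambda>x. f (angle_to e x))"
    using continuous_on_compose2[OF cont_f(1) continuous_on_angle_to[OF e]] by blast
  moreover have "continuous_on H (\<lambda>x. norm x powr k)" by (intro continuous_intros) auto
  ultimately show ?thesis by (intro continuous_on_mult)
qed

lemma continuous_G: "continuous_on H G"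
  using exists_polar_pair polar_pair.continuous_field by blast

text \<open>|G| is r^(k-1) times the square root of \<open>V\<close>, so the radial exponents
  (k-1)(p-2) and k-1 add up to (k-1)(p-1), and the angular factor is \<open>W\<close>.\<close>

lemma flux_eq:
  assumes "x \<in> H"
  shows "norm (G x) powr (p - 2) *\<^sub>R G x = polar_field e ((k - 1) * (p - 1)) P Q x"
proof -
  let ?t = "angle_to e x"
  have x: "0 < x \<bullet> e" using assms by simp
  have r: "0 < norm x" using x by auto
  have V: "0 < V ?t" using V_pos[of ?t] angle_to_bounds[OF e x] by auto
  have "norm (G x) = norm x powr (k - 1) * sqrt (V ?t)"
    using norm_polar_field[where Q = f', OF e x f'0] by (simp add: V_def power_mult_distrib)
  then have "norm (G x) powr (p - 2) = norm x powr ((k - 1) * (p - 2)) * sqrt (V ?t) powr (p - 2)"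
    using V by (simp add: powr_mult powr_powr)
  also have "sqrt (V ?t) powr (p - 2) = W ?t"
    using V by (simp add: W_def powr_half_sqrt[symmetric] powr_powr)
  finally have "norm (G x) powr (p - 2) *\<^sub>R G x =
      (norm x powr ((k - 1) * (p - 2)) * norm x powr (k - 1) * W ?t) *\<^sub>R ((k * f ?t / norm x) *\<^sub>R x - (f' ?t / sin ?t) *\<^sub>R perp_part e x)"
    by (simp add: polar_field_def mult_ac)
  also have "norm x powr ((k - 1) * (p - 2)) * norm x powr (k - 1) = norm x powr ((k - 1) * (p - 1))"
    by (simp add: powr_add[symmetric] algebra_simps)
  finally show ?thesis
    by (simp add: polar_field_def P_def Q_def scaleR_diff_right mult_ac)
qed

lemma Lp_loc_u: "0 < q \<Longrightarrow> Lp_loc q H u"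
  using continuous_u by (rule Lp_loc_continuous[OF open_inner_half_space])

lemma Lp_loc_G: "0 < q \<Longrightarrow> Lp_loc q H G"
  using continuous_G by (rule Lp_loc_continuous[OF open_inner_half_space])

text \<open>\<open>G\<close> is the classical gradient off the axis and, being continuous on
  \<open>H\<close>, bounded on compact subsets, so integration by parts applies in each coordinate.
  Both vector integrals are shown to exist before inner products with basis vectors are moved
  inside.\<close>

lemma weak_gradient_u: "weak_gradient H u G"
  unfolding weak_gradient_def
proof (intro conjI ballI)
  show "Lp_loc 1 H u" "Lp_loc 1 H G" using Lp_loc_u Lp_loc_G by auto
  fix \<phi> assume \<phi>: "\<phi> \<in> test_fun H"
  note op = open_inner_half_space[of e]
  have der: "((\<lambda>t. u (x + t *\<^sub>R b)) has_real_derivative G x \<bullet> b) (at 0)" if "x \<in> H - axis_line e" for x b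
  proof -
    have x: "0 < x \<bullet> e" "x \<notin> axis_line e" using that by auto
    have "(u has_derivative (\<lambda>v. G x \<bullet> v)) (at x)"
      using angle_to_pos[OF e x] angle_to_bounds[OF e x(1)]
      by (intro has_derivative_radial_times_angular[OF e x] interior_derivs) auto
    then show ?thesis by (rule has_derivative_along[OF e x])
  qed
  have bd: "\<exists>M. \<forall>x\<in>K - axis_line e. \<bar>G x \<bullet> b\<bar> \<le> M" if K: "compact K" "K \<subseteq> H" and b: "b \<in> Basis" for K b
  proof -
    obtain M where "\<forall>x\<in>K. norm (G x) \<le> M"
      using compact_bounded_continuous[OF K(1) continuous_on_subset[OF continuous_G K(2)]] by blast
    then show ?thesis using Basis_le_norm[OF b] order_trans by (intro exI[of _ M]) blast
  qed
  have I: "(LINT x|lebesgue_on H. u x * (grad \<phi> x \<bullet> b)) = - (LINT x|lebesgue_on H. \<phi> x * (G x \<bullet> b))"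
    if b: "b \<in> Basis" for b
    by (rule integration_by_parts_test_fun(3)[OF op \<phi> b continuous_u negligible_axis_line[OF e dim]])
      (use axis_line_meets_parallel_once[OF e b] der bd b in auto)
  obtain K where K: "compact K" "K \<subseteq> H" "\<And>x. x \<notin> K \<Longrightarrow> \<phi> x = 0" "\<And>x. x \<notin> K \<Longrightarrow> grad \<phi> x = 0"
     "continuous_on UNIV (grad \<phi>)"
    using test_funD[OF \<phi>] by metis
  have c1: "continuous_on UNIV (\<lambda>x. u x *\<^sub>R grad \<phi> x)"
    using K(3,4) by (intro continuous_on_UNIV_extend_by_0[OF op K(1,2)] continuous_on_scaleR continuous_u
          continuous_on_subset[OF K(5)]) auto
  have "integrable lebesgue (\<lambda>x. if x \<in> K then u x *\<^sub>R grad \<phi> x else 0)"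
    using integrable_lebesgue_on_compact[OF K(1) continuous_on_subset[OF c1]] K(1)
      Lebesgue_Measure.integrable_restrict_UNIV[of K "\<lambda>x. u x *\<^sub>R grad \<phi> x"] lmeasurable_compact by blast
  moreover have "(\<lambda>x. if x \<in> K then u x *\<^sub>R grad \<phi> x else 0) = (\<lambda>x. u x *\<^sub>R grad \<phi> x)"
    using K(4) by (auto simp: fun_eq_iff)
  moreover have "u x *\<^sub>R grad \<phi> x = 0" if "x \<notin> H" for x using K(2,4) that by (metis scaleR_zero_right subsetD)
  ultimately have i1: "integrable (lebesgue_on H) (\<lambda>x. u x *\<^sub>R grad \<phi> x)"
    using integral_lebesgue_on_eq(2)[OF op, of "\<lambda>x. u x *\<^sub>R grad \<phi> x"] by simp
  have i2: "integrable (lebesgue_on H) (\<lambda>x. \<phi> x *\<^sub>R G x)"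
    by (rule integrable_test_fun_scaleR[OF op \<phi> Lp_loc_G[OF zero_less_one]])
  show "(LINT x|lebesgue_on H. u x *\<^sub>R grad \<phi> x) = - (LINT x|lebesgue_on H. \<phi> x *\<^sub>R G x)"
  proof (rule euclidean_eqI)
    fix b :: 'a assume b: "b \<in> Basis"
    show "(LINT x|lebesgue_on H. u x *\<^sub>R grad \<phi> x) \<bullet> b = - (LINT x|lebesgue_on H. \<phi> x *\<^sub>R G x) \<bullet> b"
      using I[OF b] i1 i2 by (simp flip: integral_inner_left)
  qed
qed

text \<open>\<open>p_harmonic\<close> only asserts the existence of some weak gradient; this
  identifies it with \<open>G\<close>, to which the explicit flux formula applies.\<close>

lemma weak_gradient_unique:
  assumes D: "weak_gradient H u D"
  shows "AE x in lebesgue_on H. D x = G x"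
proof -
  note op = open_inner_half_space[of e]
  have L: "Lp_loc 1 H D" "Lp_loc 1 H G" using D Lp_loc_G by (auto simp: weak_gradient_def)
  have "AE x in lebesgue. x \<in> H \<longrightarrow> (D x - G x) \<bullet> b = 0" for b
  proof (rule fundamental_lemma_calculus_of_variations[OF op])
    show "integrable (lebesgue_on K) (\<lambda>x. (D x - G x) \<bullet> b)" if "compact K" "K \<subseteq> H" for K
      using Lp_loc_1_integrable[OF L(1) that] Lp_loc_1_integrable[OF L(2) that] by simp
    fix \<phi> assume \<phi>: "\<phi> \<in> test_fun H"
    have i: "integrable (lebesgue_on H) (\<lambda>x. \<phi> x *\<^sub>R D x)" "integrable (lebesgue_on H) (\<lambda>x. \<phi> x *\<^sub>R G x)"
      using integrable_test_fun_scaleR[OF op \<phi>] L by auto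
    have "(LINT x|lebesgue_on H. \<phi> x * ((D x - G x) \<bullet> b)) = (LINT x|lebesgue_on H. (\<phi> x *\<^sub>R D x - \<phi> x *\<^sub>R G x) \<bullet> b)"
      by (simp add: inner_diff_left right_diff_distrib)
    also have "\<dots> = (LINT x|lebesgue_on H. \<phi> x *\<^sub>R D x - \<phi> x *\<^sub>R G x) \<bullet> b"
      using i by (intro integral_inner_left) auto
    also have "(LINT x|lebesgue_on H. \<phi> x *\<^sub>R D x - \<phi> x *\<^sub>R G x) = 0"
      using i D weak_gradient_u \<phi> by (simp add: weak_gradient_def)
    finally show "(LINT x|lebesgue_on H. \<phi> x * ((D x - G x) \<bullet> b)) = 0" by simp
  qed
  then have "AE x in lebesgue. \<forall>b\<in>Basis. x \<in> H \<longrightarrow> (D x - G x) \<bullet> b = 0"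
    by (intro AE_finite_allI) auto
  then have "AE x in lebesgue. x \<in> H \<longrightarrow> D x = G x"
  proof eventually_elim
    case (elim x)
    then show ?case by (auto simp: inner_diff_left intro: euclidean_eqI)
  qed
  then show ?thesis
    using op by (subst AE_restrict_space_iff) auto
qed

lemma angular_ode_eq:
  assumes t: "0 < t" "t < pi/2"
  shows "((k - 1) * (p - 1) + N - 1) * P t + Q' t + (N - 2) * cot t * Q t
     = W t / V t * angular_ode p N k t (f t) (f' t) (f'' t)"
proof -
  have V: "0 < V t" using V_pos t by auto
  have "((k - 1) * (p - 1) + N - 1) * P t + Q' t + (N - 2) * cot t * Q t =
    W t / V t * ((k * (p - 1) + N - p) * k * f t * V t + (p - 2) * (k\<^sup>2 * f t * f' t + f' t * f'' t) * f' t + f'' t * V t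
      + (N - 2) * cot t * f' t * V t)"
    using V by (simp add: P_def Q_def Q'_def W'_def field_simps)
  also have "(k * (p - 1) + N - p) * k * f t * V t + (p - 2) * (k\<^sup>2 * f t * f' t + f' t * f'' t) * f' t + f'' t * V t
      + (N - 2) * cot t * f' t * V t = angular_ode p N k t (f t) (f' t) (f'' t)"
    unfolding angular_ode_def V_def by (simp add: algebra_simps power2_eq_square)
  finally show ?thesis .
qed

theorem p_harmonic_iff_angular_ode:
  "p_harmonic p H u \<longleftrightarrow> (\<forall>t. 0 < t \<and> t < pi/2 \<longrightarrow> angular_ode p (real DIM('a)) k t (f t) (f' t) (f'' t) = 0)"
proof -
  note op = open_inner_half_space[of e]
  let ?F = "polar_field e ((k - 1) * (p - 1)) P Q"
  obtain C where "polar_pair e P Q P' Q' C" using exists_polar_pair by blast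
  then interpret pp: polar_pair e P Q P' Q' C .
  have "(\<forall>\<phi>\<in>test_fun H. (LINT x|lebesgue_on H. ?F x \<bullet> grad \<phi> x) = 0) \<longleftrightarrow>
    (\<forall>t. 0 < t \<and> t < pi/2 \<longrightarrow> ((k - 1) * (p - 1) + real DIM('a) - 1) * P t + Q' t + (real DIM('a) - 2) * cot t * Q t = 0)"
    by (rule pp.weakly_div_free_iff) (rule continuous_on_subset[OF cont_PQ(4)], auto)
  also have "\<dots> \<longleftrightarrow> (\<forall>t. 0 < t \<and> t < pi/2 \<longrightarrow> angular_ode p (real DIM('a)) k t (f t) (f' t) (f'' t) = 0)"
    using V_pos W_pos by (auto simp: angular_ode_eq) (metis atLeastAtMost_iff less_eq_real_def less_irrefl)+
  finally have iff: "(\<forall>\<phi>\<in>test_fun H. (LINT x|lebesgue_on H. ?F x \<bullet> grad \<phi> x) = 0) \<longleftrightarrow>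
    (\<forall>t. 0 < t \<and> t < pi/2 \<longrightarrow> angular_ode p (real DIM('a)) k t (f t) (f' t) (f'' t) = 0)" .
  have flux: "(LINT x|lebesgue_on H. (norm (D x) powr (p - 2) *\<^sub>R D x) \<bullet> grad \<phi> x) = (LINT x|lebesgue_on H. ?F x \<bullet> grad \<phi> x)"
    if D: "weak_gradient H u D" and \<phi>: "\<phi> \<in> test_fun H" for D \<phi>
  proof (rule integral_cong_AE)
    have [measurable]: "D \<in> borel_measurable (lebesgue_on H)"
      using D by (simp add: weak_gradient_def Lp_loc_def)
    have "continuous_on UNIV (grad \<phi>)" using test_funD[OF \<phi>] by metis
    then have "continuous_on H (grad \<phi>)" by (rule continuous_on_subset) simp
    then have [measurable]: "grad \<phi> \<in> borel_measurable (lebesgue_on H)"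
      using op by (intro continuous_imp_measurable_on_sets_lebesgue) auto
    show "(\<lambda>x. (norm (D x) powr (p - 2) *\<^sub>R D x) \<bullet> grad \<phi> x) \<in> borel_measurable (lebesgue_on H)"
      by measurable
    have [measurable]: "?F \<in> borel_measurable (lebesgue_on H)"
      using op pp.continuous_field by (intro continuous_imp_measurable_on_sets_lebesgue) auto
    show "(\<lambda>x. ?F x \<bullet> grad \<phi> x) \<in> borel_measurable (lebesgue_on H)"
      by measurable
    have "AE x in lebesgue_on H. x \<in> H" by (rule AE_I2) simp
    with weak_gradient_unique[OF D]
    show "AE x in lebesgue_on H. (norm (D x) powr (p - 2) *\<^sub>R D x) \<bullet> grad \<phi> x = ?F x \<bullet> grad \<phi> x"
      by eventually_elim (simp only: flux_eq)
  qed
  have "p_harmonic p H u \<longleftrightarrow> (\<forall>\<phi>\<in>test_fun H. (LINT x|lebesgue_on H. ?F x \<bullet> grad \<phi> x) = 0)"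
  proof
    assume "p_harmonic p H u"
    then show "\<forall>\<phi>\<in>test_fun H. (LINT x|lebesgue_on H. ?F x \<bullet> grad \<phi> x) = 0"
      unfolding p_harmonic_def using flux by fastforce
  next
    assume "\<forall>\<phi>\<in>test_fun H. (LINT x|lebesgue_on H. ?F x \<bullet> grad \<phi> x) = 0"
    then have "\<forall>\<phi>\<in>test_fun H. (LINT x|lebesgue_on H. (norm (G x) powr (p - 2) *\<^sub>R G x) \<bullet> grad \<phi> x) = 0"
      using flux[OF weak_gradient_u] by simp
    then show "p_harmonic p H u"
      unfolding p_harmonic_def
      using continuous_u Lp_loc_u[of p] Lp_loc_G[of p] weak_gradient_u p by auto
  qed
  then show ?thesis using iff by simp
qed

end

subsection \<open>Uniqueness of the exponent\<close>

text \<open>At the first point \<open>c\<close> where \<open>g\<close> fails to be positive it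
  vanishes; a positive derivative there would make \<open>g\<close> negative just before
  \<open>c\<close>, contrary to the choice of \<open>c\<close>.\<close>

lemma pos_preserved_if_zeros_increasing:
  fixes g g' :: "real \<Rightarrow> real"
  assumes cont: "continuous_on {a..b} g" and "a \<le> b" and a: "0 < g a"
    and der: "\<And>x. a < x \<Longrightarrow> x \<le> b \<Longrightarrow> g x = 0 \<Longrightarrow> (g has_real_derivative g' x) (at x within {a..b})"
    and pos: "\<And>x. a < x \<Longrightarrow> x \<le> b \<Longrightarrow> g x = 0 \<Longrightarrow> 0 < g' x"
  shows "0 < g b"
proof (rule ccontr)
  assume "\<not> 0 < g b"
  define A where "A = {a..b} \<inter> g -` {..0}"
  have A: "closed A" "b \<in> A" "A \<subseteq> {a..b}"
    using continuous_closed_preimage[OF cont, of "{..0}"] \<open>\<not> 0 < g b\<close> \<open>a \<le> b\<close> by (auto simp: A_def)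
  define c where "c = Inf A"
  have bdd: "bdd_below A" using A(3) by (meson bdd_below_Icc bdd_below_mono)
  have cA: "c \<in> A" unfolding c_def using A bdd by (intro closed_contains_Inf) auto
  have less: "0 < g x" if "a \<le> x" "x < c" for x
  proof (rule ccontr)
    assume "\<not> 0 < g x"
    moreover have "c \<le> b" using cA by (auto simp: A_def)
    ultimately have "x \<in> A" using that by (auto simp: A_def)
    then show False using cInf_lower[OF _ bdd, of x] that by (simp add: c_def)
  qed
  have c: "a < c" "c \<le> b" "g c \<le> 0" using cA a by (auto simp: A_def less_le)
  have "g c = 0"
  proof (rule ccontr)
    assume "g c \<noteq> 0"
    then have "g c < 0" using c by simp
    moreover have "continuous_on {a..c} g" using cont c by (auto intro: continuous_on_subset)
    ultimately obtain x where "a \<le> x" "x \<le> c" "g x = 0"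
      using IVT2'[of g c 0 a] a c by auto
    then show False using less[of x] \<open>g c < 0\<close> by (cases "x = c") auto
  qed
  then obtain d where d: "0 < d" "\<And>h. 0 < h \<Longrightarrow> c - h \<in> {a..b} \<Longrightarrow> h < d \<Longrightarrow> g (c - h) < g c"
    using has_real_derivative_pos_inc_left[OF der pos] c by blast
  define h where "h = min (d / 2) (c - a)"
  have "g (c - h) < g c" using d c by (intro d(2)) (auto simp: h_def)
  moreover have "0 < g (c - h)" using d(1) c by (intro less) (auto simp: h_def)
  ultimately show False using \<open>g c = 0\<close> by simp
qed

locale angular_solution = angular_profile +
  assumes f0: "f 0 = 1" and f1: "f (pi/2) = 0" and f'1_neg: "f' (pi/2) < 0"
    and ode: "\<And>t. 0 < t \<Longrightarrow> t < pi/2 \<Longrightarrow> angular_ode p (real DIM('a)) k t (f t) (f' t) (f'' t) = 0"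
begin

text \<open>As t tends to 0, cot t f'(t) tends to f''(0) since f'(0) = 0. In the limit of the
  equation, divided by k^2, f'' therefore occurs 1 + (N - 2) times.\<close>

lemma second_derivative_at_0:
  "(real DIM('a) - 1) * f'' 0 + (k * (p - 1) + real DIM('a) - p) * k = 0"
proof -
  have w: "at 0 within {0..pi/2} = at_right (0::real)" by (intro at_within_Icc_at_right) simp
  have lf: "(f \<longlongrightarrow> 1) (at_right 0)" "(f' \<longlongrightarrow> 0) (at_right 0)" "(f'' \<longlongrightarrow> f'' 0) (at_right 0)"
    using cont_f f'' f0 f'0 unfolding continuous_on_def w[symmetric] by force+
  have "((\<lambda>t. (f' t - f' 0) / (t - 0)) \<longlongrightarrow> f'' 0) (at_right 0)"
    using f'[of 0] unfolding has_field_derivative_iff w by simp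
  moreover have "((\<lambda>t. (sin t - sin 0) / (t - 0)) \<longlongrightarrow> cos 0) (at_right (0::real))"
    using DERIV_sin[of "0::real"] unfolding has_field_derivative_iff by (auto intro: filterlim_mono[OF _ order_refl at_le])
  moreover have "((\<lambda>t. cos t) \<longlongrightarrow> cos 0) (at_right (0::real))" by (intro tendsto_intros)
  ultimately have "((\<lambda>t. cos t * (f' t / t) / (sin t / t)) \<longlongrightarrow> cos 0 * f'' 0 / cos 0) (at_right 0)"
    using f'0 by (intro tendsto_intros) auto
  moreover have "\<forall>\<^sub>F t in at_right 0. cos t * (f' t / t) / (sin t / t) = cot t * f' t"
    using eventually_at_right_less[of "0::real"] by eventually_elim (simp add: cot_def)
  ultimately have lc: "((\<lambda>t. cot t * f' t) \<longlongrightarrow> f'' 0) (at_right 0)"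
    by (auto intro: Lim_transform_eventually)
  have "((\<lambda>t. ((p - 1) * (f' t)\<^sup>2 + k\<^sup>2 * (f t)\<^sup>2) * f'' t + (p - 2) * k\<^sup>2 * f t * (f' t)\<^sup>2
     + (real DIM('a) - 2) * (cot t * f' t) * (k\<^sup>2 * (f t)\<^sup>2 + (f' t)\<^sup>2) + (k * (p - 1) + real DIM('a) - p) * k * f t * (k\<^sup>2 * (f t)\<^sup>2 + (f' t)\<^sup>2)) \<longlongrightarrow>
     ((p - 1) * 0\<^sup>2 + k\<^sup>2 * 1\<^sup>2) * f'' 0 + (p - 2) * k\<^sup>2 * 1 * 0\<^sup>2
     + (real DIM('a) - 2) * f'' 0 * (k\<^sup>2 * 1\<^sup>2 + 0\<^sup>2) + (k * (p - 1) + real DIM('a) - p) * k * 1 * (k\<^sup>2 * 1\<^sup>2 + 0\<^sup>2)) (at_right 0)"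
    (is "(?g \<longlongrightarrow> ?l) _")
    by (intro tendsto_intros lf lc)
  moreover have "\<forall>\<^sub>F t in at_right 0. ?g t = 0"
    using eventually_at_right_real[of 0 "pi/2", simplified]
  proof eventually_elim
    case (elim t)
    then show ?case using ode[of t] by (simp add: angular_ode_def mult.assoc)
  qed
  ultimately have "((\<lambda>t. 0) \<longlongrightarrow> ?l) (at_right (0::real))"
    by (rule Lim_transform_eventually)
  then have "?l = 0" by (simp add: tendsto_const_iff)
  then have "k\<^sup>2 * ((real DIM('a) - 1) * f'' 0 + (k * (p - 1) + real DIM('a) - p) * k) = 0"
    by (simp add: algebra_simps)
  then show ?thesis using k by simp
qed

text \<open>With f' = k f y the equation becomes divisible by k^2 f^2. Where two solutions have
  equal slope y, their second derivatives then differ only through k and the values of the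
  solutions.\<close>

lemma second_derivative_via_slope:
  assumes t: "0 < t" "t < pi/2" and y: "f' t = k * f t * y"
  shows "(1 + (p - 1) * y\<^sup>2) * f'' t = f t * ((1 + (p - 1) * y\<^sup>2) * k\<^sup>2 * y\<^sup>2
     + k * (1 + y\<^sup>2) * (p - real DIM('a) - (p - 1) * k * (1 + y\<^sup>2) - (real DIM('a) - 2) * cot t * y))"
proof -
  have "0 < f t" using pos t by simp
  have "(k\<^sup>2 * (f t)\<^sup>2) * ((1 + (p - 1) * y\<^sup>2) * f'' t - f t * ((1 + (p - 1) * y\<^sup>2) * k\<^sup>2 * y\<^sup>2
     + k * (1 + y\<^sup>2) * (p - real DIM('a) - (p - 1) * k * (1 + y\<^sup>2) - (real DIM('a) - 2) * cot t * y))) =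
     angular_ode p (real DIM('a)) k t (f t) (f' t) (f'' t)"
    unfolding angular_ode_def y by algebra
  then show ?thesis using ode[OF t] k \<open>0 < f t\<close> by simp
qed

end

text \<open>\<open>D\<close> is k l f g times the difference of the slopes g'/(l g) and f'/(k f). It
  vanishes at both ends, and its derivative is positive there and at every interior zero. So
  \<open>D\<close> is positive after 0, remains positive, and yet is negative before pi/2.\<close>

lemma angular_solution_exponent_not_less:
  assumes S1: "angular_solution e p k f f' f''" and S2: "angular_solution (e::'a::euclidean_space) p l g g' g''"
  shows "\<not> l < k"
proof
  assume kl: "l < k"
  interpret F: angular_solution e p k f f' f'' by (rule S1)
  interpret G: angular_solution e p l g g' g'' by (rule S2)
  define N where "N = real DIM('a)"
  have N: "N \<ge> 2" using F.dim by (simp add: N_def)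
  define D where "D t = - l * f' t * g t + k * g' t * f t" for t
  define D' where "D' t = - l * (f'' t * g t + f' t * g' t) + k * (g'' t * f t + g' t * f' t)" for t
  have der: "(D has_real_derivative D' t) (at t within {0..pi/2})" if t: "t \<in> {0..pi/2}" for t
    unfolding D_def[abs_def] D'_def
    by (rule DERIV_cong, (rule derivative_eq_intros F.f[OF t] F.f'[OF t] G.f[OF t] G.f'[OF t] refl)+)
      (simp add: algebra_simps)
  have contD: "continuous_on {0..pi/2} D" using der by (rule DERIV_continuous_on)
  have D0: "D 0 = 0" by (simp add: D_def F.f'0 G.f'0)
  have D1: "D (pi/2) = 0" by (simp add: D_def F.f1 G.f1)
  have "D' 0 > 0"
  proof -
    have "(N - 1) * D' 0 = - l * ((N - 1) * f'' 0) + k * ((N - 1) * g'' 0)"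
      by (simp add: D'_def F.f'0 G.f'0 F.f0 G.f0 algebra_simps)
    also have "\<dots> = l * (k * (p - 1) + N - p) * k - k * (l * (p - 1) + N - p) * l"
      using F.second_derivative_at_0 G.second_derivative_at_0 unfolding N_def[symmetric]
      by (simp add: eq_neg_iff_add_eq_0[symmetric] mult.assoc)
    also have "\<dots> = (k * l) * ((p - 1) * (k - l))" by (simp add: algebra_simps)
    also have "\<dots> > 0" using F.k G.k F.p kl by (intro mult_pos_pos mult_neg_neg) auto
    finally show ?thesis using N by (simp add: zero_less_mult_iff)
  qed
  then obtain d where d: "0 < d" "\<And>h. 0 < h \<Longrightarrow> 0 + h \<in> {0..pi/2} \<Longrightarrow> h < d \<Longrightarrow> D 0 < D (0 + h)"
    using has_real_derivative_pos_inc_right[OF der[of 0]] by (metis atLeastAtMost_iff order_refl pi_half_ge_zero)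
  have "D' (pi/2) = (k - l) * (f' (pi/2) * g' (pi/2))"
    by (simp add: D'_def F.f1 G.f1 algebra_simps)
  also have "\<dots> > 0" using kl F.f'1_neg G.f'1_neg by (intro mult_pos_pos mult_neg_neg) auto
  finally obtain d1 where d1: "0 < d1" "\<And>h. 0 < h \<Longrightarrow> pi/2 - h \<in> {0..pi/2} \<Longrightarrow> h < d1 \<Longrightarrow> D (pi/2 - h) < D (pi/2)"
    using has_real_derivative_pos_inc_left[OF der[of "pi/2"]] by (metis atLeastAtMost_iff order_refl pi_half_ge_zero)
  \<comment> \<open>The caps pi/6 ensure a \<le> pi/6 and b \<ge> pi/3, so that a \<le> b.\<close>
  define a where "a = min (d/2) (pi/6)"
  define b where "b = pi/2 - min (d1/2) (pi/6)"
  have ab: "0 < a" "a \<le> b" "b < pi/2" using d(1) d1(1) by (auto simp: a_def b_def min_def)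
  have Da: "0 < D a" using d(2)[of a] d(1) ab D0 by (auto simp: a_def)
  have "D b < 0"
  proof -
    have h: "0 < min (d1/2) (pi/6)" "min (d1/2) (pi/6) < d1" using d1(1) by auto
    moreover have "b \<in> {0..pi/2}" using ab by auto
    ultimately show ?thesis using d1(2)[OF h(1) _ h(2)] D1 by (simp add: b_def)
  qed
  moreover have "0 < D b"
  proof (rule pos_preserved_if_zeros_increasing[where a = a and b = b and g = D and g' = D'])
    show "continuous_on {a..b} D" using ab by (intro continuous_on_subset[OF contD]) auto
    show "a \<le> b" "0 < D a" by fact+
    fix t assume t: "a < t" "t \<le> b" and z: "D t = 0"
    show "(D has_real_derivative D' t) (at t within {a..b})"
      using t ab by (intro DERIV_subset[OF der]) auto
    have t': "0 < t" "t < pi/2" using t ab by auto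
    have fg: "0 < f t" "0 < g t" using F.pos G.pos t' by auto
    define y where "y = f' t / (k * f t)"
    have y1: "f' t = k * f t * y" using fg F.k by (simp add: y_def)
    have "k * f t * (l * g t * y - g' t) = - D t" unfolding D_def y1 by algebra
    then have "k * f t * (l * g t * y - g' t) = 0" using z by simp
    then have y2: "g' t = l * g t * y" using fg F.k by simp
    define A where "A = 1 + (p - 1) * y\<^sup>2"
    have A: "A > 0" using F.p by (simp add: A_def add_pos_nonneg)
    note e1 = F.second_derivative_via_slope[OF t' y1, folded A_def N_def]
    note e2 = G.second_derivative_via_slope[OF t' y2, folded A_def N_def]
    have "A * D' t = - l * g t * (A * f'' t) + k * f t * (A * g'' t) + (k - l) * A * (f' t * g' t)"
      by (simp add: D'_def algebra_simps)
    \<comment> \<open>With a common slope y the terms containing A, those with the cotangent and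
      those with p - N all cancel; only the part proportional to (p-1)(k-l) survives.\<close>
    also have "\<dots> = (k * l) * (f t * g t) * ((1 + y\<^sup>2)\<^sup>2 * (p - 1) * (k - l))"
      unfolding e1 e2 unfolding y1 y2 by algebra
    also have "\<dots> > 0"
    proof -
      have "1 + y\<^sup>2 > 0" by (simp add: add_pos_nonneg)
      then show ?thesis
        using F.k G.k F.p kl fg by (intro mult_pos_pos mult_neg_neg) auto
    qed
    finally show "0 < D' t" using A by (simp add: zero_less_mult_iff)
  qed
  ultimately show False by simp
qed

subsection \<open>A singular initial value problem\<close>

text \<open>\<open>sin_average n g\<close> is the continuous solution of \<open>y' + n cot t y = g\<close> with \<open>y 0 = 0\<close>.\<close>

definition sin_average :: "nat \<Rightarrow> (real \<Rightarrow> real) \<Rightarrow> real \<Rightarrow> real" where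
  "sin_average n g s = (if s = 0 then 0 else integral {0..s} (\<lambda>t. sin t ^ n * g t) / sin s ^ n)"

lemma sin_pos_half: "0 < t \<Longrightarrow> t \<le> pi/2 \<Longrightarrow> 0 < sin t" for t :: real
  by (rule sin_gt_zero) auto

text \<open>The kernel (sin t / sin s)^n is at most 1 for t \<le> s, because sin increases on
  [0, pi/2].\<close>

lemma sin_average_bound:
  assumes g: "continuous_on {0..pi/2} g" and w: "continuous_on {0..pi/2} w"
    and le: "\<And>t. t \<in> {0..pi/2} \<Longrightarrow> \<bar>g t\<bar> \<le> w t" and s: "s \<in> {0..pi/2}"
  shows "\<bar>sin_average n g s\<bar> \<le> integral {0..s} w"
proof (cases "s = 0")
  case False
  with s have s0: "0 < s" "s \<le> pi/2" by auto
  have ss: "0 < sin s ^ n" using sin_pos_half s0 by simp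
  have sub: "{0..s} \<subseteq> {0..pi/2}" using s0 by auto
  have c: "continuous_on {0..s} g" "continuous_on {0..s} w" using g w continuous_on_subset[OF _ sub] by auto
  have "norm (integral {0..s} (\<lambda>t. sin t ^ n * g t)) \<le> integral {0..s} (\<lambda>t. sin s ^ n * w t)"
  proof (rule integral_norm_bound_integral)
    show "(\<lambda>t. sin t ^ n * g t) integrable_on {0..s}" "(\<lambda>t. sin s ^ n * w t) integrable_on {0..s}"
      using c by (auto intro!: integrable_continuous_real continuous_intros)
    fix t assume t: "t \<in> {0..s}"
    have "0 \<le> sin t" "sin t \<le> sin s" using t s0 by (auto intro!: sin_ge_zero sin_monotone_2pi_le)
    then have "sin t ^ n \<le> sin s ^ n" "0 \<le> sin t ^ n" by (auto intro: power_mono)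
    then show "norm (sin t ^ n * g t) \<le> sin s ^ n * w t"
      using le[of t] t s0 by (auto simp: abs_mult intro!: mult_mono)
  qed
  also have "\<dots> = sin s ^ n * integral {0..s} w" by simp
  finally show ?thesis using ss False by (simp add: sin_average_def divide_le_eq mult.commute)
qed (simp add: sin_average_def)

lemma sin_average_diff:
  assumes "continuous_on {0..pi/2} g" "continuous_on {0..pi/2} h" "s \<in> {0..pi/2}"
  shows "sin_average n g s - sin_average n h s = sin_average n (\<lambda>t. g t - h t) s"
proof (cases "s = 0")
  case False
  have sub: "{0..s} \<subseteq> {0..pi/2}" using assms(3) by auto
  have "integral {0..s} (\<lambda>t. sin t ^ n * (g t - h t)) =
      integral {0..s} (\<lambda>t. sin t ^ n * g t) - integral {0..s} (\<lambda>t. sin t ^ n * h t)"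
    unfolding right_diff_distrib
    using continuous_on_subset[OF _ sub] assms
    by (intro Henstock_Kurzweil_Integration.integral_diff integrable_continuous_real continuous_intros) auto
  then show ?thesis using False by (simp add: sin_average_def diff_divide_distrib)
qed (simp add: sin_average_def)

lemma sin_average_times:
  assumes "s \<in> {0..pi/2}"
  shows "sin s ^ n * sin_average n g s = integral {0..s} (\<lambda>t. sin t ^ n * g t)"
  using sin_pos_half[of s] assms by (cases "s = 0") (auto simp: sin_average_def)

lemma sin_average_continuous:
  assumes g: "continuous_on {0..pi/2} g"
  shows "continuous_on {0..pi/2} (sin_average n g)"
proof -
  obtain B where B: "\<And>t. t \<in> {0..pi/2} \<Longrightarrow> \<bar>g t\<bar> \<le> B"
    using compact_bounded_continuous[OF compact_Icc g] unfolding real_norm_def by blast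
  have bd: "\<bar>sin_average n g s\<bar> \<le> B * s" if "s \<in> {0..pi/2}" for s
    using sin_average_bound[OF g continuous_on_const[of _ B] B that] that by (simp add: mult.commute)
  define I where "I s = integral {0..s} (\<lambda>t. sin t ^ n * g t)" for s
  have cI: "continuous_on {0..pi/2} I"
    unfolding I_def by (intro indefinite_integral_continuous_1 integrable_continuous_real continuous_intros g)
  have "continuous (at s within {0..pi/2}) (sin_average n g)" if s: "s \<in> {0..pi/2}" for s
  proof (cases "s = 0")
    case True
    have "((\<lambda>s. B * s) \<longlongrightarrow> B * 0) (at 0 within {0..pi/2})" by (intro tendsto_intros)
    then have "((\<lambda>s. B * s) \<longlongrightarrow> 0) (at 0 within {0..pi/2})" by simp
    moreover have "\<forall>\<^sub>F s in at 0 within {0..pi/2}. norm (sin_average n g s) \<le> B * s"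
      unfolding eventually_at_filter by (rule always_eventually) (simp add: bd del: atLeastAtMost_iff)
    ultimately have "(sin_average n g \<longlongrightarrow> 0) (at 0 within {0..pi/2})"
      by (rule Lim_null_comparison[rotated])
    then show ?thesis using True by (simp add: continuous_within sin_average_def)
  next
    case False
    with s have s0: "0 < s" "s \<le> pi/2" by auto
    have "(I \<longlongrightarrow> I s) (at s within {0..pi/2})" using cI s by (simp add: continuous_on_def)
    then have "((\<lambda>t. I t / sin t ^ n) \<longlongrightarrow> I s / sin s ^ n) (at s within {0..pi/2})"
      using sin_pos_half[OF s0] by (intro tendsto_intros) auto
    moreover have "\<forall>\<^sub>F t in at s within {0..pi/2}. I t / sin t ^ n = sin_average n g t"
    proof -
      have "\<forall>\<^sub>F t in at s within {0..pi/2}. t \<in> {0<..}"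
        using s0 by (intro eventually_at_in_open'[THEN filter_leD[OF at_le, rotated]]) auto
      then show ?thesis by eventually_elim (simp add: sin_average_def I_def)
    qed
    ultimately have "(sin_average n g \<longlongrightarrow> I s / sin s ^ n) (at s within {0..pi/2})"
      by (rule Lim_transform_eventually)
    then show ?thesis using False by (simp add: continuous_within sin_average_def I_def)
  qed
  then show ?thesis by (simp add: continuous_on_eq_continuous_within)
qed

lemma sin_average_deriv:
  assumes g: "continuous_on {0..pi/2} g" and s: "s \<in> {0..pi/2}"
  shows "((\<lambda>s. sin s ^ n * sin_average n g s) has_real_derivative sin s ^ n * g s) (at s within {0..pi/2})"
proof -
  have "((\<lambda>s. integral {0..s} (\<lambda>t. sin t ^ n * g t)) has_real_derivative sin s ^ n * g s) (at s within {0..pi/2})"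
    using s by (intro integral_has_real_derivative continuous_intros g)
  then show ?thesis
    by (rule has_field_derivative_transform_within[where d = 1]) (use s in \<open>auto simp: sin_average_times\<close>)
qed

text \<open>By \<open>sin_average_bound\<close> the singular term costs nothing in the Picard
  estimate. An exponential weight makes the map a contraction on the whole interval at once.\<close>

lemma singular_volterra_solution_exists:
  fixes K :: "real \<Rightarrow> real \<Rightarrow> real"
  assumes cont: "\<And>\<psi>. continuous_on {0..pi/2} \<psi> \<Longrightarrow> continuous_on {0..pi/2} (\<lambda>t. K t (\<psi> t))"
    and lip: "\<And>t x y. t \<in> {0..pi/2} \<Longrightarrow> \<bar>K t x - K t y\<bar> \<le> M * \<bar>x - y\<bar>" and M: "0 \<le> M"
  shows "\<exists>\<psi>. continuous_on {0..pi/2} \<psi> \<and> \<psi> 0 = 0 \<and>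
    (\<forall>t\<in>{0..pi/2}. ((\<lambda>t. sin t ^ n * \<psi> t) has_real_derivative sin t ^ n * K t (\<psi> t)) (at t within {0..pi/2}))"
proof -
  \<comment> \<open>The fixed point \<open>v\<close> represents \<psi>(t) = exp(L t) v(t); in this
    weight the contraction factor is M/L < 1.\<close>
  define L where "L = M + 1"
  have L: "L > 0" "M / L < 1" "0 \<le> M / L" using M by (auto simp: L_def)
  \<comment> \<open>Clamping to [0, pi/2] lets the iteration run in the complete space of bounded
    continuous functions on the real line.\<close>
  define c where "c s = max 0 (min s (pi/2))" for s :: real
  have c: "c s \<in> {0..pi/2}" for s
    unfolding c_def atLeastAtMost_iff using pi_half_ge_zero by (simp only: max.cobounded1 max.bounded_iff min.cobounded2 simp_thms)
  have cc: "continuous_on UNIV c" unfolding c_def by (intro continuous_intros)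
  define Kv where "Kv v t = K t (exp (L * t) * apply_bcontfun v t)" for v t
  have Kv: "continuous_on {0..pi/2} (Kv v)" for v
    unfolding Kv_def by (intro cont continuous_intros continuous_on_apply_bcontfun)
  define T0 where "T0 v s = exp (- L * c s) * sin_average n (Kv v) (c s)" for v s
  have T0: "T0 v \<in> bcontfun" for v
  proof -
    have k: "continuous_on {0..pi/2} (\<lambda>s. exp (- L * s) * sin_average n (Kv v) s)"
      by (intro continuous_intros sin_average_continuous Kv)
    then have "continuous_on UNIV (T0 v)"
      unfolding T0_def by (rule continuous_on_compose2[OF _ cc]) (use c in auto)
    moreover have "range (T0 v) \<subseteq> (\<lambda>s. exp (- L * s) * sin_average n (Kv v) s) ` {0..pi/2}"
      unfolding T0_def using c by auto
    then have "bounded (range (T0 v))"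
      using compact_imp_bounded[OF compact_continuous_image[OF k compact_Icc]] bounded_subset by blast
    ultimately show ?thesis by (simp add: bcontfun_def)
  qed
  define T where "T v = Bcontfun (T0 v)" for v
  have T: "apply_bcontfun (T v) = T0 v" for v
    unfolding T_def using T0 by (rule Bcontfun_inverse)
  have "dist (T v) (T w) \<le> M / L * dist v w" for v w
  proof (rule dist_bound)
    fix s
    let ?d = "dist v w"
    have d0: "0 \<le> ?d" by simp
    have "\<bar>Kv v t - Kv w t\<bar> \<le> M * ?d * exp (L * t)" if "t \<in> {0..pi/2}" for t
    proof -
      have "\<bar>Kv v t - Kv w t\<bar> \<le> M * \<bar>exp (L * t) * v t - exp (L * t) * w t\<bar>"
        unfolding Kv_def by (rule lip[OF that])
      moreover have "\<bar>exp (L * t) * v t - exp (L * t) * w t\<bar> \<le> exp (L * t) * ?d"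
        using dist_bounded[of v t w] by (simp add: dist_real_def abs_mult right_diff_distrib[symmetric])
      ultimately have "\<bar>Kv v t - Kv w t\<bar> \<le> M * (exp (L * t) * ?d)"
        using M mult_left_mono order_trans by blast
      then show ?thesis by (simp add: mult_ac)
    qed
    then have "\<bar>sin_average n (\<lambda>t. Kv v t - Kv w t) (c s)\<bar> \<le> integral {0..c s} (\<lambda>t. M * ?d * exp (L * t))"
      by (intro sin_average_bound c continuous_intros Kv)
    also have "\<dots> = M * ?d / L * exp (L * c s) - M * ?d / L * exp (L * 0)"
    proof (rule integral_unique, rule fundamental_theorem_of_calculus)
      show "0 \<le> c s" using c[of s] by simp
      show "((\<lambda>t. M * ?d / L * exp (L * t)) has_vector_derivative M * ?d * exp (L * t)) (at t within {0..c s})" for t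
        using L unfolding has_real_derivative_iff_has_vector_derivative[symmetric]
        by (auto intro!: derivative_eq_intros)
    qed
    also have "\<dots> \<le> M * ?d / L * exp (L * c s)" using M L by simp
    finally have b: "\<bar>sin_average n (Kv v) (c s) - sin_average n (Kv w) (c s)\<bar> \<le> M * ?d / L * exp (L * c s)"
      by (simp add: sin_average_diff[OF Kv Kv c])
    have "dist (T v s) (T w s) = exp (- L * c s) * \<bar>sin_average n (Kv v) (c s) - sin_average n (Kv w) (c s)\<bar>"
      by (simp add: T T0_def dist_real_def abs_mult right_diff_distrib[symmetric])
    also have "\<dots> \<le> exp (- L * c s) * (M * ?d / L * exp (L * c s))"
      using b by (intro mult_left_mono) auto
    also have "\<dots> = M / L * ?d" by (simp add: exp_minus field_simps)
    finally show "dist (T v s) (T w s) \<le> M / L * ?d" .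
  qed
  then obtain v where v: "T v = v"
    using banach_fix_type[OF L(3,2), of T] by blast
  define \<psi> where "\<psi> = sin_average n (Kv v)"
  have fixp: "Kv v t = K t (\<psi> t)" if t: "t \<in> {0..pi/2}" for t
  proof -
    have "c t = t" using t by (auto simp: c_def)
    then have "apply_bcontfun v t = exp (- L * t) * \<psi> t"
      using T[of v] v by (simp add: T0_def \<psi>_def)
    then have "exp (L * t) * apply_bcontfun v t = \<psi> t"
      by (simp add: exp_minus field_simps)
    then show ?thesis by (simp add: Kv_def)
  qed
  have "continuous_on {0..pi/2} \<psi>" unfolding \<psi>_def by (rule sin_average_continuous[OF Kv])
  moreover have "\<psi> 0 = 0" by (simp add: \<psi>_def sin_average_def)
  moreover have "((\<lambda>t. sin t ^ n * \<psi> t) has_real_derivative sin t ^ n * K t (\<psi> t)) (at t within {0..pi/2})"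
    if "t \<in> {0..pi/2}" for t
    using sin_average_deriv[OF Kv that, of n v] fixp[OF that] by (simp add: \<psi>_def)
  ultimately show ?thesis by blast
qed

section \<open>Comparison with sub- and supersolutions\<close>

text \<open>A Gronwall argument confined to where \<open>g\<close> is positive: after the last point
  at which exp(-L t) g(t) is not positive, this function is nonincreasing and so cannot have become
  positive.\<close>

lemma nonpos_if_growth_bounded:
  fixes g g' :: "real \<Rightarrow> real"
  assumes cont: "continuous_on {0..b} g" and g0: "g 0 \<le> 0" and b: "0 \<le> b"
    and der: "\<And>t. 0 < t \<Longrightarrow> t < b \<Longrightarrow> 0 < g t \<Longrightarrow> (g has_real_derivative g' t) (at t)"
    and le: "\<And>t. 0 < t \<Longrightarrow> t < b \<Longrightarrow> 0 < g t \<Longrightarrow> g' t \<le> L * g t"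
  shows "g b \<le> 0"
proof (rule ccontr)
  assume "\<not> g b \<le> 0"
  define h where "h t = exp (- L * t) * g t" for t
  have conth: "continuous_on {0..b} h" unfolding h_def by (intro continuous_intros cont)
  have h_pos: "0 < h t \<longleftrightarrow> 0 < g t" for t by (simp add: h_def zero_less_mult_iff)
  define A where "A = {0..b} \<inter> h -` {..0}"
  have A: "closed A" "0 \<in> A"
    using continuous_closed_preimage[OF conth, of "{..0}"] g0 b by (auto simp: A_def h_def)
  have bdd: "bdd_above A" unfolding A_def by (intro bdd_above_Int1) auto
  define c where "c = Sup A"
  have cA: "c \<in> A" unfolding c_def using A bdd by (intro closed_contains_Sup) auto
  have pos: "0 < h t" if "c < t" "t \<le> b" for t
  proof (rule ccontr)
    assume "\<not> 0 < h t"
    then have "t \<in> A" using that cA by (auto simp: A_def)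
    then show False using cSup_upper[OF _ bdd, of t] that by (simp add: c_def)
  qed
  have c: "0 \<le> c" "c \<le> b" "h c \<le> 0" using cA by (auto simp: A_def)
  have hb: "0 < h b" using \<open>\<not> g b \<le> 0\<close> h_pos by simp
  then have cb: "c < b" using c by (cases "c = b") auto
  have dh: "(h has_real_derivative exp (- L * t) * (g' t - L * g t)) (at t)" if t: "c < t" "t < b" for t
  proof -
    have "0 < g t" using pos[of t] h_pos t by auto
    then have d: "(g has_real_derivative g' t) (at t)" using der t c by auto
    show ?thesis unfolding h_def
      by (rule DERIV_cong, (rule derivative_eq_intros d refl)+) (simp add: algebra_simps)
  qed
  have "continuous_on {c..b} h" using conth c by (auto intro: continuous_on_subset)
  moreover have "(h has_derivative (\<lambda>u. exp (- L * t) * (g' t - L * g t) * u)) (at t)" if "c < t" "t < b" for t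
    using dh[OF that] by (simp add: has_field_derivative_def)
  ultimately obtain t where t: "c < t" "t < b" "h b - h c = exp (- L * t) * (g' t - L * g t) * (b - c)"
    using mvt[OF cb, of h "\<lambda>t u. exp (- L * t) * (g' t - L * g t) * u"] by blast
  have "0 < g t" using pos[of t] h_pos t by auto
  then have "g' t - L * g t \<le> 0" using le[of t] t c by auto
  then have "exp (- L * t) * (g' t - L * g t) * (b - c) \<le> 0"
    using cb by (intro mult_nonpos_nonneg mult_nonneg_nonpos) auto
  then show False using t(3) hb c(3) by linarith
qed

text \<open>The integrating factor \<open>sin t ^ n\<close> removes the singular term of \<open>y' + n cot t y = K t y\<close>.\<close>

lemma singular_comparison:
  fixes K :: "real \<Rightarrow> real \<Rightarrow> real"
  assumes lip: "\<And>t x y. t \<in> {0..pi/2} \<Longrightarrow> \<bar>K t x - K t y\<bar> \<le> M * \<bar>x - y\<bar>"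
    and cont: "continuous_on {0..pi/2} \<psi>" and \<psi>0: "\<psi> 0 = 0"
    and der: "\<And>t. t \<in> {0..pi/2} \<Longrightarrow>
        ((\<lambda>t. sin t ^ n * \<psi> t) has_real_derivative sin t ^ n * K t (\<psi> t)) (at t within {0..pi/2})"
    and contc: "continuous_on {0..pi/2} \<eta>"
    and derc: "\<And>t. 0 < t \<Longrightarrow> t < pi/2 \<Longrightarrow> (\<eta> has_real_derivative \<eta>' t) (at t)"
    and s: "s \<in> {0..pi/2}"
  shows singular_comparison_super: "\<lbrakk>0 \<le> \<eta> 0; \<And>t. 0 < t \<Longrightarrow> t < pi/2 \<Longrightarrow> K t (\<eta> t) - real n * cot t * \<eta> t \<le> \<eta>' t\<rbrakk> \<Longrightarrow> \<psi> s \<le> \<eta> s"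
    and singular_comparison_sub: "\<lbrakk>\<eta> 0 \<le> 0; \<And>t. 0 < t \<Longrightarrow> t < pi/2 \<Longrightarrow> \<eta>' t \<le> K t (\<eta> t) - real n * cot t * \<eta> t\<rbrakk> \<Longrightarrow> \<eta> s \<le> \<psi> s"
proof -
  \<comment> \<open>The sign \<open>\<sigma>\<close> treats both comparisons at once: 1 for
    supersolutions, -1 for subsolutions.\<close>
  have main: "\<sigma> * (\<psi> s - \<eta> s) \<le> 0" if \<sigma>: "\<sigma> = 1 \<or> \<sigma> = - 1" and c0: "0 \<le> \<sigma> * \<eta> 0"
    and ineq: "\<And>t. 0 < t \<Longrightarrow> t < pi/2 \<Longrightarrow> \<sigma> * (K t (\<eta> t) - real n * cot t * \<eta> t - \<eta>' t) \<le> 0" for \<sigma> :: real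
  proof (cases "s = 0")
    case True
    then show ?thesis using c0 \<psi>0 by (simp add: right_diff_distrib)
  next
    case False
    with s have s0: "0 < s" "s \<le> pi/2" by auto
    define g where "g t = \<sigma> * (sin t ^ n * \<psi> t - sin t ^ n * \<eta> t)" for t
    define g' where "g' t = \<sigma> * (sin t ^ n * K t (\<psi> t) - (sin t ^ n * real n * cot t * \<eta> t + sin t ^ n * \<eta>' t))" for t
    have sub: "{0..s} \<subseteq> {0..pi/2}" using s0 by auto
    have "g s \<le> 0"
    proof (rule nonpos_if_growth_bounded[where g = g and b = s and g' = g' and L = M])
      show "continuous_on {0..s} g" unfolding g_def
        by (intro continuous_intros continuous_on_subset[OF cont sub] continuous_on_subset[OF contc sub])
      \<comment> \<open>For \<open>n = 0\<close> the weight \<open>0 ^ n\<close> is 1 and the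
        initial inequality enters; for positive \<open>n\<close> the weight is 0.\<close>
      show "g 0 \<le> 0"
      proof -
        have "g 0 = - (0 ^ n) * (\<sigma> * \<eta> 0)" by (simp add: g_def \<psi>0)
        then show ?thesis using c0 by (cases n) auto
      qed
      show "0 \<le> s" using s0 by simp
      fix t assume t: "0 < t" "t < s" and gt: "0 < g t"
      have t': "0 < t" "t < pi/2" "t \<in> {0..pi/2}" using t s0 by auto
      have st: "0 < sin t" using sin_pos_half t' by simp
      have d1: "((\<lambda>t. sin t ^ n * \<psi> t) has_real_derivative sin t ^ n * K t (\<psi> t)) (at t)"
        using der[OF t'(3)] at_within_Icc_at[OF t'(1,2)] by simp
      have pw: "n = 0 \<or> cos t * sin t ^ (n - Suc 0) = cot t * sin t ^ n"
        using st by (cases n) (auto simp: cot_def)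
      have d2: "((\<lambda>t. sin t ^ n * \<eta> t) has_real_derivative sin t ^ n * real n * cot t * \<eta> t + sin t ^ n * \<eta>' t) (at t)"
        by (rule DERIV_cong, (rule derivative_eq_intros derc[OF t'(1,2)] refl)+)
          (use pw in \<open>auto simp: algebra_simps\<close>)
      show "(g has_real_derivative g' t) (at t)"
        unfolding g_def g'_def by (intro DERIV_cmult DERIV_diff d1 d2)
      have "\<sigma> * (K t (\<psi> t) - K t (\<eta> t)) \<le> M * \<bar>\<psi> t - \<eta> t\<bar>"
        using lip[OF t'(3), of "\<psi> t" "\<eta> t"] \<sigma> by (auto simp: abs_le_iff)
      moreover have "0 < \<sigma> * (\<psi> t - \<eta> t)"
      proof -
        have "g t = sin t ^ n * (\<sigma> * (\<psi> t - \<eta> t))" by (simp add: g_def algebra_simps)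
        then show ?thesis using gt st by (simp add: zero_less_mult_iff)
      qed
      then have "\<bar>\<psi> t - \<eta> t\<bar> = \<sigma> * (\<psi> t - \<eta> t)" using \<sigma> by auto
      then have "M * \<bar>\<psi> t - \<eta> t\<bar> = M * (\<sigma> * (\<psi> t - \<eta> t))" by simp
      ultimately have "\<sigma> * (K t (\<psi> t) - K t (\<eta> t)) + \<sigma> * (K t (\<eta> t) - real n * cot t * \<eta> t - \<eta>' t) \<le> M * (\<sigma> * (\<psi> t - \<eta> t))"
        using ineq[OF t'(1,2)] by linarith
      then have "sin t ^ n * (\<sigma> * (K t (\<psi> t) - K t (\<eta> t)) + \<sigma> * (K t (\<eta> t) - real n * cot t * \<eta> t - \<eta>' t))
           \<le> sin t ^ n * (M * (\<sigma> * (\<psi> t - \<eta> t)))"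
        using st by (intro mult_left_mono) auto
      then show "g' t \<le> M * g t" by (simp add: g_def g'_def algebra_simps)
    qed
    moreover have "g s = sin s ^ n * (\<sigma> * (\<psi> s - \<eta> s))" by (simp add: g_def algebra_simps)
    moreover have "0 < sin s ^ n" using sin_pos_half[OF s0] by simp
    ultimately show ?thesis by (metis mult_pos_pos not_le)
  qed
  show "\<psi> s \<le> \<eta> s" if "0 \<le> \<eta> 0" "\<And>t. 0 < t \<Longrightarrow> t < pi/2 \<Longrightarrow> K t (\<eta> t) - real n * cot t * \<eta> t \<le> \<eta>' t"
    using main[of 1] that by auto
  show "\<eta> s \<le> \<psi> s" if "\<eta> 0 \<le> 0" "\<And>t. 0 < t \<Longrightarrow> t < pi/2 \<Longrightarrow> \<eta>' t \<le> K t (\<eta> t) - real n * cot t * \<eta> t"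
    using main[of "-1"] that by auto
qed

subsection \<open>The shooting problem for the Pruefer angle\<close>

lemma cot_nonneg: "0 \<le> t \<Longrightarrow> t \<le> pi/2 \<Longrightarrow> 0 \<le> cot t" for t :: real
  unfolding cot_def by (intro divide_nonneg_nonneg cos_ge_zero sin_ge_zero) auto

lemma times_cot_le_1:
  fixes t :: real
  assumes "0 \<le> t" "t \<le> pi/2"
  shows "t * cot t \<le> 1"
proof (cases "t = 0")
  case False
  with assms have t: "0 < t" by simp
  have "\<exists>z. 0 < z \<and> z < t \<and> sin t - sin 0 = (t - 0) * cos z"
    using t by (intro MVT2) (auto simp: DERIV_sin)
  then obtain z where z: "0 < z" "z < t" "sin t = t * cos z" by auto
  have "cos t \<le> cos z" using z assms by (intro cos_monotone_0_pi_le) auto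
  then have "t * cos t \<le> sin t" unfolding z(3) using t by (intro mult_left_mono) auto
  then show ?thesis using sin_pos_half[OF t assms(2)] by (simp add: cot_def divide_le_eq)
qed simp

text \<open>A factor of order t^2 beats the pole of cot: by t cot t \<le> 1 the product is at most B
  t, so it tends to 0, its value at 0.\<close>

lemma continuous_on_cot_times:
  fixes w :: "real \<Rightarrow> real"
  assumes w: "continuous_on {0..pi/2} w" and le: "\<And>t. t \<in> {0..pi/2} \<Longrightarrow> \<bar>w t\<bar> \<le> B * t\<^sup>2"
  shows "continuous_on {0..pi/2} (\<lambda>t. cot t * w t)"
proof -
  have "0 \<le> B * (pi/2)\<^sup>2" by (rule order_trans[OF abs_ge_zero le]) simp
  then have B: "B \<ge> 0" by (simp add: zero_le_mult_iff)
  have bd: "\<bar>cot t * w t\<bar> \<le> B * t" if t: "t \<in> {0..pi/2}" for t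
  proof -
    have "\<bar>cot t * w t\<bar> \<le> cot t * (B * t\<^sup>2)"
      using t le[OF t] cot_nonneg[of t] by (simp add: abs_mult mult_left_mono)
    also have "\<dots> = (t * cot t) * (B * t)" by (simp add: power2_eq_square)
    also have "\<dots> \<le> 1 * (B * t)" using t B times_cot_le_1[of t] by (intro mult_right_mono) auto
    finally show ?thesis by simp
  qed
  have "continuous (at s within {0..pi/2}) (\<lambda>t. cot t * w t)" if s: "s \<in> {0..pi/2}" for s
  proof (cases "s = 0")
    case True
    have "((\<lambda>s. B * s) \<longlongrightarrow> B * 0) (at 0 within {0..pi/2})" by (intro tendsto_intros)
    then have "((\<lambda>s. B * s) \<longlongrightarrow> 0) (at 0 within {0..pi/2})" by simp
    moreover have "\<forall>\<^sub>F s in at 0 within {0..pi/2}. norm (cot s * w s) \<le> B * s"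
      unfolding eventually_at_filter by (rule always_eventually) (simp add: bd del: atLeastAtMost_iff)
    ultimately have "((\<lambda>t. cot t * w t) \<longlongrightarrow> 0) (at 0 within {0..pi/2})"
      by (rule Lim_null_comparison[rotated])
    then show ?thesis using True by (simp add: continuous_within)
  next
    case False
    then have "sin s \<noteq> 0" using sin_pos_half[of s] s by simp
    moreover have "(w \<longlongrightarrow> w s) (at s within {0..pi/2})" using w s by (simp add: continuous_on_def)
    ultimately show ?thesis
      unfolding continuous_within cot_def by (intro tendsto_intros) auto
  qed
  then show ?thesis by (simp add: continuous_on_eq_continuous_within)
qed

lemma abs_mult_le_of_abs_le: "\<bar>x\<bar> \<le> a \<Longrightarrow> \<bar>y\<bar> \<le> b \<Longrightarrow> \<bar>x * y\<bar> \<le> a * b" for x y a b :: real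
  by (simp add: abs_mult mult_mono')

lemma cos_squared_lipschitz: "\<bar>(cos x)\<^sup>2 - (cos y)\<^sup>2\<bar> \<le> 2 * \<bar>x - y\<bar>" for x y :: real
proof -
  have "\<bar>cos x - cos y\<bar> \<le> 1 * \<bar>x - y\<bar>"
    by (rule lipschitz_of_bounded_derivative_except_point[where c = x and \<phi>' = "\<lambda>t. - sin t"])
      (auto intro!: continuous_on_cos continuous_on_id DERIV_cos)
  moreover have "\<bar>cos x + cos y\<bar> \<le> 2" using abs_cos_le_one[of x] abs_cos_le_one[of y] by linarith
  ultimately have "\<bar>(cos x - cos y) * (cos x + cos y)\<bar> \<le> (1 * \<bar>x - y\<bar>) * 2" by (rule abs_mult_le_of_abs_le)
  then show ?thesis by (simp add: power2_eq_square algebra_simps)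
qed

text \<open>With \<open>f = R cos \<psi>\<close>, \<open>f' = - \<beta> R sin \<psi>\<close> and \<open>k = - \<beta>\<close> the angular equation becomes
  \<open>\<psi>' = slope \<beta> \<psi> - n cot t * swing \<psi>\<close>, where \<open>swing x = sin x cos x / den x\<close> and \<open>n = N - 2\<close>.
  Splitting \<open>swing x = x - rest x\<close> isolates the singular linear term; \<open>clip\<close> keeps \<open>cot t * rest\<close>
  Lipschitz, and is inactive on the solutions of interest.\<close>

locale shooting =
  fixes p :: real and n :: nat
  assumes p: "1 < p"
begin

definition den :: "real \<Rightarrow> real" where "den x = (cos x)\<^sup>2 + (p - 1) * (sin x)\<^sup>2"
definition slope :: "real \<Rightarrow> real \<Rightarrow> real" where
  "slope \<beta> x = ((p - 1) * \<beta> + (p - (real n + 2)) * (cos x)\<^sup>2) / den x"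
definition rest :: "real \<Rightarrow> real" where "rest x = x - sin x * cos x / den x"
definition den_min :: real where "den_min = min 1 (p - 1)"
text \<open>Makes \<open>slope \<beta> 0\<close> = (p-1)\<beta> + p - N nonnegative for \<beta>
  \<ge> \<open>\<beta>0\<close>, so that 0 is a subsolution.\<close>

definition \<beta>0 :: real where "\<beta>0 = max 0 ((real n + 2 - p) / (p - 1))"
text \<open>The entries 1 and (2N - 1 - p)/(p - 1) are what the subsolution \<psi>(t) = t
  requires.\<close>

definition \<beta>1 :: real where "\<beta>1 = max (max 1 \<beta>0) ((2 * (real n + 2) - 1 - p) / (p - 1))"
text \<open>The quotient bounds \<open>slope\<close> for 0 \<le> \<beta> \<le>
  \<open>\<beta>1\<close>. The summands |p - N| and 1 keep the comparison functions arctan((p - N)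
  t) and t below the truncation level.\<close>

definition slope_max :: real where
  "slope_max = ((p - 1) * \<beta>1 + \<bar>p - (real n + 2)\<bar>) / den_min + \<bar>p - (real n + 2)\<bar> + 1"
definition rest_lip :: real where "rest_lip = (p\<^sup>2 + 2 * p) / den_min\<^sup>2"
definition clip :: "real \<Rightarrow> real \<Rightarrow> real" where
  "clip t x = max 0 (min x (min (slope_max * t) (pi/2)))"
definition rhs :: "real \<Rightarrow> real \<Rightarrow> real \<Rightarrow> real" where
  "rhs \<beta> t x = slope \<beta> x + real n * cot t * rest (clip t x)"
definition rhs_lip :: real where
  "rhs_lip = 2 * (\<bar>p - (real n + 2)\<bar> * (p - 1) + (p - 1) * \<beta>1 * p) / den_min\<^sup>2 + real n * rest_lip * slope_max"

lemma den_min_pos: "0 < den_min" using p by (simp add: den_min_def)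

text \<open>\<open>den x\<close> is a convex combination of 1 and p - 1.\<close>

lemma den_bounds: "den_min \<le> den x" "den x \<le> p"
proof -
  have "den_min * (cos x)\<^sup>2 \<le> 1 * (cos x)\<^sup>2" "den_min * (sin x)\<^sup>2 \<le> (p - 1) * (sin x)\<^sup>2"
    by (intro mult_right_mono; simp add: den_min_def)+
  then have "den_min * ((cos x)\<^sup>2 + (sin x)\<^sup>2) \<le> den x"
    unfolding den_def distrib_left by linarith
  then show "den_min \<le> den x" by simp
  have "1 * (cos x)\<^sup>2 \<le> p * (cos x)\<^sup>2" "(p - 1) * (sin x)\<^sup>2 \<le> p * (sin x)\<^sup>2"
    using p by (intro mult_right_mono; simp)+
  then have "den x \<le> p * (cos x)\<^sup>2 + p * (sin x)\<^sup>2"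
    unfolding den_def by linarith
  also have "\<dots> = p" by (simp flip: distrib_left)
  finally show "den x \<le> p" .
qed

lemma den_pos: "0 < den x" using den_min_pos den_bounds(1)[of x] by linarith

lemma den_eq: "den x = (p - 1) + (2 - p) * (cos x)\<^sup>2"
  unfolding den_def sin_squared_eq by (simp add: algebra_simps)

lemma \<beta>1_ge: "1 \<le> \<beta>1" "\<beta>0 \<le> \<beta>1" "2 * (real n + 2) - 1 - p \<le> (p - 1) * \<beta>1"
proof -
  show "1 \<le> \<beta>1" "\<beta>0 \<le> \<beta>1" by (auto simp: \<beta>1_def)
  have "(2 * (real n + 2) - 1 - p) / (p - 1) \<le> \<beta>1" unfolding \<beta>1_def by (rule max.cobounded2)
  then show "2 * (real n + 2) - 1 - p \<le> (p - 1) * \<beta>1" using p by (simp add: pos_divide_le_eq mult.commute)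
qed

lemma \<beta>0_nonneg: "0 \<le> \<beta>0" by (simp add: \<beta>0_def)

lemma slope_0_nonneg: "\<beta>0 \<le> \<beta> \<Longrightarrow> 0 \<le> (p - 1) * \<beta> + p - (real n + 2)"
  using p by (auto simp: \<beta>0_def pos_divide_le_eq mult.commute)

lemma slope_max_ge: "1 \<le> slope_max" "\<bar>p - (real n + 2)\<bar> \<le> slope_max"
  using p \<beta>1_ge(1) den_min_pos by (simp_all add: slope_max_def)

lemma slope_le:
  assumes "0 \<le> \<beta>" "\<beta> \<le> \<beta>1"
  shows "slope \<beta> x \<le> slope_max"
proof -
  have "(p - 1) * \<beta> + (p - (real n + 2)) * (cos x)\<^sup>2 \<le> (p - 1) * \<beta>1 + \<bar>p - (real n + 2)\<bar>"
  proof (intro add_mono mult_left_mono)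
    have "\<bar>(p - (real n + 2)) * (cos x)\<^sup>2\<bar> \<le> \<bar>p - (real n + 2)\<bar> * 1"
      by (rule abs_mult_le_of_abs_le[OF order_refl]) (simp add: abs_square_le_1)
    then show "(p - (real n + 2)) * (cos x)\<^sup>2 \<le> \<bar>p - (real n + 2)\<bar>" by simp
  qed (use assms p in auto)
  then have "slope \<beta> x \<le> ((p - 1) * \<beta>1 + \<bar>p - (real n + 2)\<bar>) / den x"
    unfolding slope_def using den_pos[of x] by (intro divide_right_mono) auto
  also have "\<dots> \<le> ((p - 1) * \<beta>1 + \<bar>p - (real n + 2)\<bar>) / den_min"
    using p \<beta>1_ge(1) den_min_pos den_bounds(1)[of x] by (intro divide_left_mono) auto
  finally show ?thesis by (simp add: slope_max_def)
qed

text \<open>Numerator and denominator of \<open>slope\<close> are affine in (cos x)^2, so over a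
  common denominator the difference collapses to a constant times (cos x)^2 - (cos y)^2.\<close>

lemma slope_lipschitz:
  assumes "0 \<le> \<beta>" "\<beta> \<le> \<beta>1"
  shows "\<bar>slope \<beta> x - slope \<beta> y\<bar> \<le> 2 * (\<bar>p - (real n + 2)\<bar> * (p - 1) + (p - 1) * \<beta>1 * p) / den_min\<^sup>2 * \<bar>x - y\<bar>"
proof -
  define b where "b = p - (real n + 2)"
  define w where "w = b * (p - 1) - (p - 1) * \<beta> * (2 - p)"
  have "slope \<beta> x - slope \<beta> y = w * ((cos x)\<^sup>2 - (cos y)\<^sup>2) / (den x * den y)"
    unfolding slope_def w_def b_def[symmetric] using den_pos[of x] den_pos[of y]
    by (simp add: diff_frac_eq) (simp add: den_eq algebra_simps)
  also have "\<bar>\<dots>\<bar> = \<bar>w * ((cos x)\<^sup>2 - (cos y)\<^sup>2)\<bar> / (den x * den y)"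
    using den_pos[of x] den_pos[of y] by (simp add: abs_mult)
  also have "\<dots> \<le> ((\<bar>b\<bar> * (p - 1) + (p - 1) * \<beta>1 * p) * (2 * \<bar>x - y\<bar>)) / (den_min * den_min)"
  proof (rule frac_le)
    have "\<bar>w\<bar> \<le> \<bar>b * (p - 1)\<bar> + \<bar>(p - 1) * \<beta> * (2 - p)\<bar>" unfolding w_def by (rule abs_triangle_ineq4)
    also have "\<dots> \<le> \<bar>b\<bar> * (p - 1) + (p - 1) * \<beta>1 * p"
      using p assms by (intro add_mono abs_mult_le_of_abs_le) (auto simp: abs_mult)
    finally show "\<bar>w * ((cos x)\<^sup>2 - (cos y)\<^sup>2)\<bar> \<le> (\<bar>b\<bar> * (p - 1) + (p - 1) * \<beta>1 * p) * (2 * \<bar>x - y\<bar>)"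
      using cos_squared_lipschitz by (rule abs_mult_le_of_abs_le)
    show "den_min * den_min \<le> den x * den y"
      using den_min_pos den_bounds(1) by (intro mult_mono) (auto intro: less_imp_le den_pos)
    show "0 < den_min * den_min" using den_min_pos by simp
    show "0 \<le> (\<bar>b\<bar> * (p - 1) + (p - 1) * \<beta>1 * p) * (2 * \<bar>x - y\<bar>)"
      using p \<beta>1_ge(1) by auto
  qed
  finally show ?thesis unfolding b_def by (simp only: power2_eq_square times_divide_eq_left times_divide_eq_right mult_ac)
qed

lemma slope_param: "\<bar>slope \<beta> x - slope \<gamma> x\<bar> \<le> (p - 1) / den_min * \<bar>\<beta> - \<gamma>\<bar>"
proof -
  have "slope \<beta> x - slope \<gamma> x = (p - 1) * (\<beta> - \<gamma>) / den x"
    unfolding slope_def by (simp add: diff_divide_distrib[symmetric] algebra_simps)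
  also have "\<bar>\<dots>\<bar> = (p - 1) * \<bar>\<beta> - \<gamma>\<bar> / den x" using den_pos[of x] p by (simp add: abs_mult)
  also have "\<dots> \<le> (p - 1) * \<bar>\<beta> - \<gamma>\<bar> / den_min"
    using p den_min_pos den_bounds(1)[of x] by (intro divide_left_mono) auto
  finally show ?thesis by simp
qed

text \<open>The factor (sin x)^2 shows that removing the linear part leaves a remainder of third
  order at 0.\<close>

lemma rest_deriv:
  "(rest has_real_derivative (sin x)\<^sup>2 * (p * den x + 2 * (p - 2) * (cos x)\<^sup>2) / (den x)\<^sup>2) (at x)"
proof -
  have d: "(den has_real_derivative 2 * (p - 2) * sin x * cos x) (at x)"
    unfolding den_def[abs_def] by (rule DERIV_cong, (rule derivative_eq_intros refl)+) (simp add: algebra_simps)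
  have "den x * den x - (((cos x)\<^sup>2 - (sin x)\<^sup>2) * den x - sin x * cos x * (2 * (p - 2) * sin x * cos x))
     = (sin x)\<^sup>2 * (p * den x + 2 * (p - 2) * (cos x)\<^sup>2)"
    unfolding den_def by (simp add: algebra_simps power2_eq_square)
  then have eq: "1 - (((cos x)\<^sup>2 - (sin x)\<^sup>2) * den x - sin x * cos x * (2 * (p - 2) * sin x * cos x)) / (den x * den x)
     = (sin x)\<^sup>2 * (p * den x + 2 * (p - 2) * (cos x)\<^sup>2) / (den x)\<^sup>2"
    using den_pos[of x] by (simp add: field_simps power2_eq_square)
  have "((\<lambda>x. sin x * cos x) has_real_derivative ((cos x)\<^sup>2 - (sin x)\<^sup>2)) (at x)"
    by (rule DERIV_cong, (rule derivative_eq_intros refl)+) (simp add: power2_eq_square)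
  from DERIV_diff[OF DERIV_ident DERIV_divide[OF this d]] den_pos[of x]
  show ?thesis unfolding rest_def[abs_def] eq[symmetric] by simp
qed

lemma continuous_on_rest: "continuous_on S rest"
  using rest_deriv DERIV_isCont continuous_at_imp_continuous_on by blast

text \<open>The Lipschitz constant is proportional to the size \<open>c\<close> of the arguments,
  from (sin z)^2 \<le> c. With \<open>c\<close> of order t this compensates the pole of cot
  t.\<close>

lemma rest_lipschitz:
  assumes "0 \<le> x" "x \<le> pi/2" "0 \<le> y" "y \<le> pi/2" "x \<le> c" "y \<le> c"
  shows "\<bar>rest x - rest y\<bar> \<le> rest_lip * c * \<bar>x - y\<bar>"
proof -
  have bd: "\<bar>(sin z)\<^sup>2 * (p * den z + 2 * (p - 2) * (cos z)\<^sup>2) / (den z)\<^sup>2\<bar> \<le> rest_lip * c"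
    if z: "0 \<le> z" "z \<le> c" for z
  proof -
    have "\<bar>sin z\<bar> \<le> c" using abs_sin_x_le_abs_x[of z] z by simp
    moreover have "\<bar>sin z\<bar> \<le> 1" by simp
    ultimately have s: "\<bar>sin z * sin z\<bar> \<le> c * 1" by (rule abs_mult_le_of_abs_le)
    have "\<bar>p * den z\<bar> \<le> p * p" using p den_pos[of z] den_bounds(2)[of z] by (simp add: abs_mult)
    moreover have "\<bar>2 * (p - 2) * (cos z)\<^sup>2\<bar> \<le> (2 * p) * 1"
      using p by (intro abs_mult_le_of_abs_le) (auto simp: abs_square_le_1)
    ultimately have "\<bar>p * den z + 2 * (p - 2) * (cos z)\<^sup>2\<bar> \<le> p\<^sup>2 + 2 * p"
      unfolding power2_eq_square[of p] by linarith
    with s have "\<bar>sin z * sin z * (p * den z + 2 * (p - 2) * (cos z)\<^sup>2)\<bar> \<le> c * 1 * (p\<^sup>2 + 2 * p)"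
      by (rule abs_mult_le_of_abs_le)
    then have n: "\<bar>(sin z)\<^sup>2 * (p * den z + 2 * (p - 2) * (cos z)\<^sup>2)\<bar> \<le> (p\<^sup>2 + 2 * p) * c"
      by (simp add: power2_eq_square mult.commute)
    have "\<bar>(sin z)\<^sup>2 * (p * den z + 2 * (p - 2) * (cos z)\<^sup>2) / (den z)\<^sup>2\<bar> =
        \<bar>(sin z)\<^sup>2 * (p * den z + 2 * (p - 2) * (cos z)\<^sup>2)\<bar> / (den z)\<^sup>2"
      by simp
    also have "\<dots> \<le> ((p\<^sup>2 + 2 * p) * c) / den_min\<^sup>2"
      using n den_min_pos den_bounds(1)[of z] p z by (intro frac_le power_mono) auto
    finally show ?thesis by (simp add: rest_lip_def)
  qed
  have main: "\<bar>rest x - rest y\<bar> \<le> rest_lip * c * \<bar>x - y\<bar>" if xy: "x < y" "0 \<le> x" "y \<le> c" for x y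
  proof -
    obtain z where z: "x < z" "z < y"
      "rest y - rest x = (y - x) * ((sin z)\<^sup>2 * (p * den z + 2 * (p - 2) * (cos z)\<^sup>2) / (den z)\<^sup>2)"
      using MVT2[OF xy(1) rest_deriv] by blast
    have "\<bar>rest y - rest x\<bar> \<le> (y - x) * (rest_lip * c)"
      unfolding z(3) abs_mult[of "y - x"] using bd[of z] z xy by (intro mult_mono) auto
    then show ?thesis using xy by (simp add: abs_minus_commute mult.commute)
  qed
  consider "x < y" | "y < x" | "x = y" by linarith
  then show ?thesis
    using main[of x y] main[of y x] assms by cases (auto simp: abs_minus_commute)
qed

lemma rest_0: "rest 0 = 0" by (simp add: rest_def)

lemma rest_lip_nonneg: "0 \<le> rest_lip" using p by (simp add: rest_lip_def)

lemma rest_le: "0 \<le> x \<Longrightarrow> x \<le> pi/2 \<Longrightarrow> rest x \<le> x"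
  using den_pos[of x] by (simp add: rest_def sin_ge_zero cos_ge_zero)

lemma clip_bounds: "0 \<le> clip t x" "0 \<le> t \<Longrightarrow> clip t x \<le> slope_max * t" "clip t x \<le> pi/2"
proof -
  show "0 \<le> clip t x" by (simp add: clip_def)
  show "clip t x \<le> slope_max * t" if "0 \<le> t"
    using slope_max_ge(1) that by (simp add: clip_def min.coboundedI2 min.coboundedI1)
  show "clip t x \<le> pi/2"
    unfolding clip_def by (intro max.boundedI min.coboundedI2 order_refl pi_half_ge_zero)
qed

lemma clip_lipschitz: "\<bar>clip t x - clip t y\<bar> \<le> \<bar>x - y\<bar>"
  unfolding clip_def by (simp add: max_def min_def)

text \<open>Truncation at \<open>slope_max * t\<close> gives \<open>rest\<close> a Lipschitz
  constant of order t, and t cot t \<le> 1 absorbs the cotangent.\<close>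

lemma rest_clip_lipschitz:
  assumes t: "t \<in> {0..pi/2}"
  shows "\<bar>real n * cot t * rest (clip t x) - real n * cot t * rest (clip t y)\<bar> \<le> real n * rest_lip * slope_max * \<bar>x - y\<bar>"
proof -
  have t0: "0 \<le> t" "t \<le> pi/2" using t by auto
  have ct: "0 \<le> cot t" using cot_nonneg t0 by blast
  have "\<bar>rest (clip t x) - rest (clip t y)\<bar> \<le> rest_lip * (slope_max * t) * \<bar>clip t x - clip t y\<bar>"
    using clip_bounds t0 by (intro rest_lipschitz) auto
  also have "\<dots> \<le> rest_lip * (slope_max * t) * \<bar>x - y\<bar>"
    using clip_lipschitz rest_lip_nonneg slope_max_ge(1) t0 by (intro mult_left_mono) auto
  finally have "real n * cot t * \<bar>rest (clip t x) - rest (clip t y)\<bar> \<le> real n * cot t * (rest_lip * (slope_max * t) * \<bar>x - y\<bar>)"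
    using ct by (intro mult_left_mono) auto
  also have "\<dots> = (t * cot t) * (real n * rest_lip * slope_max * \<bar>x - y\<bar>)" by (simp add: mult_ac)
  also have "\<dots> \<le> 1 * (real n * rest_lip * slope_max * \<bar>x - y\<bar>)"
    using times_cot_le_1[OF t0] rest_lip_nonneg slope_max_ge(1) by (intro mult_right_mono) auto
  finally show ?thesis using ct by (simp add: abs_mult right_diff_distrib[symmetric])
qed

lemma rhs_lipschitz:
  assumes "0 \<le> \<beta>" "\<beta> \<le> \<beta>1" "t \<in> {0..pi/2}"
  shows "\<bar>rhs \<beta> t x - rhs \<beta> t y\<bar> \<le> rhs_lip * \<bar>x - y\<bar>"
  using slope_lipschitz[OF assms(1,2), of x y] rest_clip_lipschitz[OF assms(3), of x y]
  unfolding rhs_def rhs_lip_def distrib_right by linarith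

lemma rhs_lip_nonneg: "0 \<le> rhs_lip"
  using p \<beta>1_ge(1) rest_lip_nonneg slope_max_ge(1) unfolding rhs_lip_def
  by (intro add_nonneg_nonneg divide_nonneg_nonneg mult_nonneg_nonneg) auto

lemma continuous_on_rhs:
  assumes \<psi>: "continuous_on {0..pi/2} \<psi>"
  shows "continuous_on {0..pi/2} (\<lambda>t. rhs \<beta> t (\<psi> t))"
proof -
  have c: "continuous_on {0..pi/2} (\<lambda>t. rest (clip t (\<psi> t)))"
    unfolding clip_def by (intro continuous_on_compose2[OF continuous_on_rest[of UNIV]] continuous_intros \<psi>) auto
  have bd: "\<bar>rest (clip t (\<psi> t))\<bar> \<le> rest_lip * slope_max\<^sup>2 * t\<^sup>2" if t: "t \<in> {0..pi/2}" for t
  proof -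
    have t0: "0 \<le> t" using t by simp
    let ?c = "clip t (\<psi> t)"
    have "\<bar>rest ?c\<bar> \<le> rest_lip * (slope_max * t) * \<bar>?c - 0\<bar>"
      using rest_lipschitz[of ?c 0 "slope_max * t"] clip_bounds t0 slope_max_ge(1) by (simp add: rest_0)
    also have "\<dots> \<le> rest_lip * (slope_max * t) * (slope_max * t)"
      using clip_bounds[of t "\<psi> t"] t0 rest_lip_nonneg slope_max_ge(1) by (intro mult_left_mono) auto
    finally show ?thesis by (simp add: power2_eq_square mult_ac)
  qed
  have "continuous_on {0..pi/2} (\<lambda>t. slope \<beta> (\<psi> t))"
    unfolding slope_def den_def using den_pos[unfolded den_def]
    by (intro continuous_intros \<psi>) (metis less_irrefl)
  then have "continuous_on {0..pi/2} (\<lambda>t. slope \<beta> (\<psi> t) + real n * (cot t * rest (clip t (\<psi> t))))"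
    by (intro continuous_intros continuous_on_cot_times[OF c bd])
  then show ?thesis by (simp add: rhs_def mult.assoc)
qed


section \<open>The solutions of the truncated problem and their dependence on \<beta>\<close>

definition is_solution :: "real \<Rightarrow> (real \<Rightarrow> real) \<Rightarrow> bool" where
  "is_solution \<beta> \<psi> \<longleftrightarrow> continuous_on {0..pi/2} \<psi> \<and> \<psi> 0 = 0 \<and>
    (\<forall>t\<in>{0..pi/2}. ((\<lambda>t. sin t ^ n * \<psi> t) has_real_derivative sin t ^ n * rhs \<beta> t (\<psi> t)) (at t within {0..pi/2}))"

definition sol :: "real \<Rightarrow> real \<Rightarrow> real" where "sol \<beta> = (SOME \<psi>. is_solution \<beta> \<psi>)"

lemma is_solution_sol:
  assumes "0 \<le> \<beta>" "\<beta> \<le> \<beta>1"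
  shows "is_solution \<beta> (sol \<beta>)"
  unfolding sol_def
proof (rule someI_ex[of "is_solution \<beta>"])
  show "\<exists>\<psi>. is_solution \<beta> \<psi>"
    unfolding is_solution_def
    by (rule singular_volterra_solution_exists[OF continuous_on_rhs rhs_lipschitz[OF assms] rhs_lip_nonneg])
qed

lemma le_supersolution:
  assumes "0 \<le> \<beta>" "\<beta> \<le> \<beta>1" "s \<in> {0..pi/2}"
    and "continuous_on {0..pi/2} \<eta>" "\<And>t. 0 < t \<Longrightarrow> t < pi/2 \<Longrightarrow> (\<eta> has_real_derivative \<eta>' t) (at t)"
    and "0 \<le> \<eta> 0" "\<And>t. 0 < t \<Longrightarrow> t < pi/2 \<Longrightarrow> rhs \<beta> t (\<eta> t) - real n * cot t * \<eta> t \<le> \<eta>' t"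
  shows "sol \<beta> s \<le> \<eta> s"
  using is_solution_sol[OF assms(1,2)] assms(3-) unfolding is_solution_def
  by (intro singular_comparison_super[where K = "rhs \<beta>" and M = rhs_lip and \<psi> = "sol \<beta>" and n = n
        and \<eta> = \<eta> and \<eta>' = \<eta>' and s = s] rhs_lipschitz[OF assms(1,2)]; blast)

lemma ge_subsolution:
  assumes "0 \<le> \<beta>" "\<beta> \<le> \<beta>1" "s \<in> {0..pi/2}"
    and "continuous_on {0..pi/2} \<eta>" "\<And>t. 0 < t \<Longrightarrow> t < pi/2 \<Longrightarrow> (\<eta> has_real_derivative \<eta>' t) (at t)"
    and "\<eta> 0 \<le> 0" "\<And>t. 0 < t \<Longrightarrow> t < pi/2 \<Longrightarrow> \<eta>' t \<le> rhs \<beta> t (\<eta> t) - real n * cot t * \<eta> t"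
  shows "\<eta> s \<le> sol \<beta> s"
  using is_solution_sol[OF assms(1,2)] assms(3-) unfolding is_solution_def
  by (intro singular_comparison_sub[where K = "rhs \<beta>" and M = rhs_lip and \<psi> = "sol \<beta>" and n = n
        and \<eta> = \<eta> and \<eta>' = \<eta>' and s = s] rhs_lipschitz[OF assms(1,2)]; blast)

lemma slope_0: "slope \<beta> 0 = (p - 1) * \<beta> + p - (real n + 2)"
  by (simp add: slope_def den_def)

lemma clip_0: "0 \<le> t \<Longrightarrow> clip t 0 = 0"
  using slope_max_ge(1) by (simp add: clip_def)

lemma rhs_0: "0 \<le> t \<Longrightarrow> rhs \<beta> t 0 = (p - 1) * \<beta> + p - (real n + 2)"
  by (simp add: rhs_def clip_0 rest_0 slope_0)

lemma rhs_clip_inactive: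
  assumes "0 \<le> x" "x \<le> slope_max * t" "x \<le> pi/2"
  shows "rhs \<beta> t x - real n * cot t * x = slope \<beta> x - real n * cot t * (sin x * cos x / den x)"
proof -
  have "clip t x = x" using assms by (simp add: clip_def)
  then show ?thesis by (simp add: rhs_def rest_def algebra_simps)
qed

lemma sol_nonneg:
  assumes "\<beta>0 \<le> \<beta>" "\<beta> \<le> \<beta>1" "s \<in> {0..pi/2}"
  shows "0 \<le> sol \<beta> s"
proof -
  have b: "0 \<le> \<beta>" using assms \<beta>0_nonneg by linarith
  show ?thesis
    using slope_0_nonneg[OF assms(1)]
    by (intro ge_subsolution[OF b assms(2,3), of "\<lambda>_. 0" "\<lambda>_. 0"]) (auto simp: rhs_0)
qed

text \<open>At x = \<open>slope_max * t\<close> the truncated remainder is at most x, so the two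
  cotangent terms sum to something nonpositive and only
  \<open>slope \<beta> x \<le> slope_max\<close> is left. This frees the solution from the linear
  part of the truncation.\<close>

lemma sol_le_linear:
  assumes "0 \<le> \<beta>" "\<beta> \<le> \<beta>1" "s \<in> {0..pi/2}"
  shows "sol \<beta> s \<le> slope_max * s"
proof (rule le_supersolution[OF assms, where \<eta>' = "\<lambda>_. slope_max"])
  show "continuous_on {0..pi/2} (\<lambda>s. slope_max * s)" by (intro continuous_intros)
  show "((\<lambda>s. slope_max * s) has_real_derivative slope_max) (at t)" for t
    by (auto intro!: derivative_eq_intros)
  fix t :: real assume t: "0 < t" "t < pi/2"
  have "rest (clip t (slope_max * t)) \<le> clip t (slope_max * t)"
    using clip_bounds by (intro rest_le) auto
  also have "\<dots> \<le> slope_max * t" using clip_bounds t by simp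
  finally have "real n * cot t * rest (clip t (slope_max * t)) \<le> real n * cot t * (slope_max * t)"
    using cot_nonneg[of t] t by (intro mult_left_mono) auto
  then show "rhs \<beta> t (slope_max * t) - real n * cot t * (slope_max * t) \<le> slope_max"
    using slope_le[OF assms(1,2), of "slope_max * t"] by (simp add: rhs_def)
qed simp

lemma solution_deriv:
  assumes S: "is_solution \<beta> \<psi>" and t: "0 < t" "t \<le> pi/2"
  shows "(\<psi> has_real_derivative rhs \<beta> t (\<psi> t) - real n * cot t * \<psi> t) (at t within {0..pi/2})"
proof -
  have st: "0 < sin t" using sin_pos_half t by simp
  have tI: "t \<in> {0..pi/2}" using t by auto
  have "((\<lambda>t. sin t ^ n * \<psi> t) has_real_derivative sin t ^ n * rhs \<beta> t (\<psi> t)) (at t within {0..pi/2})"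
    using S tI unfolding is_solution_def by blast
  moreover have "((\<lambda>t. sin t ^ n) has_real_derivative real n * cos t * sin t ^ (n - 1)) (at t within {0..pi/2})"
    by (rule DERIV_cong, (rule derivative_eq_intros refl)+) simp
  ultimately have "((\<lambda>t. sin t ^ n * \<psi> t / sin t ^ n) has_real_derivative
      (sin t ^ n * rhs \<beta> t (\<psi> t) * sin t ^ n - sin t ^ n * \<psi> t * (real n * cos t * sin t ^ (n - 1))) / (sin t ^ n * sin t ^ n))
      (at t within {0..pi/2})"
    using st by (intro DERIV_divide) auto
  moreover have "(sin t ^ n * rhs \<beta> t (\<psi> t) * sin t ^ n - sin t ^ n * \<psi> t * (real n * cos t * sin t ^ (n - 1))) / (sin t ^ n * sin t ^ n)
     = rhs \<beta> t (\<psi> t) - real n * cot t * \<psi> t"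
    using st by (cases n) (auto simp: cot_def field_simps)
  ultimately have "((\<lambda>t. sin t ^ n * \<psi> t / sin t ^ n) has_real_derivative rhs \<beta> t (\<psi> t) - real n * cot t * \<psi> t) (at t within {0..pi/2})"
    by simp
  then show ?thesis
  proof (rule has_field_derivative_transform_within[OF _ t(1) tI])
    fix x assume x: "x \<in> {0..pi/2}" "dist x t < t"
    then have "0 < sin x" by (intro sin_pos_half) (auto simp: dist_real_def)
    then show "sin x ^ n * \<psi> x / sin x ^ n = \<psi> x" by simp
  qed
qed

text \<open>The solution for \<gamma> plus d exp((\<open>rhs_lip\<close> + 1) t) is a supersolution
  for \<beta>: \<open>rhs_lip\<close> pays for the shift of the argument, the extra 1 for the change
  d of the right-hand side. Exchanging \<beta> and \<gamma> gives Lipschitz dependence.\<close>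

lemma sol_param_le:
  assumes \<beta>: "0 \<le> \<beta>" "\<beta> \<le> \<beta>1" and \<gamma>: "0 \<le> \<gamma>" "\<gamma> \<le> \<beta>1"
  shows "sol \<beta> (pi/2) \<le> sol \<gamma> (pi/2) + (p - 1) / den_min * \<bar>\<beta> - \<gamma>\<bar> * exp ((rhs_lip + 1) * (pi/2))"
proof -
  define d where "d = (p - 1) / den_min * \<bar>\<beta> - \<gamma>\<bar>"
  have d: "0 \<le> d" using p den_min_pos by (simp add: d_def)
  let ?e = "\<lambda>t. d * exp ((rhs_lip + 1) * t)"
  have S: "is_solution \<gamma> (sol \<gamma>)" using is_solution_sol[OF \<gamma>] .
  have "sol \<beta> (pi/2) \<le> sol \<gamma> (pi/2) + ?e (pi/2)"
  proof (rule le_supersolution[OF \<beta>, where \<eta>' = "\<lambda>t. rhs \<gamma> t (sol \<gamma> t) - real n * cot t * sol \<gamma> t + (rhs_lip + 1) * ?e t"])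
    show "pi/2 \<in> {0..pi/2}" by simp
    show "continuous_on {0..pi/2} (\<lambda>t. sol \<gamma> t + ?e t)"
      using S unfolding is_solution_def by (intro continuous_intros) auto
    show "0 \<le> sol \<gamma> 0 + ?e 0" using S d by (simp add: is_solution_def)
    fix t :: real assume t: "0 < t" "t < pi/2"
    have "(sol \<gamma> has_real_derivative rhs \<gamma> t (sol \<gamma> t) - real n * cot t * sol \<gamma> t) (at t)"
      using solution_deriv[OF S, of t] t at_within_Icc_at[OF t] by simp
    then show "((\<lambda>t. sol \<gamma> t + ?e t) has_real_derivative rhs \<gamma> t (sol \<gamma> t) - real n * cot t * sol \<gamma> t + (rhs_lip + 1) * ?e t) (at t)"
      by (auto intro!: derivative_eq_intros)
    have t': "t \<in> {0..pi/2}" using t by auto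
    have e0: "d \<le> ?e t" using d rhs_lip_nonneg t by (simp add: mult_le_cancel_left1)
    have "rhs \<beta> t (sol \<gamma> t + ?e t) \<le> rhs \<gamma> t (sol \<gamma> t + ?e t) + d"
      using slope_param[of \<beta> "sol \<gamma> t + ?e t" \<gamma>] by (simp add: rhs_def d_def abs_le_iff)
    moreover have "rhs \<gamma> t (sol \<gamma> t + ?e t) \<le> rhs \<gamma> t (sol \<gamma> t) + rhs_lip * ?e t"
      using rhs_lipschitz[OF \<gamma> t', of "sol \<gamma> t + ?e t" "sol \<gamma> t"] d by (simp add: abs_le_iff)
    moreover have "0 \<le> real n * cot t * ?e t" using cot_nonneg[of t] t d by simp
    ultimately have "rhs \<beta> t (sol \<gamma> t + ?e t) - real n * cot t * sol \<gamma> t - real n * cot t * ?e t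
        \<le> rhs \<gamma> t (sol \<gamma> t) - real n * cot t * sol \<gamma> t + rhs_lip * ?e t + ?e t"
      using e0 by linarith
    then show "rhs \<beta> t (sol \<gamma> t + ?e t) - real n * cot t * (sol \<gamma> t + ?e t)
        \<le> rhs \<gamma> t (sol \<gamma> t) - real n * cot t * sol \<gamma> t + (rhs_lip + 1) * ?e t"
      by (simp only: distrib_left distrib_right mult_1 diff_diff_add)
  qed
  then show ?thesis by (simp add: d_def)
qed

lemma continuous_on_sol_endpoint: "continuous_on {\<beta>0..\<beta>1} (\<lambda>\<beta>. sol \<beta> (pi/2))"
proof -
  define B where "B = (p - 1) / den_min * exp ((rhs_lip + 1) * (pi/2))"
  have B0: "0 \<le> B" using p den_min_pos by (simp add: B_def)
  have lip: "\<bar>sol \<beta> (pi/2) - sol \<gamma> (pi/2)\<bar> \<le> B * \<bar>\<beta> - \<gamma>\<bar>"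
    if "\<beta> \<in> {\<beta>0..\<beta>1}" "\<gamma> \<in> {\<beta>0..\<beta>1}" for \<beta> \<gamma>
    using sol_param_le[of \<beta> \<gamma>] sol_param_le[of \<gamma> \<beta>] that \<beta>0_nonneg
    by (simp add: B_def abs_le_iff abs_minus_commute mult_ac)
  have "B-lipschitz_on {\<beta>0..\<beta>1} (\<lambda>\<beta>. sol \<beta> (pi/2))"
    by (rule lipschitz_onI) (use lip B0 in \<open>auto simp: dist_real_def\<close>)
  then show ?thesis by (rule lipschitz_on_continuous_on)
qed

text \<open>For p \<le> N the slope at 0 vanishes and 0 is a supersolution. For p > N one has
  \<open>\<beta>0\<close> = 0 and, as \<open>den\<close> is at least 1 there, \<open>slope\<close>
  is at most (p - N)(cos x)^2, the derivative of arctan((p - N) t) at x = arctan((p - N) t).\<close>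

lemma sol_at_\<beta>0: "sol \<beta>0 (pi/2) < pi/2"
proof (cases "p \<le> real n + 2")
  case True
  then have "(p - 1) * \<beta>0 = real n + 2 - p" using p by (simp add: \<beta>0_def max_def divide_le_eq)
  then have "sol \<beta>0 (pi/2) \<le> 0"
    by (intro le_supersolution[OF \<beta>0_nonneg \<beta>1_ge(2), of "pi/2" "\<lambda>_. 0" "\<lambda>_. 0"]) (auto simp: rhs_0)
  then show ?thesis using pi_half_gt_zero by linarith
next
  case False
  define m where "m = p - (real n + 2)"
  have m: "0 < m" "m \<le> slope_max" using False slope_max_ge(2) by (auto simp: m_def)
  have p2: "p \<ge> 2" using False by simp
  have b0: "\<beta>0 = 0" using False p by (simp add: \<beta>0_def max_def divide_le_eq zero_le_divide_iff)
  have "sol \<beta>0 (pi/2) \<le> arctan (m * (pi/2))"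
  proof (rule le_supersolution[OF \<beta>0_nonneg \<beta>1_ge(2), where \<eta>' = "\<lambda>t. m * (cos (arctan (m * t)))\<^sup>2"])
    show "pi/2 \<in> {0..pi/2}" by simp
    show "continuous_on {0..pi/2} (\<lambda>t. arctan (m * t))" by (intro continuous_intros)
    show "0 \<le> arctan (m * 0)" by simp
    fix t :: real assume t: "0 < t" "t < pi/2"
    have "((\<lambda>t. arctan (m * t)) has_real_derivative m * inverse (1 + (m * t)\<^sup>2)) (at t)"
      by (rule DERIV_cong, (rule derivative_eq_intros refl)+) simp
    then show "((\<lambda>t. arctan (m * t)) has_real_derivative m * (cos (arctan (m * t)))\<^sup>2) (at t)"
      by (simp add: cos_arctan power_divide add_nonneg_nonneg inverse_eq_divide)
    let ?x = "arctan (m * t)"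
    have x: "0 \<le> ?x" "?x \<le> pi/2" using m t arctan_bounded[of "m * t"] by (auto simp: less_imp_le)
    have "?x \<le> m * t" using m t by (intro arctan_le_self) simp
    then have xs: "?x \<le> slope_max * t" using m t mult_right_mono[of m slope_max t] by linarith
    have "1 \<le> den ?x"
    proof -
      have "1 * (sin ?x)\<^sup>2 \<le> (p - 1) * (sin ?x)\<^sup>2" using p2 by (intro mult_right_mono) auto
      then show ?thesis unfolding den_def using sin_cos_squared_add[of ?x] by linarith
    qed
    then have "slope \<beta>0 ?x \<le> m * (cos ?x)\<^sup>2"
      unfolding slope_def b0 m_def[symmetric] using m
      by (simp add: divide_le_eq)
    moreover have "0 \<le> real n * cot t * (sin ?x * cos ?x / den ?x)"
    proof -
      have "0 \<le> sin ?x" "0 \<le> cos ?x" using x by (auto intro!: sin_ge_zero cos_ge_zero simp del: zero_le_arctan_iff)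
      then show ?thesis using cot_nonneg[of t] t den_pos[of ?x] by (simp add: less_imp_le)
    qed
    ultimately show "rhs \<beta>0 t ?x - real n * cot t * ?x \<le> m * (cos ?x)\<^sup>2"
      unfolding rhs_clip_inactive[OF x(1) xs x(2)] by linarith
  qed
  also have "\<dots> < pi/2" by (rule arctan_ubound)
  finally show ?thesis .
qed

text \<open>At \<psi> = t the cotangent term is n (cos t)^2 / \<open>den t\<close>. Splitting
  (p-1)\<open>\<beta>1\<close> along sin^2 + cos^2 = 1, the sine part uses \<open>\<beta>1\<close>
  \<ge> 1 and the cosine part the last bound in \<open>\<beta>1_ge\<close>.\<close>

lemma sol_at_\<beta>1: "pi/2 \<le> sol \<beta>1 (pi/2)"
proof (rule ge_subsolution[where \<eta> = "\<lambda>t. t" and \<eta>' = "\<lambda>_. 1"])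
  show "0 \<le> \<beta>1" using \<beta>1_ge(1) by simp
  fix t :: real assume t: "0 < t" "t < pi/2"
  have ts: "t \<le> slope_max * t" using slope_max_ge(1) t by (simp add: mult_le_cancel_right1)
  have "den t \<le> (p - 1) * \<beta>1 + (p - (real n + 2)) * (cos t)\<^sup>2 - real n * (cos t)\<^sup>2"
  proof -
    have "(p - 1) * (sin t)\<^sup>2 \<le> ((p - 1) * \<beta>1) * (sin t)\<^sup>2"
      using p \<beta>1_ge(1) by (intro mult_right_mono) auto
    moreover have "(2 * (real n + 2) - 1 - p) * (cos t)\<^sup>2 \<le> ((p - 1) * \<beta>1) * (cos t)\<^sup>2"
      using \<beta>1_ge(3) by (intro mult_right_mono) auto
    moreover have "((p - 1) * \<beta>1) * (sin t)\<^sup>2 + ((p - 1) * \<beta>1) * (cos t)\<^sup>2 = (p - 1) * \<beta>1"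
      by (simp add: distrib_left[symmetric])
    ultimately have "(p - 1) * (sin t)\<^sup>2 + (2 * (real n + 2) - 1 - p) * (cos t)\<^sup>2 \<le> (p - 1) * \<beta>1"
      by linarith
    then show ?thesis unfolding den_def by (simp add: algebra_simps)
  qed
  then have "1 \<le> ((p - 1) * \<beta>1 + (p - (real n + 2)) * (cos t)\<^sup>2 - real n * (cos t)\<^sup>2) / den t"
    using den_pos[of t] by simp
  also have "\<dots> = slope \<beta>1 t - real n * cot t * (sin t * cos t / den t)"
    using sin_pos_half[of t] t by (simp add: slope_def cot_def diff_divide_distrib power2_eq_square)
  also have "\<dots> = rhs \<beta>1 t t - real n * cot t * t"
    using rhs_clip_inactive[of t t \<beta>1] ts t by simp
  finally show "1 \<le> rhs \<beta>1 t t - real n * cot t * t" .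
qed auto

text \<open>Strictness at \<open>\<beta>0\<close> excludes \<beta> = \<open>\<beta>0\<close>; this
  later makes both \<beta> and the slope at 0 positive.\<close>

lemma exists_shooting_parameter:
  obtains \<beta> where "\<beta>0 < \<beta>" "\<beta> \<le> \<beta>1" "sol \<beta> (pi/2) = pi/2"
proof -
  obtain \<beta> where b: "\<beta>0 \<le> \<beta>" "\<beta> \<le> \<beta>1" "sol \<beta> (pi/2) = pi/2"
    using IVT'[of "\<lambda>\<beta>. sol \<beta> (pi/2)" \<beta>0 "pi/2" \<beta>1] sol_at_\<beta>0 sol_at_\<beta>1 \<beta>1_ge(2) continuous_on_sol_endpoint
    by (metis less_imp_le)
  have "\<beta> \<noteq> \<beta>0" using sol_at_\<beta>0 b(3) by auto
  then have "\<beta>0 < \<beta>" using b(1) by simp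
  then show ?thesis by (rule that[OF _ b(2,3)])
qed


section \<open>The solution that reaches pi/2 at the end point\<close>

lemma slope_half_pi: "slope \<beta> (pi/2) = \<beta>"
  using p by (simp add: slope_def den_def)

context
  fixes \<beta> :: real
  assumes \<beta>: "\<beta>0 < \<beta>" "\<beta> \<le> \<beta>1" and hit: "sol \<beta> (pi/2) = pi/2"
begin

lemma \<beta>_pos: "0 < \<beta>" using \<beta> \<beta>0_nonneg by linarith

lemma sol_solution: "is_solution \<beta> (sol \<beta>)"
  using is_solution_sol \<beta> \<beta>_pos by simp

lemma sol_cont: "continuous_on {0..pi/2} (sol \<beta>)" and sol_0: "sol \<beta> 0 = 0"
  using sol_solution by (auto simp: is_solution_def)

lemma sol_bounds: "t \<in> {0..pi/2} \<Longrightarrow> 0 \<le> sol \<beta> t" "t \<in> {0..pi/2} \<Longrightarrow> sol \<beta> t \<le> slope_max * t"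
  using sol_nonneg[of \<beta> t] sol_le_linear[of \<beta> t] \<beta> \<beta>_pos by auto

text \<open>At height pi/2 the cosine kills the cotangent term, so the level is crossed with slope
  \<beta> > 0, hence only upwards.\<close>

lemma sol_deriv_at_half_pi:
  assumes t: "0 < t" "t \<le> pi/2" and e: "sol \<beta> t = pi/2"
  shows "(sol \<beta> has_real_derivative \<beta>) (at t within {0..pi/2})"
proof -
  have "pi/2 \<le> slope_max * t" using sol_bounds(2)[of t] e t by simp
  then have "rhs \<beta> t (pi/2) - real n * cot t * (pi/2) = \<beta>"
    using rhs_clip_inactive[of "pi/2" t \<beta>] by (simp add: slope_half_pi)
  then show ?thesis using solution_deriv[OF sol_solution t] e by simp
qed

text \<open>Reaching pi/2 early would put the solution strictly above that level, and upward
  crossings alone cannot bring it back to pi/2 at the end. Consequently the truncation is inactive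
  and cos of the solution is positive before pi/2.\<close>

lemma sol_less_half_pi:
  assumes s: "0 \<le> s" "s < pi/2"
  shows "sol \<beta> s < pi/2"
proof (rule ccontr)
  assume "\<not> sol \<beta> s < pi/2"
  then have ge: "pi/2 \<le> sol \<beta> s" by simp
  then have s0: "0 < s" using s sol_0 pi_half_gt_zero by (cases "s = 0") auto
  have "\<exists>a. 0 < a \<and> a < pi/2 \<and> pi/2 < sol \<beta> a"
  proof (cases "sol \<beta> s = pi/2")
    case True
    obtain d where d: "0 < d" "\<And>h. 0 < h \<Longrightarrow> s + h \<in> {0..pi/2} \<Longrightarrow> h < d \<Longrightarrow> sol \<beta> s < sol \<beta> (s + h)"
      using has_real_derivative_pos_inc_right[OF sol_deriv_at_half_pi[OF s0 _ True] \<beta>_pos] s by auto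
    define h where "h = min (d/2) ((pi/2 - s)/2)"
    have h: "0 < h" "h < d" "s + h < pi/2"
      unfolding h_def using d(1) s by (auto simp: min_def field_simps)
    then have "sol \<beta> s < sol \<beta> (s + h)" using s0 by (intro d(2)) auto
    then show ?thesis using True h s0 by (intro exI[of _ "s + h"]) auto
  next
    case False
    then show ?thesis using ge s0 s by (intro exI[of _ s]) auto
  qed
  then obtain a where a: "0 < a" "a < pi/2" "pi/2 < sol \<beta> a" by blast
  have "0 < sol \<beta> (pi/2) - pi/2"
  proof (rule pos_preserved_if_zeros_increasing[where a = a and b = "pi/2" and g = "\<lambda>t. sol \<beta> t - pi/2" and g' = "\<lambda>_. \<beta>"])
    show "continuous_on {a..pi/2} (\<lambda>t. sol \<beta> t - pi/2)"
      using a by (intro continuous_intros continuous_on_subset[OF sol_cont]) auto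
    fix t assume t: "a < t" "t \<le> pi/2" "sol \<beta> t - pi/2 = 0"
    have "(sol \<beta> has_real_derivative \<beta>) (at t within {0..pi/2})"
      using t a by (intro sol_deriv_at_half_pi) auto
    then have "(sol \<beta> has_real_derivative \<beta>) (at t within {a..pi/2})"
      by (rule DERIV_subset) (use a in auto)
    then show "((\<lambda>t. sol \<beta> t - pi/2) has_real_derivative \<beta>) (at t within {a..pi/2})"
      by (auto intro!: derivative_eq_intros)
  qed (use a \<beta>_pos in auto)
  then show False using hit by simp
qed

lemma slope_0_pos: "0 < slope \<beta> 0"
proof -
  have "(p - 1) * \<beta>0 < (p - 1) * \<beta>" using \<beta>(1) p by simp
  then show ?thesis using slope_0_nonneg[of \<beta>0] by (simp add: slope_0)
qed

text \<open>At an interior zero the derivative would be \<open>slope \<beta> 0\<close> > 0, making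
  the solution negative just before.\<close>

lemma sol_pos:
  assumes t: "0 < t" "t < pi/2"
  shows "0 < sol \<beta> t"
proof (rule ccontr)
  assume "\<not> 0 < sol \<beta> t"
  then have z: "sol \<beta> t = 0" using sol_bounds(1)[of t] t by auto
  have "(sol \<beta> has_real_derivative slope \<beta> 0) (at t within {0..pi/2})"
    using solution_deriv[OF sol_solution, of t] t z by (simp add: rhs_0 slope_0)
  then obtain d where d: "0 < d" "\<And>h. 0 < h \<Longrightarrow> t - h \<in> {0..pi/2} \<Longrightarrow> h < d \<Longrightarrow> sol \<beta> (t - h) < sol \<beta> t"
    using has_real_derivative_pos_inc_left slope_0_pos by blast
  define h where "h = min (d/2) (t/2)"
  have h: "0 < h" "h < d" "t - h \<in> {0..pi/2}" using d(1) t by (auto simp: h_def min_def)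
  then have "sol \<beta> (t - h) < 0" using d(2) z by simp
  then show False using sol_bounds(1)[OF h(3)] by simp
qed

text \<open>The value at 0 solves y + n y = \<open>slope \<beta> 0\<close>, the limit of the
  equation as cot t \<psi>(t) tends to \<psi>'(0).\<close>

definition sol' :: "real \<Rightarrow> real" where
  "sol' t = (if t = 0 then slope \<beta> 0 / (real n + 1) else rhs \<beta> t (sol \<beta> t) - real n * cot t * sol \<beta> t)"

text \<open>L'Hopital's rule is applied after expansion by \<open>sin t ^ n\<close>: the numerator
  \<open>sin t ^ n * sol \<beta> t\<close> has a derivative free of the singular term.\<close>

lemma sol_over_sin_tendsto: "((\<lambda>t. sol \<beta> t / sin t) \<longlongrightarrow> slope \<beta> 0 / (real n + 1)) (at_right 0)"
proof -
  have w: "at 0 within {0..pi/2} = at_right (0::real)" by (intro at_within_Icc_at_right) simp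
  have ev: "\<forall>\<^sub>F t in at_right 0. 0 < t \<and> t < pi/2"
    using eventually_at_right_real[of 0 "pi/2", simplified] by eventually_elim auto
  have psi: "(sol \<beta> \<longlongrightarrow> 0) (at_right 0)"
    using sol_cont sol_0 unfolding continuous_on_def w[symmetric] by force
  have "((\<lambda>t. rhs \<beta> t (sol \<beta> t)) \<longlongrightarrow> rhs \<beta> 0 (sol \<beta> 0)) (at_right 0)"
    using continuous_on_rhs[OF sol_cont, of \<beta>] unfolding continuous_on_def w[symmetric] by (elim ballE) auto
  then have r: "((\<lambda>t. rhs \<beta> t (sol \<beta> t)) \<longlongrightarrow> slope \<beta> 0) (at_right 0)"
    by (simp add: sol_0 rhs_0 slope_0)
  have "((\<lambda>t. (sin t ^ n * sol \<beta> t) / sin t ^ Suc n) \<longlongrightarrow> slope \<beta> 0 / (real n + 1)) (at_right 0)"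
  proof (rule lhopital_right_0)
    have "((\<lambda>t. sin t ^ n * sol \<beta> t) \<longlongrightarrow> sin 0 ^ n * 0) (at_right 0)" by (intro tendsto_intros psi)
    then show "((\<lambda>t. sin t ^ n * sol \<beta> t) \<longlongrightarrow> 0) (at_right 0)" by simp
    have "((\<lambda>t::real. sin t ^ Suc n) \<longlongrightarrow> sin 0 ^ Suc n) (at_right 0)" by (intro tendsto_intros)
    then show "((\<lambda>t::real. sin t ^ Suc n) \<longlongrightarrow> 0) (at_right 0)" by simp
    show "\<forall>\<^sub>F t in at_right 0. sin t ^ Suc n \<noteq> (0::real)"
      using ev by eventually_elim (use sin_pos_half in fastforce)
    show "\<forall>\<^sub>F t in at_right 0. (real n + 1) * sin t ^ n * cos t \<noteq> (0::real)"
      using ev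
    proof eventually_elim
      case (elim t)
      have "0 < sin t" "0 < cos t" using elim by (auto intro: sin_pos_half cos_gt_zero)
      then show ?case by simp
    qed
    show "\<forall>\<^sub>F t in at_right 0. ((\<lambda>t. sin t ^ n * sol \<beta> t) has_real_derivative sin t ^ n * rhs \<beta> t (sol \<beta> t)) (at t)"
      using ev
    proof eventually_elim
      case (elim t)
      then have t: "0 < t" "t < pi/2" "t \<in> {0..pi/2}" by auto
      then have "((\<lambda>t. sin t ^ n * sol \<beta> t) has_real_derivative sin t ^ n * rhs \<beta> t (sol \<beta> t)) (at t within {0..pi/2})"
        using sol_solution unfolding is_solution_def by blast
      then show ?case using at_within_Icc_at[OF t(1,2)] by simp
    qed
    show "\<forall>\<^sub>F t in at_right 0. ((\<lambda>t. sin t ^ Suc n) has_real_derivative (real n + 1) * sin t ^ n * cos t) (at t)"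
      by (rule always_eventually) (auto intro!: derivative_eq_intros simp del: power_Suc)
    have "((\<lambda>t. rhs \<beta> t (sol \<beta> t) / ((real n + 1) * cos t)) \<longlongrightarrow> slope \<beta> 0 / ((real n + 1) * cos 0)) (at_right 0)"
      by (intro tendsto_intros r) auto
    moreover have "\<forall>\<^sub>F t in at_right 0. rhs \<beta> t (sol \<beta> t) / ((real n + 1) * cos t) =
       sin t ^ n * rhs \<beta> t (sol \<beta> t) / ((real n + 1) * sin t ^ n * cos t)"
      using ev
    proof eventually_elim
      case (elim t)
      have "0 < sin t" using elim by (auto intro: sin_pos_half)
      then show ?case by simp
    qed
    ultimately show "((\<lambda>t. sin t ^ n * rhs \<beta> t (sol \<beta> t) / ((real n + 1) * sin t ^ n * cos t)) \<longlongrightarrow> slope \<beta> 0 / (real n + 1)) (at_right 0)"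
      by (auto intro: Lim_transform_eventually)
  qed
  moreover have "\<forall>\<^sub>F t in at_right 0. (sin t ^ n * sol \<beta> t) / sin t ^ Suc n = sol \<beta> t / sin t"
    using ev
  proof eventually_elim
    case (elim t)
    have "0 < sin t" using elim by (auto intro: sin_pos_half)
    then show ?case by simp
  qed
  ultimately show ?thesis by (rule Lim_transform_eventually)
qed

lemma sol_has_deriv:
  assumes t: "t \<in> {0..pi/2}"
  shows "(sol \<beta> has_real_derivative sol' t) (at t within {0..pi/2})"
proof (cases "t = 0")
  case True
  have w: "at 0 within {0..pi/2} = at_right (0::real)" by (intro at_within_Icc_at_right) simp
  have "((\<lambda>t. (sin t - sin 0) / (t - 0)) \<longlongrightarrow> cos 0) (at_right (0::real))"
    using DERIV_sin[of "0::real"] unfolding has_field_derivative_iff by (auto intro: filterlim_mono[OF _ order_refl at_le])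
  then have "((\<lambda>t. sol \<beta> t / sin t * (sin t / t)) \<longlongrightarrow> slope \<beta> 0 / (real n + 1) * 1) (at_right 0)"
    by (intro tendsto_mult sol_over_sin_tendsto) simp
  moreover have "\<forall>\<^sub>F t in at_right 0. sol \<beta> t / sin t * (sin t / t) = (sol \<beta> t - sol \<beta> 0) / (t - 0)"
    using eventually_at_right_real[of 0 "pi/2", simplified]
  proof eventually_elim
    case (elim t)
    have "0 < sin t" using elim by (auto intro: sin_pos_half)
    then show ?case by (simp add: sol_0)
  qed
  ultimately have "((\<lambda>t. (sol \<beta> t - sol \<beta> 0) / (t - 0)) \<longlongrightarrow> slope \<beta> 0 / (real n + 1) * 1) (at_right 0)"
    by (rule Lim_transform_eventually)
  then show ?thesis using True by (simp add: has_field_derivative_iff w sol'_def)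
next
  case False
  then show ?thesis using solution_deriv[OF sol_solution, of t] t by (simp add: sol'_def)
qed

lemma continuous_on_sol': "continuous_on {0..pi/2} sol'"
proof -
  have w: "at 0 within {0..pi/2} = at_right (0::real)" by (intro at_within_Icc_at_right) simp
  have r: "((\<lambda>t. rhs \<beta> t (sol \<beta> t)) \<longlongrightarrow> rhs \<beta> s (sol \<beta> s)) (at s within {0..pi/2})" if "s \<in> {0..pi/2}" for s
    using continuous_on_rhs[OF sol_cont, of \<beta>] that unfolding continuous_on_def by blast
  have "(sol' \<longlongrightarrow> sol' s) (at s within {0..pi/2})" if s: "s \<in> {0..pi/2}" for s
  proof (cases "s = 0")
    case True
    have "((\<lambda>t. rhs \<beta> t (sol \<beta> t) - real n * (cos t * (sol \<beta> t / sin t))) \<longlongrightarrow>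
       rhs \<beta> 0 (sol \<beta> 0) - real n * (cos 0 * (slope \<beta> 0 / (real n + 1)))) (at_right 0)"
      using r[of 0] unfolding w by (intro tendsto_intros sol_over_sin_tendsto) simp
    moreover have "rhs \<beta> 0 (sol \<beta> 0) - real n * (cos 0 * (slope \<beta> 0 / (real n + 1))) = sol' 0"
    proof -
      have "rhs \<beta> 0 (sol \<beta> 0) = slope \<beta> 0" by (simp add: sol_0 rhs_0 slope_0)
      then show ?thesis by (simp add: sol'_def field_simps)
    qed
    moreover have "\<forall>\<^sub>F t in at_right 0. rhs \<beta> t (sol \<beta> t) - real n * (cos t * (sol \<beta> t / sin t)) = sol' t"
      using eventually_at_right_less[of "0::real"] by eventually_elim (simp add: sol'_def cot_def)
    ultimately have "(sol' \<longlongrightarrow> sol' 0) (at_right 0)"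
      by (auto intro: Lim_transform_eventually)
    then show ?thesis using True by (simp add: w)
  next
    case False
    with s have s0: "0 < s" "s \<le> pi/2" by auto
    have "sin s \<noteq> 0" using sin_pos_half[OF s0] by simp
    moreover have "(sol \<beta> \<longlongrightarrow> sol \<beta> s) (at s within {0..pi/2})" using sol_cont s by (simp add: continuous_on_def)
    ultimately have "((\<lambda>t. rhs \<beta> t (sol \<beta> t) - real n * cot t * sol \<beta> t) \<longlongrightarrow> rhs \<beta> s (sol \<beta> s) - real n * cot s * sol \<beta> s) (at s within {0..pi/2})"
      unfolding cot_def by (intro tendsto_intros r[OF s])
    moreover have "\<forall>\<^sub>F t in at s within {0..pi/2}. rhs \<beta> t (sol \<beta> t) - real n * cot t * sol \<beta> t = sol' t"
    proof -
      have "\<forall>\<^sub>F t in at s within {0..pi/2}. t \<in> {0<..}"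
        using s0 by (intro eventually_at_in_open'[THEN filter_leD[OF at_le, rotated]]) auto
      then show ?thesis by eventually_elim (simp add: sol'_def)
    qed
    ultimately have "(sol' \<longlongrightarrow> rhs \<beta> s (sol \<beta> s) - real n * cot s * sol \<beta> s) (at s within {0..pi/2})"
      by (rule Lim_transform_eventually)
    then show ?thesis using False by (simp add: sol'_def)
  qed
  then show ?thesis by (simp add: continuous_on_def)
qed

lemma den_times_sol':
  assumes t: "0 < t" "t \<le> pi/2"
  shows "den (sol \<beta> t) * sol' t = (p - 1) * \<beta> + (p - (real n + 2)) * (cos (sol \<beta> t))\<^sup>2 - real n * cot t * sin (sol \<beta> t) * cos (sol \<beta> t)"
proof -
  have tI: "t \<in> {0..pi/2}" using t by auto
  have "sol \<beta> t \<le> pi/2"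
  proof (cases "t = pi/2")
    case True
    show ?thesis unfolding True hit by simp
  next
    case False
    then show ?thesis using t by (intro less_imp_le sol_less_half_pi) auto
  qed
  then have e: "sol' t = slope \<beta> (sol \<beta> t) - real n * cot t * (sin (sol \<beta> t) * cos (sol \<beta> t) / den (sol \<beta> t))"
    using rhs_clip_inactive[of "sol \<beta> t" t \<beta>] sol_bounds[OF tI] t by (simp add: sol'_def)
  have g: "d * (a / d - b * (c / d)) = a - b * c" if "d \<noteq> 0" for a b c d :: real
    using that by (simp add: right_diff_distrib)
  have nz: "den (sol \<beta> t) \<noteq> 0" using den_pos[of "sol \<beta> t"] by simp
  show ?thesis unfolding e slope_def g[OF nz] by (simp only: mult.assoc)
qed

section \<open>Recovering the angular factor from the Pruefer angle\<close>

text \<open>The logarithmic derivative R'/R. Requiring (R cos \<psi>)' = -\<beta> R sin \<psi> gives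
  (\<psi>' - \<beta>) tan \<psi>; in \<psi>' - \<beta> a factor cos \<psi> splits off and cancels,
  which leaves this formula, regular also at pi/2.\<close>

definition amp_rate :: "real \<Rightarrow> real" where
  "amp_rate t = (((p - 2) * \<beta> + p - (real n + 2)) * cos (sol \<beta> t) * sin (sol \<beta> t) - real n * (cot t * (sin (sol \<beta> t))\<^sup>2)) / den (sol \<beta> t)"

lemma continuous_on_amp_rate: "continuous_on {0..pi/2} amp_rate"
proof -
  have "\<bar>(sin (sol \<beta> t))\<^sup>2\<bar> \<le> slope_max\<^sup>2 * t\<^sup>2" if t: "t \<in> {0..pi/2}" for t
  proof -
    have "\<bar>sin (sol \<beta> t)\<bar> \<le> slope_max * t"
      using abs_sin_x_le_abs_x[of "sol \<beta> t"] sol_bounds[OF t] by linarith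
    then have "(\<bar>sin (sol \<beta> t)\<bar>)\<^sup>2 \<le> (slope_max * t)\<^sup>2" by (intro power_mono) auto
    then show ?thesis by (simp add: power_mult_distrib)
  qed
  then have c1: "continuous_on {0..pi/2} (\<lambda>t. cot t * (sin (sol \<beta> t))\<^sup>2)"
    by (intro continuous_on_cot_times[where B = "slope_max\<^sup>2"] continuous_intros sol_cont)
  have c2: "continuous_on {0..pi/2} (\<lambda>t. den (sol \<beta> t))"
    unfolding den_def by (intro continuous_intros sol_cont)
  have "den (sol \<beta> t) \<noteq> 0" for t using den_pos[of "sol \<beta> t"] by simp
  then show ?thesis
    unfolding amp_rate_def[abs_def]
    by (intro continuous_on_divide[OF _ c2] continuous_on_diff continuous_on_mult continuous_on_const
        continuous_on_cos continuous_on_sin sol_cont c1) blast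
qed

lemma den_times_amp_rate:
  "den (sol \<beta> t) * amp_rate t = ((p - 2) * \<beta> + p - (real n + 2)) * cos (sol \<beta> t) * sin (sol \<beta> t) - real n * (cot t * (sin (sol \<beta> t))\<^sup>2)"
  using den_pos[of "sol \<beta> t"] by (simp add: amp_rate_def)

lemma amp_rate_identity:
  assumes t: "t \<in> {0..pi/2}"
  shows "amp_rate t * cos (sol \<beta> t) - sin (sol \<beta> t) * sol' t = - \<beta> * sin (sol \<beta> t)"
proof (cases "t = 0")
  case True
  then show ?thesis by (simp add: amp_rate_def sol_0)
next
  case False
  then have t': "0 < t" "t \<le> pi/2" using t by auto
  define s c where "s = sin (sol \<beta> t)" and "c = cos (sol \<beta> t)"
  have sc: "den (sol \<beta> t) = c\<^sup>2 + (p - 1) * s\<^sup>2" "s\<^sup>2 = 1 - c\<^sup>2"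
    by (simp_all add: den_def s_def c_def sin_squared_eq)
  have "den (sol \<beta> t) * (amp_rate t * c - s * sol' t) = (den (sol \<beta> t) * amp_rate t) * c - s * (den (sol \<beta> t) * sol' t)"
    by (simp add: algebra_simps)
  also have "\<dots> = - \<beta> * s * ((p - 1) * (s\<^sup>2 + c\<^sup>2) - (p - 2) * c\<^sup>2) + (p - 1) * \<beta> * s * (s\<^sup>2 + c\<^sup>2 - 1)"
    unfolding den_times_amp_rate den_times_sol'[OF t'] s_def[symmetric] c_def[symmetric] by algebra
  also have "\<dots> = den (sol \<beta> t) * (- \<beta> * s)"
  proof -
    have z: "s\<^sup>2 + c\<^sup>2 - 1 = 0" using sc(2) by simp
    show ?thesis unfolding sc(1) z by (simp add: algebra_simps)
  qed
  finally show ?thesis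
    using den_pos[of "sol \<beta> t"] unfolding s_def c_def by (metis less_irrefl mult_left_cancel)
qed

text \<open>Setting R = exp of the integral of \<open>amp_rate\<close> makes f = R cos \<psi> and f'
  = -\<beta> R sin \<psi> compatible. Since \<open>amp_rate\<close> and \<open>sol'\<close> are
  continuous up to both ends, f is C^2 on the closed interval.\<close>

lemma angular_solution_from_shooting:
  obtains f f' f'' where
    "\<And>t. t \<in> {0..pi/2} \<Longrightarrow> (f has_real_derivative f' t) (at t within {0..pi/2})"
    "\<And>t. t \<in> {0..pi/2} \<Longrightarrow> (f' has_real_derivative f'' t) (at t within {0..pi/2})"
    "continuous_on {0..pi/2} f''" "\<And>t. 0 \<le> t \<Longrightarrow> t < pi/2 \<Longrightarrow> 0 < f t"
    "f 0 = 1" "f' 0 = 0" "f (pi/2) = 0" "f' (pi/2) < 0" "\<And>t. 0 < t \<Longrightarrow> t < pi/2 \<Longrightarrow> f' t < 0"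
    "\<And>t. 0 < t \<Longrightarrow> t < pi/2 \<Longrightarrow> angular_ode p (real n + 2) (- \<beta>) t (f t) (f' t) (f'' t) = 0"
proof
  define R where "R t = exp (integral {0..t} amp_rate)" for t
  have R0: "0 < R t" for t by (simp add: R_def)
  define f where "f t = R t * cos (sol \<beta> t)" for t
  define f' where "f' t = - \<beta> * (R t * sin (sol \<beta> t))" for t
  define f'' where "f'' t = - \<beta> * (R t * (amp_rate t * sin (sol \<beta> t) + cos (sol \<beta> t) * sol' t))" for t
  have dR: "(R has_real_derivative R t * amp_rate t) (at t within {0..pi/2})" if t: "t \<in> {0..pi/2}" for t
  proof -
    have "((\<lambda>x. integral {0..x} amp_rate) has_real_derivative amp_rate t) (at t within {0..pi/2})"
      using continuous_on_amp_rate t by (rule integral_has_real_derivative)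
    then show ?thesis unfolding R_def by (rule DERIV_chain2[OF DERIV_exp])
  qed
  show "(f has_real_derivative f' t) (at t within {0..pi/2})" if t: "t \<in> {0..pi/2}" for t
  proof -
    have "(f has_real_derivative R t * (amp_rate t * cos (sol \<beta> t) - sin (sol \<beta> t) * sol' t)) (at t within {0..pi/2})"
      unfolding f_def by (rule DERIV_cong, (rule derivative_eq_intros dR[OF t] sol_has_deriv[OF t] refl)+) (simp add: algebra_simps)
    then show ?thesis unfolding amp_rate_identity[OF t] by (simp add: f'_def mult_ac)
  qed
  show "(f' has_real_derivative f'' t) (at t within {0..pi/2})" if t: "t \<in> {0..pi/2}" for t
    unfolding f'_def f''_def
    by (rule DERIV_cong, (rule derivative_eq_intros dR[OF t] sol_has_deriv[OF t] refl)+) (simp add: algebra_simps)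
  have "continuous_on {0..pi/2} R" using dR by (rule DERIV_continuous_on)
  then show "continuous_on {0..pi/2} f''"
    unfolding f''_def by (intro continuous_intros continuous_on_amp_rate continuous_on_sol' sol_cont)
  show "0 < f t" if "0 \<le> t" "t < pi/2" for t
  proof -
    have "t \<in> {0..pi/2}" using that by auto
    then have "0 < cos (sol \<beta> t)"
      using sol_bounds(1)[of t] sol_less_half_pi[OF that] by (intro cos_gt_zero_pi) auto
    then show ?thesis using R0 by (simp add: f_def)
  qed
  show "f 0 = 1" "f' 0 = 0" by (simp_all add: f_def f'_def R_def sol_0)
  show "f (pi/2) = 0" "f' (pi/2) < 0" using R0[of "pi/2"] \<beta>_pos by (simp_all add: f_def f'_def hit)
  show "f' t < 0" if "0 < t" "t < pi/2" for t
  proof -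
    have "0 < sin (sol \<beta> t)" using sol_pos[OF that] sol_less_half_pi[of t] that by (intro sin_pos_half) auto
    then show ?thesis using R0[of t] \<beta>_pos by (simp add: f'_def mult_pos_pos)
  qed
  show "angular_ode p (real n + 2) (- \<beta>) t (f t) (f' t) (f'' t) = 0" if "0 < t" "t < pi/2" for t
  proof -
    define s c where "s = sin (sol \<beta> t)" and "c = cos (sol \<beta> t)"
    have s2: "s\<^sup>2 = 1 - c\<^sup>2" by (simp add: s_def c_def sin_squared_eq)
    have D: "den (sol \<beta> t) = (p - 1) * s\<^sup>2 + c\<^sup>2" by (simp add: den_def s_def c_def)
    \<comment> \<open>Multiplication by \<open>den\<close> turns f'' into a polynomial in s, c and
      the cotangent, because \<open>den\<close> clears the denominators of \<open>amp_rate\<close>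
      and \<open>sol'\<close>.\<close>
    define X where "X = den (sol \<beta> t) * (amp_rate t * s + c * sol' t)"
    have X: "X = (((p - 2) * \<beta> + p - (real n + 2)) * c * s - real n * (cot t * s\<^sup>2)) * s
       + c * ((p - 1) * \<beta> + (p - (real n + 2)) * c\<^sup>2 - real n * cot t * s * c)"
      unfolding X_def distrib_left
      using den_times_amp_rate[of t] den_times_sol'[of t] that unfolding s_def[symmetric] c_def[symmetric]
      by (simp add: mult.assoc[symmetric] mult.commute[of _ c])
    have ft: "f t = R t * c" "f' t = - \<beta> * (R t * s)" "f'' t = - \<beta> * (R t * (amp_rate t * s + c * sol' t))"
      by (simp_all add: f_def f'_def f''_def s_def c_def)
    have "angular_ode p (real n + 2) (- \<beta>) t (f t) (f' t) (f'' t) =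
       \<beta>^3 * R t ^ 3 * (- X + (p - 2) * \<beta> * c * s\<^sup>2
         - real n * cot t * s * (c\<^sup>2 + s\<^sup>2) + ((p - 1) * \<beta> - (real n + 2) + p) * c * (c\<^sup>2 + s\<^sup>2))"
      unfolding angular_ode_def ft X_def D by algebra
    \<comment> \<open>With s and c treated as independent variables the equation holds up to a
      multiple of s^2 + c^2 - 1.\<close>
    also have "\<dots> = \<beta>^3 * R t ^ 3 * ((s\<^sup>2 + c\<^sup>2 - 1) * ((p - 1) * \<beta> * c))"
      unfolding X by algebra
    also have "\<dots> = 0" unfolding s2 by simp
    finally show ?thesis .
  qed
qed

end

end

section \<open>Translation to the half space and conclusion\<close>

lemma half_space_eq: "half_space i = {x. 0 < x \<bullet> axis i 1}"
  by (simp add: half_space_def inner_axis)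

lemma quasiradial_eq: "quasiradial i k f = (\<lambda>x. norm x powr k * f (angle_to (axis i 1) x))"
  by (simp add: fun_eq_iff quasiradial_def polar_angle_def angle_to_def inner_axis)

lemma deriv_unique_within_Icc:
  fixes f :: "real \<Rightarrow> real"
  assumes "a < b" "x \<in> {a..b}" "(f has_real_derivative c) (at x within {a..b})" "(f has_real_derivative d) (at x within {a..b})"
  shows "c = d"
  using vector_derivative_unique_within_closed_interval[of a b x f c d] assms
  by (simp add: has_real_derivative_iff_has_vector_derivative)

theorem theorem1p2:
  fixes p :: real and i :: "'n::finite"
  assumes "1 < p" and "CARD('n) \<ge> 2"
  shows "\<exists>!k::real. k < 0 \<and>
    (\<exists>f :: real \<Rightarrow> real.
       (\<forall>t\<in>{0..<pi/2}. f t > 0) \<and> strict_antimono_on {0..pi/2} f \<and>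
       C2_on {0..pi/2} f \<and>
       f 0 = 1 \<and> (f has_real_derivative 0) (at 0 within {0..pi/2}) \<and> f (pi/2) = 0 \<and>
       (\<exists>d<0. (f has_real_derivative d) (at (pi/2) within {0..pi/2})) \<and>
       p_harmonic p (half_space i) (quasiradial i k f))"
    (is "\<exists>!k. ?A k")
proof (rule ex_ex1I)
  let ?e = "axis i 1 :: real ^ 'n"
  have e: "?e \<in> Basis" and dim: "2 \<le> DIM(real ^ 'n)" using assms(2) by (auto simp: axis_in_Basis_iff)
  show "\<exists>k. ?A k"
  proof -
    interpret shooting p "CARD('n) - 2" by unfold_locales (rule assms(1))
    \<comment> \<open>The subtraction is on natural numbers and is exact because the dimension is at
      least 2.\<close>
    have N: "real (CARD('n) - 2) + 2 = real DIM(real ^ 'n)" using assms(2) by simp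
    obtain \<beta> where \<beta>: "\<beta>0 < \<beta>" "\<beta> \<le> \<beta>1" "sol \<beta> (pi/2) = pi/2"
      by (rule exists_shooting_parameter)
    obtain f f' f'' where f: "\<And>t. t \<in> {0..pi/2} \<Longrightarrow> (f has_real_derivative f' t) (at t within {0..pi/2})"
      and f': "\<And>t. t \<in> {0..pi/2} \<Longrightarrow> (f' has_real_derivative f'' t) (at t within {0..pi/2})"
      and f'': "continuous_on {0..pi/2} f''" and pos: "\<And>t. 0 \<le> t \<Longrightarrow> t < pi/2 \<Longrightarrow> 0 < f t"
      and bc: "f 0 = 1" "f' 0 = 0" "f (pi/2) = 0" "f' (pi/2) < 0"
      and neg: "\<And>t. 0 < t \<Longrightarrow> t < pi/2 \<Longrightarrow> f' t < 0"
      and ode: "\<And>t. 0 < t \<Longrightarrow> t < pi/2 \<Longrightarrow> angular_ode p (real (CARD('n) - 2) + 2) (- \<beta>) t (f t) (f' t) (f'' t) = 0"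
      by (rule angular_solution_from_shooting[OF \<beta>]) (rule that)
    have b: "- \<beta> < 0" using \<beta>0_nonneg \<beta>(1) by linarith
    interpret angular_profile ?e p "- \<beta>" f f' f''
      by unfold_locales (fact e dim assms(1) b f f' f'' pos bc | use bc(4) in simp)+
    have "p_harmonic p (half_space i) (quasiradial i (- \<beta>) f)"
      unfolding half_space_eq quasiradial_eq using p_harmonic_iff_angular_ode ode N by simp
    moreover have "strict_antimono_on {0..pi/2} f"
    proof (rule monotone_onI)
      fix s t :: real assume st: "s \<in> {0..pi/2}" "t \<in> {0..pi/2}" "s < t"
      have "continuous_on {s..t} f" using st by (intro continuous_on_subset[OF cont_f(1)]) auto
      moreover have "\<exists>y. DERIV f x :> y \<and> y < 0" if "s < x" "x < t" for x
        using interior_derivs(1)[of x] neg[of x] that st by auto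
      ultimately show "f t < f s" using DERIV_neg_imp_decreasing_open[OF st(3), of f] by blast
    qed
    moreover have "C2_on {0..pi/2} f" unfolding C2_on_def using f f' f'' by blast
    moreover have "(f has_real_derivative 0) (at 0 within {0..pi/2})" using f[of 0] bc(2) by simp
    moreover have "(f has_real_derivative f' (pi/2)) (at (pi/2) within {0..pi/2})" using f[of "pi/2"] by simp
    moreover have "\<forall>t\<in>{0..<pi/2}. f t > 0" using pos by simp
    ultimately have "?A (- \<beta>)" using b bc by blast
    then show ?thesis by blast
  qed
  have sol: "\<exists>f f' f''. angular_solution ?e p k f f' f''" if A: "?A k" for k
  proof -
    obtain f where F: "\<And>t. t \<in> {0..<pi/2} \<Longrightarrow> 0 < f t" "C2_on {0..pi/2} f" "f 0 = 1"
      "(f has_real_derivative 0) (at 0 within {0..pi/2})" "f (pi/2) = 0"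
      "\<exists>d<0. (f has_real_derivative d) (at (pi/2) within {0..pi/2})"
      "p_harmonic p (half_space i) (quasiradial i k f)"
      using A by blast
    have k: "k < 0" using A by blast
    obtain f' f'' where f': "\<And>t. t \<in> {0..pi/2} \<Longrightarrow> (f has_real_derivative f' t) (at t within {0..pi/2})"
      and f'': "\<And>t. t \<in> {0..pi/2} \<Longrightarrow> (f' has_real_derivative f'' t) (at t within {0..pi/2})"
      and c: "continuous_on {0..pi/2} f''"
      using F(2) unfolding C2_on_def by blast
    \<comment> \<open>\<open>C2_on\<close> supplies some derivative \<open>f'\<close>; uniqueness of
      derivatives within the interval ties its end values to the prescribed ones.\<close>
    have d0: "f' 0 = 0" by (rule deriv_unique_within_Icc[OF pi_half_gt_zero _ f' F(4)]) auto
    have d1: "f' (pi/2) < 0"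
    proof -
      obtain d where d: "d < 0" "(f has_real_derivative d) (at (pi/2) within {0..pi/2})" using F(6) by blast
      have "f' (pi/2) = d" by (rule deriv_unique_within_Icc[OF pi_half_gt_zero _ f' d(2)]) auto
      then show ?thesis using d by simp
    qed
    interpret angular_profile ?e p k f f' f''
      by unfold_locales (fact e dim assms(1) k f' f'' c d0 | use F(1) d1 in simp)+
    have ode: "\<forall>t. 0 < t \<and> t < pi/2 \<longrightarrow> angular_ode p (real DIM(real ^ 'n)) k t (f t) (f' t) (f'' t) = 0"
      using F(7) unfolding half_space_eq quasiradial_eq by (rule p_harmonic_iff_angular_ode[THEN iffD1])
    have "angular_solution ?e p k f f' f''"
      by unfold_locales (fact F(3,5) d1 | use ode in blast)+
    then show ?thesis by blast
  qed
  fix k l assume A: "?A k" "?A l"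
  obtain f f' f'' where k: "angular_solution ?e p k f f' f''" using sol[OF A(1)] by (elim exE)
  obtain g g' g'' where l: "angular_solution ?e p l g g' g''" using sol[OF A(2)] by (elim exE)
  show "k = l"
    using angular_solution_exponent_not_less[OF k l] angular_solution_exponent_not_less[OF l k] by simp
qed

end
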